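(* Let $k\in\mathbb{N}$. For $1\leq j\leq k$ let $K_j$ be a number field, $\xi_j\in K_j$ not a root of unity, and $S_j$ a finite (possibly empty) set of finite places of $K_j$. For $1\leq j\leq k$ and $n\in\mathbb{N}$ put $c_{j,n}=\prod_{v\in M_{K_j}^\infty\cup S_j}|\xi_j^n-1|_v^{\delta_v}$. Then the power series $$Z(x)=\exp\left(\sum_{n=1}^\infty\prod_{j=1}^kc_{j,n}\frac{x^n}{n}\right)$$ is either rational or has a natural boundary at its circle of convergence, and the latter occurs if and only if there exist $1\leq j\leq k$ and $v\in S_j$ with $|\xi_j|_v=1$.
   Context: $M_{K}^\infty$ is the set of archimedean places of a number field $K$. For a place $v$ of $K$ over the place $p$ of $\mathbb{Q}$ ($p=\infty$ or a prime), $\delta_v=[K_v:\mathbb{Q}_p]$ and $|\cdot|_v$ is the absolute value on $K$ extending the usual absolute value $|\cdot|_p$ of $\mathbb{Q}$ (Euclidean or $p$-adic), i.e. $|a|_v=|\mathrm{Norm}_{K_v/\mathbb{Q}_p}(a)|_p^{1/\delta_v}$; thus $|a|_v^{\delta_v}=|\mathrm{Norm}_{K_v/\mathbb{Q}_p}(a)|_p$. A power series with radius of convergence $\rho$ has a natural boundary at its circle of convergence if it cannot be extended analytically to any connected open set strictly containing the disk $|x|<\rho$. *)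

theory Defs
  imports "HOL-Complex_Analysis.Complex_Analysis" "HOL-Algebra.Algebraic_Closure_Type"
begin

(* A number field is a subfield, of finite degree over the rationals, of some ambient field of
   characteristic 0.  The ambient field is a type; it may be the number field itself, the
   complex numbers, etc. *)
definition number_field :: "'a::field_char_0 set \<Rightarrow> bool" where
  "number_field K \<longleftrightarrow>
     subfield K (ring_of_type_algebra :: 'a ring) \<and>
     ring.finite_dimension (ring_of_type_algebra :: 'a ring) \<rat> K"

definition root_of_unity :: "'a::field \<Rightarrow> bool" where
  "root_of_unity x \<longleftrightarrow> (\<exists>n\<ge>1. x ^ n = 1)"


(* Extensionality makes an absolute value on K a single HOL function, so that sets of absolute
   values have the right cardinality and products over them are meaningful. *)
definition absolute_value :: "'a::field set \<Rightarrow> ('a \<Rightarrow> real) \<Rightarrow> bool" where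
  "absolute_value K v \<longleftrightarrow>
     v \<in> extensional K \<and>
     (\<forall>x\<in>K. 0 \<le> v x \<and> (v x = 0 \<longleftrightarrow> x = 0)) \<and>
     (\<forall>x\<in>K. \<forall>y\<in>K. v (x * y) = v x * v y) \<and>
     (\<forall>x\<in>K. \<forall>y\<in>K. v (x + y) \<le> v x + v y)"

definition padic_abs :: "nat \<Rightarrow> rat \<Rightarrow> real" where
  "padic_abs p q =
     (if q = 0 then 0
      else case quotient_of q of (a, b) \<Rightarrow>
        real p powi (int (multiplicity (int p) b) - int (multiplicity (int p) a)))"

(* A place v of K is represented by the unique absolute value in its class that extends the
   usual (Euclidean or p-adic) absolute value of the rationals.  So a place is itself a function,
   and v x is the number usually written |x|_v. *)
definition archimedean_places :: "'a::field_char_0 set \<Rightarrow> ('a \<Rightarrow> real) set" where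
  "archimedean_places K =
     {v. absolute_value K v \<and> (\<forall>q::rat. v (of_rat q) = \<bar>real_of_rat q\<bar>)}"

definition places_over :: "'a::field_char_0 set \<Rightarrow> nat \<Rightarrow> ('a \<Rightarrow> real) set" where
  "places_over K p =
     {v. absolute_value K v \<and> (\<forall>q::rat. v (of_rat q) = padic_abs p q)}"

definition finite_places :: "'a::field_char_0 set \<Rightarrow> ('a \<Rightarrow> real) set" where
  "finite_places K = (\<Union>p\<in>{p::nat. Factorial_Ring.prime p}. places_over K p)"


(* The completion K_v, as the ring of v-Cauchy sequences in K modulo the null sequences. *)
definition cauchy_seqs :: "'a::field set \<Rightarrow> ('a \<Rightarrow> real) \<Rightarrow> (nat \<Rightarrow> 'a) set" where
  "cauchy_seqs K v =
     {s. range s \<subseteq> K \<and> (\<forall>e>0. \<exists>N. \<forall>m\<ge>N. \<forall>n\<ge>N. v (s m - s n) < e)}"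

definition cauchy_ring :: "'a::field set \<Rightarrow> ('a \<Rightarrow> real) \<Rightarrow> (nat \<Rightarrow> 'a) ring" where
  "cauchy_ring K v =
     \<lparr>carrier = cauchy_seqs K v,
      monoid.mult = (\<lambda>s t n. s n * t n),
      one = (\<lambda>n. 1),
      ring.zero = (\<lambda>n. 0),
      add = (\<lambda>s t n. s n + t n)\<rparr>"

definition null_seqs :: "'a::field set \<Rightarrow> ('a \<Rightarrow> real) \<Rightarrow> (nat \<Rightarrow> 'a) set" where
  "null_seqs K v = {s. range s \<subseteq> K \<and> (\<lambda>n. v (s n)) \<longlonglongrightarrow> 0}"

definition completion :: "'a::field set \<Rightarrow> ('a \<Rightarrow> real) \<Rightarrow> (nat \<Rightarrow> 'a) set ring" where
  "completion K v = cauchy_ring K v Quot null_seqs K v"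

(* The copy of Q_p (of the real numbers if v is archimedean) inside K_v: the classes of the
   Cauchy sequences of rational numbers. *)
definition completion_rat :: "'a::field_char_0 set \<Rightarrow> ('a \<Rightarrow> real) \<Rightarrow> (nat \<Rightarrow> 'a) set set" where
  "completion_rat K v =
     {null_seqs K v +>\<^bsub>cauchy_ring K v\<^esub> s | s. s \<in> cauchy_seqs K v \<and> range s \<subseteq> \<rat>}"

definition local_degree :: "'a::field_char_0 set \<Rightarrow> ('a \<Rightarrow> real) \<Rightarrow> nat" where
  "local_degree K v =
     ring.dim (completion K v) (completion_rat K v) (carrier (completion K v))"


definition place_product ::
    "'a::field_char_0 set \<Rightarrow> ('a \<Rightarrow> real) set \<Rightarrow> 'a \<Rightarrow> nat \<Rightarrow> real" where
  "place_product K S \<xi> n =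
     (\<Prod>v\<in>archimedean_places K \<union> S. v (\<xi> ^ n - 1) ^ local_degree K v)"

(* exp (sum over n >= 1 of c n * x^n / n) as a formal power series *)
definition zeta_series :: "(nat \<Rightarrow> real) \<Rightarrow> complex fps" where
  "zeta_series c =
     fps_exp 1 oo Abs_fps (\<lambda>n. if n = 0 then 0 else complex_of_real (c n) / of_nat n)"

definition rational_series :: "complex fps \<Rightarrow> bool" where
  "rational_series F \<longleftrightarrow>
     (\<exists>P Q :: complex poly. Q \<noteq> 0 \<and> fps_of_poly Q * F = fps_of_poly P)"

(* Only a positive finite radius of convergence gives a circle of convergence. *)
definition has_natural_boundary :: "complex fps \<Rightarrow> bool" where
  "has_natural_boundary F \<longleftrightarrow>
     0 < fps_conv_radius F \<and> fps_conv_radius F < \<infinity> \<and>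
     \<not> (\<exists>U g. open U \<and> connected U \<and> eball 0 (fps_conv_radius F) \<subset> U \<and>
            g analytic_on U \<and> (\<forall>x\<in>eball 0 (fps_conv_radius F). g x = eval_fps F x))"

end

theory Submission
  imports Defs
begin

text \<open>
Each factor \<open>|\<xi>\<^sup>n - 1|\<^sub>v\<close> is of one of two kinds. At an archimedean place, which comes from a
complex embedding \<open>\<sigma>\<close>, and at a finite place with \<open>|\<xi>|\<^sub>v \<noteq> 1\<close>, it contributes an integer combination
of exponentials \<open>w\<^sup>n\<close>; if all factors are of this kind, then so is their product, and exponentiating
gives a finite product of powers of \<open>1 - w x\<close>. At a finite place over \<open>p\<close> with \<open>|\<xi>|\<^sub>v = 1\<close>
there are a number \<open>m\<close> and a strictly decreasing null sequence \<open>\<phi>\<close> such that the factor is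
\<open>\<phi>(v\<^sub>p(n))\<close> if \<open>m\<close> divides \<open>n\<close>, and 1 otherwise.

In the second case let \<open>\<zeta>\<close> be a primitive root of unity of order \<open>p\<^sup>j\<close> with \<open>j\<close> large. Let \<open>a\<^sub>n\<close> be the
coefficients, normalised by \<open>W\<^sup>n\<close>, where \<open>1/W\<close> is the radius of convergence. If the factors
above \<open>p\<close> are truncated at \<open>v\<^sub>p(n) < j\<close>, then \<open>a\<^sub>n \<zeta>\<^sup>n\<close> has Abel mean 0, because no frequency is resonant with
\<open>\<zeta>\<close>. The truncation error lives on the multiples \<open>n\<close> of \<open>p\<^sup>j\<close>, where \<open>\<zeta>\<^sup>n = 1\<close>, and has constant sign;
so the Abel mean of \<open>a\<^sub>n \<zeta>\<^sup>n\<close> is not 0. Hence the logarithmic derivative of \<open>Z\<close> blows up radially at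
\<open>\<zeta>/W\<close>, and an analytic extension of \<open>Z\<close> would vanish at a dense set of points of the circle.
\<close>

text \<open>The exponent \<open>local_degree\<close> is a dimension over a completion, and two facts
  about it carry the argument. It is positive; otherwise a factor with |\<xi>|_v = 1 would be
  constant. It is even at an archimedean place where the image of \<xi> is not real: |z^n - 1| alone
  is in general no exponential sum, but its square is one, with integer coefficients. Finiteness of
  the set of archimedean places matters too, because a HOL product over an infinite set is 1. What
  makes the singularity at \<zeta>/W hard to read off is that frequencies of the regular part on the
  unit circle may themselves be roots of unity, and that several primes may occur at once. There are
  only finitely many frequencies, so some Q kills all roots of unity among them, and resonance is
  excluded once p^j does not divide Q. The factors at primes other than p are uniform limits of
  periodic functions of n. The rest is positivity: on an arithmetic progression where all valuation
  factors are constant, the truncation error is a positive constant times the regular part, whose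
  Abel mean is positive.\<close>

section \<open>Completions of valued fields\<close>

text \<open>The tower K, K(x), R: the quadratic equation makes [K(x):K] = 2, and degrees multiply.
  This is the source of the even local degree at an archimedean place where the element has a
  non-real image.\<close>

lemma (in field) even_dim_of_quadratic_element:
  assumes K: "subfield K R" and fin: "finite_dimension K (carrier R)"
    and x: "x \<in> carrier R" "x \<notin> K" and ab: "a \<in> K" "b \<in> K"
    and eq: "x \<otimes> x = a \<otimes> x \<oplus> b"
  shows "even (dim K (carrier R))"
proof -
  note sub = subfieldE(1)[OF K]
  have KR: "K \<subseteq> carrier R" using subfieldE(3)[OF K] .
  have alg: "(algebraic over K) x"
    using finite_dimension_imp_algebraic[OF K carrier_is_subring fin x(1)] by (simp add: over_def)
  let ?F = "simple_extension K x"
  have F: "subfield ?F R" using simple_extension_is_subfield[OF K x(1)] alg by simp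
  have S1: "Span K [\<one>] = K"
  proof -
    have "Span K [\<one>] = line_extension K \<one> {\<zero>}" by simp
    also have "\<dots> = K"
    proof -
      have "x \<in> carrier R" if "x \<in> K" for x using that KR by blast
      hence "k \<otimes> \<one> \<oplus> \<zero> = k" if "k \<in> K" for k using that by simp
      thus ?thesis unfolding set_eq_iff line_extension_mem_iff by force
    qed
    finally show ?thesis .
  qed
  have memS: "u \<in> Span K [x, \<one>] \<longleftrightarrow> (\<exists>k\<in>K. \<exists>l\<in>K. u = k \<otimes> x \<oplus> l)" for u
  proof -
    have "Span K [x, \<one>] = line_extension K x (Span K [\<one>])" by simp
    thus ?thesis unfolding S1 by (simp only: line_extension_mem_iff)
  qed
  have "?F = Span K [x, \<one>]"
  proof
    \<comment> \<open>\<open>simple_extension\<close> is generated by Horner steps k1 x + k2, so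
      closure of the span under multiplication by x suffices; the quadratic equation lowers
      x^2.\<close>
    show "?F \<subseteq> Span K [x, \<one>]"
    proof
      fix u assume "u \<in> ?F"
      thus "u \<in> Span K [x, \<one>]"
      proof induct
        case zero
        have "\<zero> = \<zero> \<otimes> x \<oplus> \<zero>" using x by simp
        thus ?case unfolding memS using subringE(2)[OF sub] by blast
      next
        case (lin k1 k2)
        then obtain p q where pq: "p \<in> K" "q \<in> K" "k1 = p \<otimes> x \<oplus> q" unfolding memS by blast
        have car: "p \<in> carrier R" "q \<in> carrier R" "k2 \<in> carrier R" "a \<in> carrier R" "b \<in> carrier R"
          using pq lin ab KR by auto
        have "k1 \<otimes> x \<oplus> k2 = p \<otimes> (x \<otimes> x) \<oplus> q \<otimes> x \<oplus> k2"
          unfolding pq using car x(1) by algebra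
        also have "\<dots> = (p \<otimes> a \<oplus> q) \<otimes> x \<oplus> (p \<otimes> b \<oplus> k2)"
          unfolding eq using car x(1) by algebra
        finally show ?case unfolding memS
          using subringE(6,7)[OF sub] pq lin ab by blast
      qed
    qed
    show "Span K [x, \<one>] \<subseteq> ?F"
    proof
      fix u assume "u \<in> Span K [x, \<one>]"
      then obtain k l where "k \<in> K" "l \<in> K" "u = k \<otimes> x \<oplus> l" unfolding memS by blast
      thus "u \<in> ?F"
        using simple_extension_incl[OF KR x(1)] simple_extension.lin by blast
    qed
  qed
  moreover have "independent K [x, \<one>]"
  proof (intro li_Cons)
    show "x \<notin> Span K [\<one>]" unfolding S1 by fact
    show "\<one> \<notin> Span K []" by simp
  qed (use x in \<open>simp_all del: Span.simps\<close>)
  ultimately have d2: "dimension 2 K ?F"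
    using dimension_independent[of K "[x, \<one>]"] by (simp del: Span.simps add: numeral_2_eq_2)
  \<comment> \<open>Generators of R over K also generate it over K(x); this gives the finite
    dimension that the degree formula asks for.\<close>
  obtain d where d: "dimension d K (carrier R)" using fin by auto
  obtain Us where Us: "set Us \<subseteq> carrier R" "Span K Us = carrier R"
    using exists_base[OF K d] by blast
  have "K \<subseteq> ?F" using simple_extension_incl[OF KR x(1)] .
  hence "K <#> set Us \<subseteq> Span ?F Us"
    using Span_incl[OF F Us(1)] unfolding set_mult_def by blast
  hence "Span K Us \<subseteq> Span ?F Us"
    using Span_min[OF K Us(1) Span_is_add_subgroup[OF F Us(1)]] by blast
  hence "Span ?F Us = carrier R"
    using Us(2) Span_in_carrier[OF subfieldE(3)[OF F] Us(1)] by (metis subset_antisym)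
  hence "finite_dimension ?F (carrier R)"
    using Span_finite_dimension[OF F Us(1)] by simp
  then obtain m where "dimension m ?F (carrier R)" by auto
  hence "dimension (2 * m) K (carrier R)" using telescopic_base[OF K F d2] by blast
  hence "dim K (carrier R) = 2 * m" using dimI[OF K] by (simp add: over_def)
  thus ?thesis by simp
qed

text \<open>A field is not the zero ring, so its dimension cannot be 0. For K_v this makes
  \<open>local_degree\<close> a genuine exponent.\<close>

lemma (in field) dim_carrier_pos:
  assumes K: "subfield K R" and fin: "finite_dimension K (carrier R)"
  shows "0 < dim K (carrier R)"
proof (rule ccontr)
  assume "\<not> 0 < dim K (carrier R)"
  hence "dimension 0 K (carrier R)"
    using finite_dimensionE[OF K fin] unfolding over_def by simp
  hence "carrier R = {\<zero>}" by (rule dimension_zero[OF K])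
  hence "\<one> = \<zero>" using one_closed by blast
  thus False by simp
qed

section \<open>Absolute values on a subfield\<close>

lemma subfield_ring_of_type_algebraD:
  fixes K :: "'a::field set"
  assumes "subfield K (ring_of_type_algebra :: 'a ring)"
  shows "0 \<in> K" "1 \<in> K" "x \<in> K \<Longrightarrow> y \<in> K \<Longrightarrow> x + y \<in> K" "x \<in> K \<Longrightarrow> y \<in> K \<Longrightarrow> x * y \<in> K"
    "x \<in> K \<Longrightarrow> - x \<in> K" "x \<in> K \<Longrightarrow> inverse x \<in> K"
proof -
  let ?R = "ring_of_type_algebra :: 'a ring"
  interpret R: field ?R by (rule field_from_type_algebra)
  note sub = subfieldE(1)[OF assms]
  note s [simp] = ring_of_type_algebra_def
  show "0 \<in> K" "1 \<in> K" "x \<in> K \<Longrightarrow> y \<in> K \<Longrightarrow> x + y \<in> K" "x \<in> K \<Longrightarrow> y \<in> K \<Longrightarrow> x * y \<in> K"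
    using subringE[OF sub] by auto
  show "- x \<in> K" if "x \<in> K"
  proof -
    have "\<ominus>\<^bsub>?R\<^esub> x \<in> K" using subringE(5)[OF sub that] .
    moreover have "x + \<ominus>\<^bsub>?R\<^esub> x = 0" using R.r_neg[of x] by simp
    hence "\<ominus>\<^bsub>?R\<^esub> x = - x" by (simp add: eq_neg_iff_add_eq_0 add.commute)
    ultimately show ?thesis by simp
  qed
  show "inverse x \<in> K" if "x \<in> K"
  proof (cases "x = 0")
    case False
    have "inv\<^bsub>?R\<^esub> x \<in> K" "x * inv\<^bsub>?R\<^esub> x = 1"
      using R.subfield_m_inv[OF assms, of x] that False by auto
    hence "inverse x = inv\<^bsub>?R\<^esub> x" by (intro inverse_unique)
    with \<open>inv\<^bsub>?R\<^esub> x \<in> K\<close> show ?thesis by simp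
  qed (use \<open>0 \<in> K\<close> in simp)
qed

locale valued_subfield =
  fixes K :: "'a::field_char_0 set" and v :: "'a \<Rightarrow> real"
  assumes subfield: "subfield K (ring_of_type_algebra :: 'a ring)"
    and absolute_value: "absolute_value K v"
begin

lemmas zero_mem [simp, intro] = subfield_ring_of_type_algebraD(1)[OF subfield]
lemmas one_mem [simp, intro] = subfield_ring_of_type_algebraD(2)[OF subfield]
lemmas add_mem [intro] = subfield_ring_of_type_algebraD(3)[OF subfield]
lemmas mult_mem [intro] = subfield_ring_of_type_algebraD(4)[OF subfield]
lemmas uminus_mem [intro] = subfield_ring_of_type_algebraD(5)[OF subfield]
lemmas inverse_mem [intro] = subfield_ring_of_type_algebraD(6)[OF subfield]

lemma diff_mem [intro]: "x \<in> K \<Longrightarrow> y \<in> K \<Longrightarrow> x - y \<in> K"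
  using add_mem[of x "- y"] uminus_mem by simp

lemma divide_mem [intro]: "x \<in> K \<Longrightarrow> y \<in> K \<Longrightarrow> x / y \<in> K"
  using mult_mem[of x "inverse y"] inverse_mem by (simp add: divide_inverse)

lemma of_nat_mem [simp, intro]: "of_nat n \<in> K"
  by (induction n) auto

lemma of_int_mem [simp, intro]: "of_int n \<in> K"
  by (cases n rule: int_diff_cases) auto

lemma of_rat_mem [simp, intro]: "of_rat q \<in> K"
  by (cases q) (auto simp: of_rat_rat)

lemma power_mem [intro]: "x \<in> K \<Longrightarrow> x ^ n \<in> K"
  by (induction n) auto

lemma sum_mem [intro]: "(\<And>i. i \<in> A \<Longrightarrow> f i \<in> K) \<Longrightarrow> sum f A \<in> K"
  by (induction A rule: infinite_finite_induct) auto

lemma v_nonneg [simp]: "x \<in> K \<Longrightarrow> 0 \<le> v x"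
  and v_eq_0_iff [simp]: "x \<in> K \<Longrightarrow> v x = 0 \<longleftrightarrow> x = 0"
  and v_mult: "x \<in> K \<Longrightarrow> y \<in> K \<Longrightarrow> v (x * y) = v x * v y"
  and v_add_le: "x \<in> K \<Longrightarrow> y \<in> K \<Longrightarrow> v (x + y) \<le> v x + v y"
  using absolute_value by (auto simp: absolute_value_def)

lemma v_0 [simp]: "v 0 = 0" by simp

lemma v_1 [simp]: "v 1 = 1"
  using v_mult[of 1 1] v_eq_0_iff[of 1] by simp

lemma v_pos: "x \<in> K \<Longrightarrow> x \<noteq> 0 \<Longrightarrow> 0 < v x"
  using v_nonneg[of x] v_eq_0_iff[of x] by linarith

lemma v_minus [simp]: "x \<in> K \<Longrightarrow> v (- x) = v x"
proof -
  assume x: "x \<in> K"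
  have "v (-1) * v (-1) = 1" using v_mult[of "-1" "-1"] uminus_mem[of 1] by simp
  hence "v (-1) = 1 \<or> v (-1) = -1" by (simp only: square_eq_1_iff)
  moreover have "0 \<le> v (-1)" using v_nonneg[OF uminus_mem[OF one_mem]] .
  ultimately have "v (-1) = 1" by linarith
  thus ?thesis using v_mult[of "-1" x] uminus_mem[of 1] x by simp
qed

lemma v_diff_le: "x \<in> K \<Longrightarrow> y \<in> K \<Longrightarrow> v (x - y) \<le> v x + v y"
  using v_add_le[of x "- y"] uminus_mem by simp

lemma v_diff_commute: "x \<in> K \<Longrightarrow> y \<in> K \<Longrightarrow> v (x - y) = v (y - x)"
  using v_minus[of "x - y"] diff_mem[of x y] by simp

lemma v_abs_diff_le: "x \<in> K \<Longrightarrow> y \<in> K \<Longrightarrow> \<bar>v x - v y\<bar> \<le> v (x - y)"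
  using v_add_le[of "x - y" y] v_add_le[of "y - x" x] v_diff_commute[of x y]
    diff_mem[of x y] diff_mem[of y x] by (simp add: abs_le_iff)

lemma v_power: "x \<in> K \<Longrightarrow> v (x ^ n) = v x ^ n"
  by (induction n) (auto simp: v_mult power_mem)

lemma v_inverse: "x \<in> K \<Longrightarrow> v (inverse x) = inverse (v x)"
proof (cases "x = 0")
  case False
  assume x: "x \<in> K"
  have "v x * v (inverse x) = 1"
    using v_mult[of x "inverse x"] x False inverse_mem[of x] by simp
  thus ?thesis by (metis inverse_unique)
qed simp

lemma v_divide: "x \<in> K \<Longrightarrow> y \<in> K \<Longrightarrow> v (x / y) = v x / v y"
  by (simp add: divide_inverse v_mult inverse_mem v_inverse)

lemma v_sum_le: "(\<And>i. i \<in> A \<Longrightarrow> f i \<in> K) \<Longrightarrow> v (sum f A) \<le> (\<Sum>i\<in>A. v (f i))"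
proof (induction A rule: infinite_finite_induct)
  case (insert x F)
  have "v (f x + sum f F) \<le> v (f x) + v (sum f F)"
    using insert by (intro v_add_le sum_mem) auto
  thus ?case using insert by fastforce
qed auto

end

text \<open>Recursion on the list permits the induction over generators in
  \<open>cauchy_rat_span_cls\<close>. The lemmas \<open>rat_span_eq\<close> and
  \<open>ring_Span_Rats\<close> identify the result with both library notions of span.\<close>

fun rat_span :: "'a::field_char_0 list \<Rightarrow> 'a set" where
  "rat_span [] = {0}"
| "rat_span (b # bs) = {of_rat q * b + y | q y. y \<in> rat_span bs}"

lemma rat_span_zero: "0 \<in> rat_span bs"
proof (induction bs)
  case (Cons b bs)
  have "(0::'a) = of_rat 0 * b + 0" by simp
  thus ?case unfolding rat_span.simps using Cons by blast
qed simp

lemma rat_span_add: "x \<in> rat_span bs \<Longrightarrow> y \<in> rat_span bs \<Longrightarrow> x + y \<in> rat_span bs"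
proof (induction bs arbitrary: x y)
  case (Cons b bs)
  then obtain p q x' y' where *: "x = of_rat p * b + x'" "y = of_rat q * b + y'"
    "x' \<in> rat_span bs" "y' \<in> rat_span bs" by auto
  have "x + y = of_rat (p + q) * b + (x' + y')" using * by (simp add: algebra_simps of_rat_add)
  thus ?case unfolding rat_span.simps using Cons.IH * by blast
qed simp

lemma rat_span_scale: "x \<in> rat_span bs \<Longrightarrow> of_rat q * x \<in> rat_span bs"
proof (induction bs arbitrary: x)
  case (Cons b bs)
  then obtain p x' where *: "x = of_rat p * b + x'" "x' \<in> rat_span bs" by auto
  have "of_rat q * x = of_rat (q * p) * b + of_rat q * x'"
    using * by (simp add: algebra_simps of_rat_mult)
  thus ?case unfolding rat_span.simps using Cons.IH * by blast
qed simp

lemma (in ideal) carrier_Quot: "carrier (R Quot I) = (+>) I ` carrier R"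
  by (auto simp: FactRing_def A_RCOSETS_def')

lemma (in ideal) zero_Quot: "\<zero>\<^bsub>R Quot I\<^esub> = I"
  by (simp add: FactRing_def)

section \<open>The completion and the classes of rational sequences in it\<close>

context valued_subfield
begin

lemma rat_span_subset: "set bs \<subseteq> K \<Longrightarrow> rat_span bs \<subseteq> K"
  by (induction bs) auto

abbreviation "C \<equiv> cauchy_ring K v"
abbreviation "N \<equiv> null_seqs K v"
abbreviation "cls s \<equiv> N +>\<^bsub>C\<^esub> s"

lemma cauchy_seqsD: "s \<in> cauchy_seqs K v \<Longrightarrow> s n \<in> K"
  "s \<in> cauchy_seqs K v \<Longrightarrow> 0 < e \<Longrightarrow> \<exists>M. \<forall>m\<ge>M. \<forall>n\<ge>M. v (s m - s n) < e"
  by (auto simp: cauchy_seqs_def)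

lemma cauchy_seqsI:
  "(\<And>n. s n \<in> K) \<Longrightarrow> (\<And>e. 0 < e \<Longrightarrow> \<exists>M. \<forall>m\<ge>M. \<forall>n\<ge>M. v (s m - s n) < e) \<Longrightarrow> s \<in> cauchy_seqs K v"
  by (auto simp: cauchy_seqs_def)

lemma null_seqs_iff: "s \<in> N \<longleftrightarrow> (\<forall>n. s n \<in> K) \<and> (\<lambda>n. v (s n)) \<longlonglongrightarrow> 0"
  by (auto simp: null_seqs_def)

lemma null_seqsD: "s \<in> N \<Longrightarrow> 0 < e \<Longrightarrow> \<exists>M. \<forall>n\<ge>M. v (s n) < e"
proof -
  assume s: "s \<in> N" "0 < e"
  hence "eventually (\<lambda>n. v (s n) < e) sequentially"
    unfolding null_seqs_iff by (intro order_tendstoD) auto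
  thus ?thesis by (simp add: eventually_sequentially)
qed

lemma null_seqsI:
  assumes "\<And>n. s n \<in> K" "\<And>n. v (s n) \<le> b n" "b \<longlonglongrightarrow> 0"
  shows "s \<in> N"
proof -
  have "(\<lambda>n. v (s n)) \<longlonglongrightarrow> 0"
    using assms by (intro tendsto_sandwich[OF _ _ tendsto_const assms(3)]) auto
  thus ?thesis using assms(1) by (simp add: null_seqs_iff)
qed

lemma null_add: "s \<in> N \<Longrightarrow> t \<in> N \<Longrightarrow> (\<lambda>n. s n + t n) \<in> N"
  by (rule null_seqsI[of _ "\<lambda>n. v (s n) + v (t n)"])
     (auto simp: null_seqs_iff add_mem v_add_le intro: tendsto_add_zero)

lemma null_uminus: "s \<in> N \<Longrightarrow> (\<lambda>n. - s n) \<in> N"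
  by (auto simp: null_seqs_iff)

lemma cauchy_add: "s \<in> cauchy_seqs K v \<Longrightarrow> t \<in> cauchy_seqs K v \<Longrightarrow> (\<lambda>n. s n + t n) \<in> cauchy_seqs K v"
proof (rule cauchy_seqsI)
  fix e :: real assume s: "s \<in> cauchy_seqs K v" and t: "t \<in> cauchy_seqs K v" and e: "0 < e"
  obtain M1 where M1: "\<forall>m\<ge>M1. \<forall>n\<ge>M1. v (s m - s n) < e/2" using cauchy_seqsD(2)[OF s, of "e/2"] e by auto
  obtain M2 where M2: "\<forall>m\<ge>M2. \<forall>n\<ge>M2. v (t m - t n) < e/2" using cauchy_seqsD(2)[OF t, of "e/2"] e by auto
  have "v (s m + t m - (s n + t n)) < e" if "m \<ge> max M1 M2" "n \<ge> max M1 M2" for m n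
  proof -
    have "v (s m + t m - (s n + t n)) = v ((s m - s n) + (t m - t n))" by (simp add: algebra_simps)
    also have "\<dots> \<le> v (s m - s n) + v (t m - t n)"
      using s t by (intro v_add_le diff_mem cauchy_seqsD(1))
    also have "\<dots> < e" using M1 M2 that by fastforce
    finally show ?thesis .
  qed
  thus "\<exists>M. \<forall>m\<ge>M. \<forall>n\<ge>M. v (s m + t m - (s n + t n)) < e" by blast
qed (auto dest: cauchy_seqsD(1))

lemma cauchy_bounded: "s \<in> cauchy_seqs K v \<Longrightarrow> \<exists>B>0. \<forall>n. v (s n) \<le> B"
proof -
  assume s: "s \<in> cauchy_seqs K v"
  have sK: "s n \<in> K" for n using s by (rule cauchy_seqsD)
  obtain M where M: "\<forall>m\<ge>M. \<forall>n\<ge>M. v (s m - s n) < 1" using cauchy_seqsD(2)[OF s, of 1] by auto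
  define B where "B = 1 + v (s M) + (\<Sum>i<M. v (s i))"
  have nn: "0 \<le> (\<Sum>i<M. v (s i))" by (intro sum_nonneg v_nonneg sK)
  have "v (s n) \<le> B" for n
  proof (cases "n < M")
    case True
    hence "v (s n) \<le> (\<Sum>i<M. v (s i))" by (intro member_le_sum) (auto simp: sK)
    thus ?thesis using v_nonneg[OF sK[of M]] by (simp add: B_def)
  next
    case False
    have "v (s n) \<le> v (s n - s M) + v (s M)" using v_add_le[of "s n - s M" "s M"] sK by auto
    also have "v (s n - s M) < 1" using M False by auto
    finally show ?thesis using nn by (simp add: B_def)
  qed
  moreover have "B > 0" using nn v_nonneg[OF sK[of M]] by (simp add: B_def)
  ultimately show ?thesis by blast
qed

lemma cauchy_mult: "s \<in> cauchy_seqs K v \<Longrightarrow> t \<in> cauchy_seqs K v \<Longrightarrow> (\<lambda>n. s n * t n) \<in> cauchy_seqs K v"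
proof (rule cauchy_seqsI)
  fix e :: real assume s: "s \<in> cauchy_seqs K v" and t: "t \<in> cauchy_seqs K v" and e: "0 < e"
  have sK: "s n \<in> K" and tK: "t n \<in> K" for n using s t by (auto dest: cauchy_seqsD)
  obtain A where A: "A > 0" "\<And>n. v (s n) \<le> A" using cauchy_bounded[OF s] by auto
  obtain B where B: "B > 0" "\<And>n. v (t n) \<le> B" using cauchy_bounded[OF t] by auto
  obtain M1 where M1: "\<forall>m\<ge>M1. \<forall>n\<ge>M1. v (s m - s n) < e/(2*B)"
    using cauchy_seqsD(2)[OF s, of "e/(2*B)"] e B by auto
  obtain M2 where M2: "\<forall>m\<ge>M2. \<forall>n\<ge>M2. v (t m - t n) < e/(2*A)"
    using cauchy_seqsD(2)[OF t, of "e/(2*A)"] e A by auto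
  have "v (s m * t m - s n * t n) < e" if "m \<ge> max M1 M2" "n \<ge> max M1 M2" for m n
  proof -
    have "v (s m * t m - s n * t n) = v ((s m - s n) * t m + s n * (t m - t n))" by (simp add: algebra_simps)
    also have "\<dots> \<le> v ((s m - s n) * t m) + v (s n * (t m - t n))"
      using sK tK by (intro v_add_le) auto
    also have "\<dots> = v (s m - s n) * v (t m) + v (s n) * v (t m - t n)"
      using sK tK by (simp add: v_mult diff_mem)
    also have "v (s m - s n) * v (t m) \<le> v (s m - s n) * B"
      using B sK by (intro mult_left_mono) (auto simp: diff_mem)
    also have "v (s m - s n) * B < e/(2*B) * B"
      using M1 that B by (intro mult_strict_right_mono) auto
    also have "v (s n) * v (t m - t n) \<le> A * v (t m - t n)"
      using A tK by (intro mult_right_mono) (auto simp: diff_mem)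
    also have "A * v (t m - t n) \<le> A * (e/(2*A))"
      using M2 that A by (intro mult_left_mono) (auto simp: less_imp_le)
    finally show ?thesis using A B by simp
  qed
  thus "\<exists>M. \<forall>m\<ge>M. \<forall>n\<ge>M. v (s m * t m - s n * t n) < e" by blast
qed (auto dest: cauchy_seqsD(1))

lemma cauchy_const [simp]: "x \<in> K \<Longrightarrow> (\<lambda>n. x) \<in> cauchy_seqs K v"
  by (rule cauchy_seqsI) auto

lemma cauchy_uminus: "s \<in> cauchy_seqs K v \<Longrightarrow> (\<lambda>n. - s n) \<in> cauchy_seqs K v"
  using cauchy_mult[OF cauchy_const[of "-1"]] uminus_mem[OF one_mem] by simp

lemma cauchy_diff: "s \<in> cauchy_seqs K v \<Longrightarrow> t \<in> cauchy_seqs K v \<Longrightarrow> (\<lambda>n. s n - t n) \<in> cauchy_seqs K v"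
  using cauchy_add[OF _ cauchy_uminus] by fastforce

lemma null_mult: "s \<in> N \<Longrightarrow> t \<in> cauchy_seqs K v \<Longrightarrow> (\<lambda>n. s n * t n) \<in> N"
proof -
  assume s: "s \<in> N" and t: "t \<in> cauchy_seqs K v"
  have sK: "s n \<in> K" and tK: "t n \<in> K" for n using s t by (auto dest: cauchy_seqsD simp: null_seqs_iff)
  obtain B where B: "B > 0" "\<And>n. v (t n) \<le> B" using cauchy_bounded[OF t] by auto
  have "(\<lambda>n. v (s n) * B) \<longlonglongrightarrow> 0 * B" using s by (intro tendsto_intros) (auto simp: null_seqs_iff)
  moreover have "v (s n * t n) \<le> v (s n) * B" for n
    using B[of] sK tK by (auto simp: v_mult intro!: mult_left_mono)
  ultimately show ?thesis
    using sK tK by (intro null_seqsI[of _ "\<lambda>n. v (s n) * B"]) auto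
qed

lemma null_cauchy: "s \<in> N \<Longrightarrow> s \<in> cauchy_seqs K v"
proof (rule cauchy_seqsI)
  fix e :: real assume s: "s \<in> N" "0 < e"
  have sK: "s n \<in> K" for n using s by (auto simp: null_seqs_iff)
  obtain M where M: "\<forall>n\<ge>M. v (s n) < e / 2" using null_seqsD[OF s(1), of "e/2"] s by auto
  have "v (s m - s n) < e" if "m \<ge> M" "n \<ge> M" for m n
  proof -
    have "v (s m) < e / 2" "v (s n) < e / 2" using M that by auto
    thus ?thesis using v_diff_le[OF sK sK, of m n] by linarith
  qed
  thus "\<exists>M. \<forall>m\<ge>M. \<forall>n\<ge>M. v (s m - s n) < e" by blast
qed (auto simp: null_seqs_iff)

lemma cauchy_ring_simps [simp]:
  "carrier C = cauchy_seqs K v" "s \<otimes>\<^bsub>C\<^esub> t = (\<lambda>n. s n * t n)" "\<one>\<^bsub>C\<^esub> = (\<lambda>n. 1)"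
  "\<zero>\<^bsub>C\<^esub> = (\<lambda>n. 0)" "s \<oplus>\<^bsub>C\<^esub> t = (\<lambda>n. s n + t n)"
  by (simp_all add: cauchy_ring_def)

sublocale C: cring C
proof (rule cringI)
  show "abelian_group C"
  proof (rule abelian_groupI)
    fix s assume "s \<in> carrier C"
    thus "\<exists>t\<in>carrier C. t \<oplus>\<^bsub>C\<^esub> s = \<zero>\<^bsub>C\<^esub>"
      by (intro bexI[of _ "\<lambda>n. - s n"]) (auto simp: cauchy_uminus)
  qed (auto simp: cauchy_add algebra_simps)
  show "comm_monoid C"
    by (rule comm_monoidI) (auto simp: cauchy_mult algebra_simps)
qed (auto simp: algebra_simps)

lemma C_uminus: "s \<in> cauchy_seqs K v \<Longrightarrow> \<ominus>\<^bsub>C\<^esub> s = (\<lambda>n. - s n)"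
  by (rule C.minus_equality) (auto simp: cauchy_uminus)

lemma C_minus: "s \<in> cauchy_seqs K v \<Longrightarrow> t \<in> cauchy_seqs K v \<Longrightarrow> s \<ominus>\<^bsub>C\<^esub> t = (\<lambda>n. s n - t n)"
  by (simp add: a_minus_def C_uminus)

lemma null_const_iff: "x \<in> K \<Longrightarrow> (\<lambda>n. x) \<in> N \<longleftrightarrow> x = 0"
  by (auto simp: null_seqs_iff LIMSEQ_const_iff)

sublocale N: ideal N C
proof (rule idealI)
  show "subgroup N (add_monoid C)"
  proof
    show "N \<subseteq> carrier (add_monoid C)" by (auto intro: null_cauchy)
    fix x assume x: "x \<in> N"
    show "inv\<^bsub>add_monoid C\<^esub> x \<in> N"
      using C_uminus[OF null_cauchy[OF x]] null_uminus[OF x] by (simp add: a_inv_def)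
  qed (auto intro: null_add simp: null_const_iff)
  fix s t assume st: "s \<in> N" "t \<in> carrier C"
  show "s \<otimes>\<^bsub>C\<^esub> t \<in> N" using null_mult[of s t] st by simp
  thus "t \<otimes>\<^bsub>C\<^esub> s \<in> N" by (simp add: mult.commute)
qed (rule C.ring_axioms)

abbreviation "Q \<equiv> completion K v"

lemma completion_eq: "Q = C Quot N" by (simp add: completion_def)

sublocale Q: cring Q
  unfolding completion_eq by (rule N.quotient_is_cring) (rule C.cring_axioms)

lemma carrier_Q: "carrier Q = cls ` cauchy_seqs K v"
  unfolding completion_eq N.carrier_Quot cauchy_ring_simps ..

lemma cls_mem [simp]: "s \<in> cauchy_seqs K v \<Longrightarrow> cls s \<in> carrier Q"
  unfolding carrier_Q by (rule imageI)

lemmas cls_hom = N.rcos_ring_hom[folded completion_eq]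

lemma cls_mult [simp]: "s \<in> cauchy_seqs K v \<Longrightarrow> t \<in> cauchy_seqs K v \<Longrightarrow>
    cls s \<otimes>\<^bsub>Q\<^esub> cls t = cls (\<lambda>n. s n * t n)"
  using ring_hom_mult[OF cls_hom, of s t] unfolding cauchy_ring_simps by simp

lemma cls_add [simp]: "s \<in> cauchy_seqs K v \<Longrightarrow> t \<in> cauchy_seqs K v \<Longrightarrow>
    cls s \<oplus>\<^bsub>Q\<^esub> cls t = cls (\<lambda>n. s n + t n)"
  using ring_hom_add[OF cls_hom, of s t] unfolding cauchy_ring_simps by simp

lemma cls_one: "\<one>\<^bsub>Q\<^esub> = cls (\<lambda>n. 1)"
  using ring_hom_one[OF cls_hom] unfolding cauchy_ring_simps by simp

lemma cls_zero: "\<zero>\<^bsub>Q\<^esub> = cls (\<lambda>n. 0)"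
  using C.a_rcos_zero[OF N.is_ideal, of "\<lambda>n. 0"] null_const_iff[of 0]
  unfolding completion_eq N.zero_Quot by simp

lemma cls_eq_iff: "s \<in> cauchy_seqs K v \<Longrightarrow> t \<in> cauchy_seqs K v \<Longrightarrow>
    cls s = cls t \<longleftrightarrow> (\<lambda>n. s n - t n) \<in> N"
  using C.quotient_eq_iff_same_a_r_cos[OF N.is_ideal, of s t] by (simp add: C_minus)

lemma cauchy_null_diff:
  assumes "s \<in> cauchy_seqs K v" "(\<lambda>n. s n - t n) \<in> N" "\<And>n. t n \<in> K"
  shows "t \<in> cauchy_seqs K v" "cls t = cls s"
proof -
  have "(\<lambda>n. s n - (s n - t n)) \<in> cauchy_seqs K v"
    by (rule cauchy_diff[OF assms(1) null_cauchy[OF assms(2)]])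
  thus t: "t \<in> cauchy_seqs K v" by simp
  show "cls t = cls s" using cls_eq_iff[OF assms(1) t] assms by simp
qed

text \<open>A Cauchy sequence that is not null stays away from 0, so the pointwise inverse is Cauchy.\<close>

lemma cauchy_inverse:
  assumes s: "s \<in> cauchy_seqs K v" and nz: "s \<notin> N"
  shows "(\<lambda>n. inverse (s n)) \<in> cauchy_seqs K v" "(\<lambda>n. s n * inverse (s n) - 1) \<in> N"
proof -
  have sK: "s n \<in> K" for n using s by (rule cauchy_seqsD)
  from nz have "\<not> (\<lambda>n. v (s n)) \<longlonglongrightarrow> 0" using sK by (simp add: null_seqs_iff)
  then obtain e where e: "e > 0" "\<forall>M. \<exists>n\<ge>M. v (s n) \<ge> e"
    unfolding LIMSEQ_def using sK by (auto simp: not_less)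
  obtain M where M: "\<forall>m\<ge>M. \<forall>n\<ge>M. v (s m - s n) < e/2" using cauchy_seqsD(2)[OF s, of "e/2"] e by auto
  have low: "v (s n) \<ge> e/2" if "n \<ge> M" for n
  proof -
    obtain m where m: "m \<ge> M" "v (s m) \<ge> e" using e by blast
    have "v (s m) \<le> v (s m - s n) + v (s n)" using v_add_le[of "s m - s n" "s n"] sK by auto
    moreover have "v (s m - s n) < e/2" using M m that by blast
    ultimately show ?thesis using m by simp
  qed
  have nz: "s n \<noteq> 0" if "n \<ge> M" for n using low[OF that] e by auto
  show "(\<lambda>n. inverse (s n)) \<in> cauchy_seqs K v"
  proof (rule cauchy_seqsI)
    fix d :: real assume d: "d > 0"
    then obtain M2 where M2: "\<forall>m\<ge>M2. \<forall>n\<ge>M2. v (s m - s n) < d * (e/2 * (e/2))"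
      using cauchy_seqsD(2)[OF s, of "d * (e/2 * (e/2))"] e by auto
    have "v (inverse (s m) - inverse (s n)) < d" if mn: "m \<ge> max M M2" "n \<ge> max M M2" for m n
    proof -
      have "inverse (s m) - inverse (s n) = (s n - s m) / (s m * s n)"
        using nz[of m] nz[of n] mn by (simp add: field_simps)
      hence "v (inverse (s m) - inverse (s n)) = v (s n - s m) / (v (s m) * v (s n))"
        using sK by (simp add: v_divide v_mult diff_mem mult_mem)
      also have "\<dots> \<le> v (s n - s m) / (e/2 * (e/2))"
        using low[of m] low[of n] mn e sK by (intro divide_left_mono mult_mono mult_pos_pos) (auto simp: diff_mem)
      also have "\<dots> < d" using M2 mn e by (simp add: divide_less_eq)
      finally show ?thesis .
    qed
    thus "\<exists>M. \<forall>m\<ge>M. \<forall>n\<ge>M. v (inverse (s m) - inverse (s n)) < d" by blast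
  qed (use sK in auto)
  have "eventually (\<lambda>n. v (s n * inverse (s n) - 1) = 0) sequentially"
    using eventually_ge_at_top[of M] by eventually_elim (simp add: nz)
  hence "(\<lambda>n. v (s n * inverse (s n) - 1)) \<longlonglongrightarrow> 0" by (rule tendsto_eventually)
  thus "(\<lambda>n. s n * inverse (s n) - 1) \<in> N" using sK by (auto simp: null_seqs_iff)
qed

lemma cls_inverse:
  assumes "s \<in> cauchy_seqs K v" "cls s \<noteq> \<zero>\<^bsub>Q\<^esub>"
  shows "(\<lambda>n. inverse (s n)) \<in> cauchy_seqs K v" "cls s \<otimes>\<^bsub>Q\<^esub> cls (\<lambda>n. inverse (s n)) = \<one>\<^bsub>Q\<^esub>"
proof -
  have "s \<notin> N" using assms cls_eq_iff[OF assms(1) cauchy_const[of 0]] by (auto simp: cls_zero)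
  note * = cauchy_inverse[OF assms(1) this]
  show "(\<lambda>n. inverse (s n)) \<in> cauchy_seqs K v" by fact
  thus "cls s \<otimes>\<^bsub>Q\<^esub> cls (\<lambda>n. inverse (s n)) = \<one>\<^bsub>Q\<^esub>"
    using * assms by (simp add: cls_one cls_eq_iff cauchy_mult)
qed

sublocale Q: field Q
proof (rule Q.cring_fieldI2)
  show "\<zero>\<^bsub>Q\<^esub> \<noteq> \<one>\<^bsub>Q\<^esub>"
    using null_const_iff[of "-1"] uminus_mem[OF one_mem] by (simp add: cls_zero cls_one cls_eq_iff)
  fix a assume "a \<in> carrier Q" "a \<noteq> \<zero>\<^bsub>Q\<^esub>"
  thus "\<exists>b\<in>carrier Q. a \<otimes>\<^bsub>Q\<^esub> b = \<one>\<^bsub>Q\<^esub>"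
    using cls_inverse cls_mem unfolding carrier_Q by blast
qed

abbreviation "F \<equiv> completion_rat K v"

lemma F_iff: "u \<in> F \<longleftrightarrow> (\<exists>q::nat \<Rightarrow> rat. (\<lambda>n. of_rat (q n)) \<in> cauchy_seqs K v \<and> u = cls (\<lambda>n. of_rat (q n)))"
proof
  assume "u \<in> F"
  then obtain s where s: "s \<in> cauchy_seqs K v" "range s \<subseteq> \<rat>" "u = cls s"
    by (auto simp: completion_rat_def)
  have "\<forall>n. \<exists>q. s n = of_rat q" using s(2) by (auto simp: Rats_def)
  then obtain q where "\<And>n. s n = of_rat (q n)" by metis
  hence "s = (\<lambda>n. of_rat (q n))" by auto
  thus "\<exists>q::nat \<Rightarrow> rat. (\<lambda>n. of_rat (q n)) \<in> cauchy_seqs K v \<and> u = cls (\<lambda>n. of_rat (q n))"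
    using s by blast
qed (auto simp: completion_rat_def)

lemma F_clsI: "(\<lambda>n. of_rat (q n)) \<in> cauchy_seqs K v \<Longrightarrow> cls (\<lambda>n. of_rat (q n)) \<in> F"
  by (auto simp: F_iff)

lemma F_subfield: "subfield F Q"
proof (rule Q.subfieldI')
  show "subring F Q"
  proof (rule Q.subringI)
    show "F \<subseteq> carrier Q" by (auto simp: F_iff)
    show "\<one>\<^bsub>Q\<^esub> \<in> F" using F_clsI[of "\<lambda>_. 1"] by (simp add: cls_one)
    fix x y assume "x \<in> F" "y \<in> F"
    then obtain p q where pq: "(\<lambda>n. of_rat (p n)) \<in> cauchy_seqs K v" "x = cls (\<lambda>n. of_rat (p n))"
      "(\<lambda>n. of_rat (q n)) \<in> cauchy_seqs K v" "y = cls (\<lambda>n. of_rat (q n))" by (auto simp: F_iff)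
    show "x \<otimes>\<^bsub>Q\<^esub> y \<in> F" using pq F_clsI[of "\<lambda>n. p n * q n"] cauchy_mult[OF pq(1,3)]
      by (simp add: of_rat_mult)
    show "x \<oplus>\<^bsub>Q\<^esub> y \<in> F" using pq F_clsI[of "\<lambda>n. p n + q n"] cauchy_add[OF pq(1,3)]
      by (simp add: of_rat_add)
  next
    fix x assume "x \<in> F"
    then obtain p where p: "(\<lambda>n. of_rat (p n)) \<in> cauchy_seqs K v" "x = cls (\<lambda>n. of_rat (p n))"
      by (auto simp: F_iff)
    have "\<ominus>\<^bsub>Q\<^esub> x = cls (\<lambda>n. - of_rat (p n))"
      using p by (intro Q.minus_equality) (auto simp: cauchy_uminus cls_zero)
    thus "\<ominus>\<^bsub>Q\<^esub> x \<in> F"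
      using p F_clsI[of "\<lambda>n. - p n"] cauchy_uminus[OF p(1)] by (simp add: of_rat_minus)
  qed
  fix x assume x: "x \<in> F - {\<zero>\<^bsub>Q\<^esub>}"
  then obtain p where p: "(\<lambda>n. of_rat (p n)) \<in> cauchy_seqs K v" "x = cls (\<lambda>n. of_rat (p n))"
    by (auto simp: F_iff)
  note * = cls_inverse[OF p(1)]
  have "inv\<^bsub>Q\<^esub> x = cls (\<lambda>n. inverse (of_rat (p n)))"
    using * p x by (intro Q.comm_inv_char) auto
  thus "inv\<^bsub>Q\<^esub> x \<in> F"
    using F_clsI[of "\<lambda>n. inverse (p n)"] * p x by (auto simp: of_rat_inverse)
qed

text \<open>Induction on the generators stands in for an argument with equivalence of norms. If the
  coefficients of \<open>b\<close> form a Cauchy sequence, its term splits off. If they do not,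
  \<open>b\<close> is a limit of elements of \<open>rat_span bs\<close>, and altering
  \<open>x\<close> by a null sequence removes \<open>b\<close> altogether.\<close>

lemma cauchy_rat_span_cls:
  assumes "set bs \<subseteq> K" "x \<in> cauchy_seqs K v" "\<And>n. x n \<in> rat_span bs"
  shows "cls x \<in> Q.Span F (map (\<lambda>b. cls (\<lambda>n. b)) bs)"
  using assms
proof (induction bs arbitrary: x)
  case Nil
  hence "x = (\<lambda>n. 0)" by auto
  thus ?case by (simp add: cls_zero)
next
  case (Cons b bs)
  have bK: "b \<in> K" and bsK: "set bs \<subseteq> K" using Cons.prems by auto
  have "\<forall>n. \<exists>q y. x n = of_rat q * b + y \<and> y \<in> rat_span bs" using Cons.prems(3) by auto
  then obtain q y where qy: "\<And>n. x n = of_rat (q n) * b + y n" "\<And>n. y n \<in> rat_span bs" by metis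
  have yK: "y n \<in> K" for n using qy rat_span_subset[OF bsK] by blast
  have xK: "x n \<in> K" for n using Cons.prems(2) by (rule cauchy_seqsD)
  have car: "set (map (\<lambda>b. cls (\<lambda>n. b)) bs) \<subseteq> carrier Q" using bsK by auto
  show ?case
  proof (cases "(\<lambda>n. of_rat (q n) :: 'a) \<in> cauchy_seqs K v")
    case True
    have y: "y \<in> cauchy_seqs K v"
    proof -
      have "(\<lambda>n. x n - of_rat (q n) * b) \<in> cauchy_seqs K v"
        using Cons.prems True bK by (intro cauchy_diff cauchy_mult cauchy_const)
      thus ?thesis using qy by simp
    qed
    hence "cls y \<in> Q.Span F (map (\<lambda>b. cls (\<lambda>n. b)) bs)" using Cons.IH bsK qy by blast
    moreover have "cls x = cls (\<lambda>n. of_rat (q n)) \<otimes>\<^bsub>Q\<^esub> cls (\<lambda>n. b) \<oplus>\<^bsub>Q\<^esub> cls y"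
    proof -
      have "x = (\<lambda>n. of_rat (q n) * b + y n)" using qy by auto
      thus ?thesis using True y bK by (simp add: cauchy_mult)
    qed
    moreover have "cls (\<lambda>n. of_rat (q n)) \<in> F" using F_clsI True .
    ultimately show ?thesis using Q.line_extension_mem_iff by auto
  next
    case False
    then obtain e where e: "e > 0" "\<forall>M. \<exists>m\<ge>M. \<exists>n\<ge>M. v (of_rat (q m) - of_rat (q n)) \<ge> e"
      by (auto simp: cauchy_seqs_def not_less)
    \<comment> \<open>Some differences q m - q n stay away from 0 while x m - x n is small. Dividing
      the latter by the former leaves \<open>b\<close> minus an element of the smaller span.\<close>
    have "\<exists>w\<in>rat_span bs. v (b - w) < d" if d: "d > 0" for d
    proof -
      obtain M where M: "\<forall>m\<ge>M. \<forall>n\<ge>M. v (x m - x n) < d * e"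
        using cauchy_seqsD(2)[OF Cons.prems(2), of "d * e"] d e by auto
      obtain m n where mn: "m \<ge> M" "n \<ge> M" "v (of_rat (q m) - of_rat (q n)) \<ge> e" using e by blast
      define r where "r = q m - q n"
      define w where "w = of_rat (- inverse r) * (y m + of_rat (-1) * y n)"
      have r: "v (of_rat r) \<ge> e" using mn by (simp add: r_def of_rat_diff)
      hence r0: "of_rat r \<noteq> (0::'a)" using e by auto
      have "of_rat r * w = - (y m - y n)"
        using r0 unfolding w_def by (simp add: of_rat_minus of_rat_inverse mult.assoc[symmetric])
      moreover have "x m - x n = of_rat r * b + (y m - y n)"
        unfolding qy(1) r_def by (simp add: of_rat_diff algebra_simps)
      ultimately have "x m - x n = of_rat r * (b - w)" by (simp only: right_diff_distrib diff_minus_eq_add)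
      hence "v (x m - x n) = v (of_rat r) * v (b - w)"
        using bK yK by (simp add: v_mult w_def diff_mem mult_mem add_mem uminus_mem)
      moreover have "v (x m - x n) < d * e" using M mn by blast
      moreover have "0 \<le> v (b - w)"
        using bK yK by (intro v_nonneg) (auto simp: w_def)
      ultimately have "v (b - w) * e < d * e"
        using mult_right_mono[OF r, of "v (b - w)"] by (simp add: mult.commute)
      hence "v (b - w) < d" using e by simp
      moreover have "w \<in> rat_span bs" unfolding w_def by (intro rat_span_scale rat_span_add qy)
      ultimately show ?thesis by blast
    qed
    note approx = this
    \<comment> \<open>The coefficients q n may be unbounded, so the precision of the approximation
      of \<open>b\<close> at index n has to depend on q n.\<close>
    have "\<exists>w\<in>rat_span bs. v (of_rat (q n)) * v (b - w) < inverse (real (Suc n))" for n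
    proof (cases "q n = 0")
      case True
      thus ?thesis using rat_span_zero by auto
    next
      case False
      hence pos: "v (of_rat (q n)) > 0" by (intro v_pos) auto
      obtain w where "w \<in> rat_span bs" "v (b - w) < inverse (real (Suc n)) / v (of_rat (q n))"
        using approx[of "inverse (real (Suc n)) / v (of_rat (q n))"] pos by auto
      moreover from this have "v (of_rat (q n)) * v (b - w) < inverse (real (Suc n))"
        using pos by (simp only: pos_less_divide_eq mult.commute)
      ultimately show ?thesis by blast
    qed
    then obtain w where w: "\<And>n. w n \<in> rat_span bs"
      "\<And>n. v (of_rat (q n)) * v (b - w n) < inverse (real (Suc n))" by metis
    have wK: "w n \<in> K" for n using w rat_span_subset[OF bsK] by blast
    define z where "z = (\<lambda>n. y n + of_rat (q n) * w n)"
    have z: "z n \<in> rat_span bs" for n unfolding z_def by (intro rat_span_add rat_span_scale qy w)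
    have "x n - z n = of_rat (q n) * (b - w n)" for n
      by (simp add: z_def qy(1) algebra_simps)
    hence "v (x n - z n) \<le> inverse (real (Suc n))" for n
      using w(2)[of n] bK wK by (simp add: v_mult diff_mem)
    moreover have xz: "x n - z n \<in> K" for n unfolding z_def by (intro diff_mem add_mem mult_mem of_rat_mem xK yK wK)
    ultimately have null: "(\<lambda>n. x n - z n) \<in> N"
      by (intro null_seqsI[OF _ _ LIMSEQ_inverse_real_of_nat]) auto
    have zK: "z n \<in> K" for n using z rat_span_subset[OF bsK] by blast
    note * = cauchy_null_diff[OF Cons.prems(2) null zK]
    have "cls x \<in> Q.Span F (map (\<lambda>b. cls (\<lambda>n. b)) bs)" using Cons.IH[OF bsK *(1) z] *(2) by simp
    thus ?thesis
      using Q.mono_Span[OF F_subfield car, of "cls (\<lambda>n. b)"] bK by auto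
  qed
qed

lemma completion_finite_dimension:
  assumes "set bs \<subseteq> K" "K \<subseteq> rat_span bs"
  shows "Q.finite_dimension F (carrier Q)"
proof -
  let ?Us = "map (\<lambda>b. cls (\<lambda>n. b)) bs"
  have Us: "set ?Us \<subseteq> carrier Q" using assms by auto
  have "carrier Q \<subseteq> Q.Span F ?Us"
  proof
    fix u assume "u \<in> carrier Q"
    then obtain x where x: "x \<in> cauchy_seqs K v" "u = cls x" unfolding carrier_Q by blast
    have "x n \<in> rat_span bs" for n using cauchy_seqsD(1)[OF x(1)] assms(2) by blast
    thus "u \<in> Q.Span F ?Us" unfolding x(2) by (rule cauchy_rat_span_cls[OF assms(1) x(1)])
  qed
  hence "Q.Span F ?Us = carrier Q"
    using Q.Span_in_carrier[OF subfieldE(3)[OF F_subfield] Us] by (rule subset_antisym[rotated])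
  thus ?thesis using Q.Span_finite_dimension[OF F_subfield Us] by (simp only:)
qed

end

section \<open>Number fields as rational vector spaces\<close>

text \<open>Brings in subspaces and the exchange bound on the size of independent sets, on which
  algebraicity rests.\<close>

interpretation rat_vs: vector_space "\<lambda>(q::rat) (x::'a::field_char_0). of_rat q * x"
  by unfold_locales (simp_all add: algebra_simps of_rat_add of_rat_mult)

lemma rat_span_eq: "rat_span bs = rat_vs.span (set bs)"
proof (induction bs)
  case (Cons b bs)
  have "x \<in> rat_span (b # bs) \<longleftrightarrow> x \<in> rat_vs.span (insert b (set bs))" for x
  proof -
    have "(\<exists>q y. x = of_rat q * b + y \<and> y \<in> A) \<longleftrightarrow> (\<exists>q. x - of_rat q * b \<in> A)" for A
      by (metis add_diff_cancel_left' diff_add_cancel add.commute)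
    thus ?thesis unfolding rat_vs.span_insert rat_span.simps Cons mem_Collect_eq .
  qed
  thus ?case by auto
qed (simp add: rat_vs.span_empty)

lemma Rats_subfield: "subfield \<rat> (ring_of_type_algebra :: 'a::field_char_0 ring)"
proof -
  let ?R = "ring_of_type_algebra :: 'a ring"
  interpret R: field ?R by (rule field_from_type_algebra)
  note s [simp] = ring_of_type_algebra_def
  have m: "\<ominus>\<^bsub>?R\<^esub> x = - x" for x
    by (rule R.minus_equality) auto
  have i: "inv\<^bsub>?R\<^esub> x = inverse x" if "x \<noteq> 0" for x
    by (rule R.comm_inv_char) (use that in auto)
  show ?thesis
  proof (rule R.subfieldI')
    show "subring \<rat> ?R"
      by (rule R.subringI) (unfold m, auto)
    show "inv\<^bsub>?R\<^esub> k \<in> \<rat>" if "k \<in> \<rat> - {\<zero>\<^bsub>?R\<^esub>}" for k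
    proof -
      have k: "k \<in> \<rat>" "k \<noteq> 0" using that by auto
      show ?thesis unfolding i[OF k(2)] using k(1) by (rule Rats_inverse)
    qed
  qed
qed

lemma ring_Span_Rats: "ring.Span (ring_of_type_algebra :: 'a::field_char_0 ring) \<rat> bs = rat_span bs"
proof -
  interpret R: ring "ring_of_type_algebra :: 'a ring" by (rule ring_from_type_algebra)
  show ?thesis
  proof (induction bs)
    case (Cons b bs)
    have "x \<in> R.Span \<rat> (b # bs) \<longleftrightarrow> x \<in> rat_span (b # bs)" for x
    proof -
      have "R.Span \<rat> (b # bs) = R.line_extension \<rat> b (R.Span \<rat> bs)" by simp
      moreover have "k \<otimes>\<^bsub>ring_of_type_algebra\<^esub> b \<oplus>\<^bsub>ring_of_type_algebra\<^esub> w = k * b + w" for k w :: 'a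
        by (simp add: ring_of_type_algebra_def)
      ultimately have "x \<in> R.Span \<rat> (b # bs) \<longleftrightarrow> (\<exists>k\<in>\<rat>. \<exists>w\<in>rat_span bs. x = k * b + w)"
        by (simp only: Cons R.line_extension_mem_iff)
      also have "\<dots> \<longleftrightarrow> x \<in> rat_span (b # bs)"
        unfolding rat_span.simps mem_Collect_eq by (metis Rats_cases Rats_of_rat)
      finally show ?thesis .
    qed
    thus ?case by blast
  next
    case Nil
    have "R.Span \<rat> [] = {\<zero>\<^bsub>ring_of_type_algebra\<^esub>}" by simp
    thus ?case by (simp add: ring_of_type_algebra_def)
  qed
qed

lemma number_field_rat_span:
  fixes K :: "'a::field_char_0 set"
  assumes "number_field K"
  obtains bs where "set bs \<subseteq> K" "K = rat_span bs"
proof -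
  interpret R: ring "ring_of_type_algebra :: 'a ring" by (rule ring_from_type_algebra)
  obtain n where n: "R.dimension n \<rat> K" using assms by (auto simp: number_field_def)
  obtain bs where bs: "R.Span \<rat> bs = K" "set bs \<subseteq> carrier ring_of_type_algebra"
    using R.exists_base[OF Rats_subfield n] by blast
  hence "K = rat_span bs" by (simp only: ring_Span_Rats)
  moreover have "set bs \<subseteq> K"
    unfolding \<open>K = rat_span bs\<close> rat_span_eq by (rule rat_vs.span_superset)
  ultimately show ?thesis using that by blast
qed

text \<open>With n generators, the n + 1 powers 1, x, ..., x^n are linearly dependent, and a linear
  relation between powers is a polynomial equation.\<close>

lemma rat_span_algebraic:
  fixes x :: "'a::field_char_0"
  assumes "\<And>n. x ^ n \<in> rat_span bs"
  shows "\<exists>p::rat poly. p \<noteq> 0 \<and> poly (map_poly of_rat p) x = 0"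
proof -
  have ex: "\<exists>p::rat poly. p \<noteq> 0 \<and> poly (map_poly of_rat p) x = 0"
    if I: "finite I" "(\<Sum>i\<in>I. of_rat (u i) * x ^ i) = 0" "i0 \<in> I" "u i0 \<noteq> 0" for I :: "nat set" and u i0
  proof -
    define p where "p = (\<Sum>i\<in>I. Polynomial.monom (u i) i)"
    have c: "poly.coeff p j = (if j \<in> I then u j else 0)" for j
      using I(1) by (simp add: p_def coeff_sum)
    hence "p \<noteq> 0" using I by (metis coeff_0)
    have "map_poly of_rat p = (\<Sum>i\<in>I. Polynomial.monom (of_rat (u i) :: 'a) i)"
      using I(1) by (intro poly_eqI) (simp add: coeff_map_poly c coeff_sum)
    hence "poly (map_poly of_rat p) x = (\<Sum>i\<in>I. of_rat (u i) * x ^ i)"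
      by (simp add: poly_sum poly_monom)
    thus ?thesis using I \<open>p \<noteq> 0\<close> by auto
  qed
  let ?n = "card (set bs)"
  show ?thesis
  proof (cases "inj_on (\<lambda>i. x ^ i) {..?n}")
    \<comment> \<open>Dependence is a property of sets of vectors and cannot see a repeated power;
      two equal powers give the relation x^i - x^j = 0 directly.\<close>
    case False
    then obtain i j where ij: "i \<noteq> j" "x ^ i = x ^ j" by (auto simp: inj_on_def)
    show ?thesis
      by (rule ex[of "{i, j}" "\<lambda>k. if k = i then 1 else -1" i]) (use ij in \<open>auto simp: of_rat_minus\<close>)
  next
    case True
    let ?S = "(\<lambda>i. x ^ i) ` {..?n}"
    have "?S \<subseteq> rat_vs.span (set bs)" using assms by (auto simp: rat_span_eq)
    moreover have "card ?S = Suc ?n" using True by (simp add: card_image)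
    ultimately have "rat_vs.dependent ?S"
      using rat_vs.independent_span_bound[of "set bs" ?S] by fastforce
    then obtain u where u: "\<exists>y\<in>?S. u y \<noteq> 0" "(\<Sum>y\<in>?S. of_rat (u y) * y) = 0"
      by (subst (asm) rat_vs.dependent_finite) auto
    then obtain i0 where "i0 \<in> {..?n}" "u (x ^ i0) \<noteq> 0" by auto
    moreover have "(\<Sum>i\<in>{..?n}. of_rat (u (x ^ i)) * x ^ i) = 0"
      using u(2) by (simp add: sum.reindex[OF True])
    ultimately show ?thesis using ex[of "{..?n}" "\<lambda>i. u (x ^ i)" i0] by simp
  qed
qed

lemma (in valued_subfield) element_algebraic:
  assumes "K = rat_span bs" "x \<in> K"
  shows "\<exists>p::rat poly. p \<noteq> 0 \<and> poly (map_poly of_rat p) x = 0"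
  using power_mem[OF assms(2)] unfolding assms(1) by (rule rat_span_algebraic)

section \<open>Archimedean places\<close>

locale archimedean_place = valued_subfield +
  assumes v_of_rat: "v (of_rat q) = \<bar>real_of_rat q\<bar>"

section \<open>Real polynomials as limits of rational ones\<close>

lemma map_poly_of_rat_add: "map_poly of_rat (p + q) = map_poly of_rat p + map_poly of_rat q"
  by (intro poly_eqI) (simp add: coeff_map_poly of_rat_add)

lemma map_poly_of_rat_diff: "map_poly of_rat (p - q) = map_poly of_rat p - map_poly of_rat q"
  by (intro poly_eqI) (simp add: coeff_map_poly of_rat_diff)

lemma map_poly_of_rat_mult: "map_poly of_rat (p * q) = map_poly of_rat p * map_poly of_rat q"
  by (intro poly_eqI) (simp add: coeff_map_poly coeff_mult of_rat_sum of_rat_mult)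

lemma map_poly_of_real_add: "map_poly of_real (p + q) = map_poly of_real p + map_poly of_real q"
  by (intro poly_eqI) (simp add: coeff_map_poly)

lemma map_poly_of_real_mult:
  "map_poly of_real (p * q) = (map_poly of_real p * map_poly of_real q :: 'a::{real_algebra_1,comm_ring_1} poly)"
  by (intro poly_eqI) (simp add: coeff_map_poly coeff_mult)

lemma map_poly_of_real_smult:
  "map_poly of_real (Polynomial.smult c q) = (Polynomial.smult (of_real c) (map_poly of_real q) :: 'a::{real_algebra_1,comm_ring_1} poly)"
  by (intro poly_eqI) (simp add: coeff_map_poly)

lemma map_poly_of_real_inject:
  "map_poly of_real p = (map_poly of_real q :: 'a::{real_algebra_1,comm_ring_1} poly) \<Longrightarrow> p = q"
  by (intro poly_eqI) (metis coeff_map_poly of_real_0 of_real_eq_iff)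

lemma map_poly_cnj_mult: "map_poly cnj (p * q) = map_poly cnj p * map_poly cnj q"
  by (intro poly_eqI) (simp add: coeff_map_poly coeff_mult)

lemma poly_as_sum_le:
  fixes p :: "'a::comm_ring_1 poly"
  shows "Polynomial.degree p \<le> D \<Longrightarrow> poly p x = (\<Sum>i\<le>D. poly.coeff p i * x ^ i)"
  unfolding poly_altdef by (intro sum.mono_neutral_left) (auto simp: coeff_eq_0)

text \<open>The common degree bound is essential: convergence of each coefficient alone would not
  control the values at x.\<close>

definition approximates :: "(nat \<Rightarrow> rat poly) \<Rightarrow> real poly \<Rightarrow> bool" where
  "approximates s p \<longleftrightarrow> (\<exists>D. \<forall>n. Polynomial.degree (s n) \<le> D) \<and>
     (\<forall>i. (\<lambda>n. of_rat (poly.coeff (s n) i)) \<longlonglongrightarrow> poly.coeff p i)"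

lemma rational_sequence: "\<exists>q::nat \<Rightarrow> rat. (\<lambda>n. of_rat (q n)) \<longlonglongrightarrow> (x::real)"
proof -
  have "\<exists>q::rat. x < of_rat q \<and> of_rat q < x + inverse (real (Suc n))" for n
    using of_rat_dense[of x "x + inverse (real (Suc n))"] by auto
  then obtain q :: "nat \<Rightarrow> rat" where q: "\<And>n. x < of_rat (q n)" "\<And>n. of_rat (q n) < x + inverse (real (Suc n))"
    by metis
  have "(\<lambda>n. x + inverse (real (Suc n))) \<longlonglongrightarrow> x + 0"
    by (intro tendsto_add tendsto_const LIMSEQ_inverse_real_of_nat)
  hence lim: "(\<lambda>n. x + inverse (real (Suc n))) \<longlonglongrightarrow> x" by simp
  have "(\<lambda>n. of_rat (q n)) \<longlonglongrightarrow> x"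
    by (rule tendsto_sandwich[OF _ _ tendsto_const lim])
       (use q in \<open>auto intro!: always_eventually less_imp_le\<close>)
  thus ?thesis by blast
qed

lemma approximates_exists: "\<exists>s. approximates s p"
proof -
  have "\<forall>i. \<exists>q::nat \<Rightarrow> rat. (\<lambda>n. of_rat (q n)) \<longlonglongrightarrow> poly.coeff p i"
    using rational_sequence by blast
  then obtain q :: "nat \<Rightarrow> nat \<Rightarrow> rat" where q: "\<And>i. (\<lambda>n. of_rat (q i n)) \<longlonglongrightarrow> poly.coeff p i" by metis
  define s where "s n = (\<Sum>i\<le>Polynomial.degree p. Polynomial.monom (q i n) i)" for n
  have c: "poly.coeff (s n) i = (if i \<le> Polynomial.degree p then q i n else 0)" for n i
    by (simp add: s_def coeff_sum)
  have "Polynomial.degree (s n) \<le> Polynomial.degree p" for n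
    by (rule degree_le) (simp add: c)
  moreover have "(\<lambda>n. of_rat (poly.coeff (s n) i)) \<longlonglongrightarrow> poly.coeff p i" for i
    using q[of i] by (cases "i \<le> Polynomial.degree p") (simp_all add: c coeff_eq_0)
  ultimately show ?thesis unfolding approximates_def by blast
qed

lemma approximates_diff: "approximates s p \<Longrightarrow> approximates t q \<Longrightarrow> approximates (\<lambda>n. s n - t n) (p - q)"
  unfolding approximates_def
proof (elim conjE exE, intro conjI allI)
  fix D E assume "\<forall>n. Polynomial.degree (s n) \<le> D" "\<forall>n. Polynomial.degree (t n) \<le> E"
  hence "\<forall>n. Polynomial.degree (s n - t n) \<le> max D E"
    by (metis degree_diff_le max.cobounded1 max.cobounded2 order.trans)
  thus "\<exists>D. \<forall>n. Polynomial.degree (s n - t n) \<le> D" by blast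
qed (auto simp: of_rat_diff intro: tendsto_diff)

lemma approximates_add: "approximates s p \<Longrightarrow> approximates t q \<Longrightarrow> approximates (\<lambda>n. s n + t n) (p + q)"
  unfolding approximates_def
proof (elim conjE exE, intro conjI allI)
  fix D E assume "\<forall>n. Polynomial.degree (s n) \<le> D" "\<forall>n. Polynomial.degree (t n) \<le> E"
  hence "\<forall>n. Polynomial.degree (s n + t n) \<le> max D E"
    by (metis degree_add_le max.cobounded1 max.cobounded2 order.trans)
  thus "\<exists>D. \<forall>n. Polynomial.degree (s n + t n) \<le> D" by blast
qed (auto simp: of_rat_add intro: tendsto_add)

lemma approximates_mult: "approximates s p \<Longrightarrow> approximates t q \<Longrightarrow> approximates (\<lambda>n. s n * t n) (p * q)"
  unfolding approximates_def
proof (elim conjE exE, intro conjI allI)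
  fix D E assume "\<forall>n. Polynomial.degree (s n) \<le> D" "\<forall>n. Polynomial.degree (t n) \<le> E"
  hence "\<forall>n. Polynomial.degree (s n * t n) \<le> D + E"
    by (metis degree_mult_le add_mono order.trans)
  thus "\<exists>D. \<forall>n. Polynomial.degree (s n * t n) \<le> D" by blast
qed (auto simp: of_rat_sum of_rat_mult coeff_mult intro!: tendsto_sum tendsto_mult)

lemma approximates_const: "approximates (\<lambda>n. p) (map_poly of_rat p)"
  unfolding approximates_def by (auto simp: coeff_map_poly)

text \<open>The absolute value of \<open>\<rat>(x)\<close>, transported to rational polynomials, extends by continuity to a
  multiplicative seminorm on real polynomials.\<close>

locale archimedean_element = archimedean_place +
  fixes x assumes x_mem: "x \<in> K"
begin

definition ev :: "rat poly \<Rightarrow> 'a" where "ev p = poly (map_poly of_rat p) x"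

lemma ev_mem [simp, intro]: "ev p \<in> K"
  unfolding ev_def poly_altdef by (intro sum_mem mult_mem power_mem x_mem) (simp add: coeff_map_poly)

lemma ev_mult: "ev (p * q) = ev p * ev q"
  by (simp add: ev_def map_poly_of_rat_mult)

lemma ev_add: "ev (p + q) = ev p + ev q"
  by (simp add: ev_def map_poly_of_rat_add)

lemma ev_diff: "ev (p - q) = ev p - ev q"
  by (simp add: ev_def map_poly_of_rat_diff)

lemma v_ev_le: "Polynomial.degree p \<le> D \<Longrightarrow> v (ev p) \<le> (\<Sum>i\<le>D. \<bar>of_rat (poly.coeff p i)\<bar> * v x ^ i)"
proof -
  assume D: "Polynomial.degree p \<le> D"
  have "Polynomial.degree (map_poly of_rat p :: 'a poly) \<le> D"
    by (rule degree_le) (use D in \<open>simp add: coeff_map_poly coeff_eq_0\<close>)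
  hence "ev p = (\<Sum>i\<le>D. of_rat (poly.coeff p i) * x ^ i)"
    unfolding ev_def by (subst poly_as_sum_le) (simp_all add: coeff_map_poly)
  also have "v \<dots> \<le> (\<Sum>i\<le>D. v (of_rat (poly.coeff p i) * x ^ i))"
    by (intro v_sum_le mult_mem power_mem x_mem of_rat_mem)
  also have "\<dots> = (\<Sum>i\<le>D. \<bar>of_rat (poly.coeff p i)\<bar> * v x ^ i)"
    by (simp add: v_mult power_mem x_mem v_power v_of_rat)
  finally show ?thesis .
qed

lemma approximates_0: "approximates s 0 \<Longrightarrow> (\<lambda>n. v (ev (s n))) \<longlonglongrightarrow> 0"
proof -
  assume s: "approximates s 0"
  then obtain D where D: "\<And>n. Polynomial.degree (s n) \<le> D" by (auto simp: approximates_def)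
  have "(\<lambda>n. \<Sum>i\<le>D. \<bar>of_rat (poly.coeff (s n) i)\<bar> * v x ^ i) \<longlonglongrightarrow> (\<Sum>i\<le>D. \<bar>0\<bar> * v x ^ i)"
    using s by (intro tendsto_sum tendsto_mult tendsto_rabs tendsto_const) (simp add: approximates_def)
  hence l: "(\<lambda>n. \<Sum>i\<le>D. \<bar>of_rat (poly.coeff (s n) i)\<bar> * v x ^ i) \<longlonglongrightarrow> 0" by simp
  show ?thesis
  proof (rule tendsto_sandwich[OF _ _ tendsto_const l])
    show "\<forall>\<^sub>F n in sequentially. v (ev (s n)) \<le> (\<Sum>i\<le>D. \<bar>of_rat (poly.coeff (s n) i)\<bar> * v x ^ i)"
      using v_ev_le[OF D] by (intro always_eventually allI)
  qed simp
qed

text \<open>A real polynomial has no value in K that could serve as the limit. So the values are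
  shown to be Cauchy, by comparing two terms of \<open>s\<close> through the coefficients of
  \<open>p\<close>.\<close>

lemma approximates_convergent: "approximates s p \<Longrightarrow> convergent (\<lambda>n. v (ev (s n)))"
proof -
  assume s: "approximates s p"
  then obtain D where D: "\<And>n. Polynomial.degree (s n) \<le> D" by (auto simp: approximates_def)
  define a where "a n = (\<Sum>i\<le>D. \<bar>of_rat (poly.coeff (s n) i) - poly.coeff p i\<bar> * v x ^ i)" for n
  have "a \<longlonglongrightarrow> (\<Sum>i\<le>D. \<bar>poly.coeff p i - poly.coeff p i\<bar> * v x ^ i)" unfolding a_def
    using s by (intro tendsto_sum tendsto_mult tendsto_rabs tendsto_const tendsto_diff) (simp add: approximates_def)
  hence a: "a \<longlonglongrightarrow> 0" by simp
  have le: "\<bar>v (ev (s m)) - v (ev (s n))\<bar> \<le> a m + a n" for m n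
  proof -
    have "\<bar>v (ev (s m)) - v (ev (s n))\<bar> \<le> v (ev (s m - s n))"
      unfolding ev_diff by (intro v_abs_diff_le ev_mem)
    also have "\<dots> \<le> (\<Sum>i\<le>D. \<bar>of_rat (poly.coeff (s m - s n) i)\<bar> * v x ^ i)"
      by (intro v_ev_le degree_diff_le D)
    also have "\<dots> \<le> (\<Sum>i\<le>D. \<bar>of_rat (poly.coeff (s m) i) - poly.coeff p i\<bar> * v x ^ i
                 + \<bar>of_rat (poly.coeff (s n) i) - poly.coeff p i\<bar> * v x ^ i)"
      unfolding distrib_right[symmetric]
      by (intro sum_mono mult_right_mono) (auto simp: of_rat_diff x_mem)
    also have "\<dots> = a m + a n" by (simp add: a_def sum.distrib)
    finally show ?thesis .
  qed
  have "Cauchy (\<lambda>n. v (ev (s n)))"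
  proof (rule CauchyI)
    fix e :: real assume "e > 0"
    hence "eventually (\<lambda>n. a n < e / 2) sequentially" by (intro order_tendstoD(2)[OF a]) auto
    then obtain M where M: "\<And>n. n \<ge> M \<Longrightarrow> a n < e / 2" by (auto simp: eventually_sequentially)
    have "norm (v (ev (s m)) - v (ev (s n))) < e" if "m \<ge> M" "n \<ge> M" for m n
      using le[of m n] M[OF that(1)] M[OF that(2)] by simp
    thus "\<exists>M. \<forall>m\<ge>M. \<forall>n\<ge>M. norm (v (ev (s m)) - v (ev (s n))) < e" by blast
  qed
  thus ?thesis by (simp add: Cauchy_convergent_iff)
qed

definition nu :: "real poly \<Rightarrow> real" where "nu p = lim (\<lambda>n. v (ev ((SOME s. approximates s p) n)))"

text \<open>The difference of two approximating sequences approximates 0, so the limit is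
  independent of the choice made in \<open>nu\<close>.\<close>

lemma nu_limit:
  assumes "approximates s p"
  shows "(\<lambda>n. v (ev (s n))) \<longlonglongrightarrow> nu p"
proof -
  define t where "t = (SOME s. approximates s p)"
  have t: "approximates t p" unfolding t_def using approximates_exists by (rule someI_ex)
  have lim: "(\<lambda>n. v (ev (t n))) \<longlonglongrightarrow> nu p"
    unfolding nu_def t_def[symmetric] using approximates_convergent[OF t] by (simp add: convergent_LIMSEQ_iff)
  have "approximates (\<lambda>n. s n - t n) 0" using approximates_diff[OF assms t] by simp
  hence z: "(\<lambda>n. v (ev (s n - t n))) \<longlonglongrightarrow> 0" by (rule approximates_0)
  have "(\<lambda>n. v (ev (s n)) - v (ev (t n))) \<longlonglongrightarrow> 0"
    by (rule Lim_null_comparison[OF _ z]) (auto simp: ev_diff intro!: always_eventually v_abs_diff_le)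
  from tendsto_add[OF this lim] show ?thesis by simp
qed

lemma nu_rat: "nu (map_poly of_rat p) = v (ev p)"
  using nu_limit[OF approximates_const] by (simp add: LIMSEQ_const_iff)

lemma nu_nonneg [simp]: "0 \<le> nu p"
proof -
  obtain s where s: "approximates s p" using approximates_exists by blast
  show ?thesis by (rule LIMSEQ_le_const[OF nu_limit[OF s]]) auto
qed

lemma nu_mult: "nu (p * q) = nu p * nu q"
proof -
  obtain s where s: "approximates s p" using approximates_exists by blast
  obtain t where t: "approximates t q" using approximates_exists by blast
  have "(\<lambda>n. v (ev (s n * t n))) \<longlonglongrightarrow> nu p * nu q"
    unfolding ev_mult using tendsto_mult[OF nu_limit[OF s] nu_limit[OF t]] by (simp add: v_mult)
  thus ?thesis using nu_limit[OF approximates_mult[OF s t]] LIMSEQ_unique by blast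
qed

lemma nu_add_le: "nu (p + q) \<le> nu p + nu q"
proof -
  obtain s where s: "approximates s p" using approximates_exists by blast
  obtain t where t: "approximates t q" using approximates_exists by blast
  show ?thesis
    by (rule LIMSEQ_le[OF nu_limit[OF approximates_add[OF s t]]
          tendsto_add[OF nu_limit[OF s] nu_limit[OF t]]])
       (auto simp: ev_add v_add_le)
qed

lemma nu_const: "nu [:c:] = \<bar>c\<bar>"
proof -
  obtain q :: "nat \<Rightarrow> rat" where q: "(\<lambda>n. of_rat (q n)) \<longlonglongrightarrow> c" using rational_sequence by blast
  have "approximates (\<lambda>n. [:q n:]) [:c:]"
    unfolding approximates_def using q by (auto simp: coeff_pCons split: nat.splits)
  hence "(\<lambda>n. v (ev [:q n:])) \<longlonglongrightarrow> nu [:c:]" by (rule nu_limit)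
  moreover have "(\<lambda>n. v (ev [:q n:])) \<longlonglongrightarrow> \<bar>c\<bar>"
    using tendsto_rabs[OF q] by (simp add: ev_def map_poly_pCons v_of_rat)
  ultimately show ?thesis using LIMSEQ_unique by blast
qed

lemma nu_smult: "nu (Polynomial.smult c p) = \<bar>c\<bar> * nu p"
  using nu_mult[of "[:c:]" p] by (simp add: nu_const)

text \<open>\<open>nu\<close> may vanish on nonzero polynomials; this lets it be computed modulo
  them.\<close>

lemma nu_add_null: "nu q = 0 \<Longrightarrow> nu (p + q) = nu p"
  using nu_add_le[of p q] nu_add_le[of "p + q" "Polynomial.smult (-1) q"] nu_smult[of "-1" q] by simp

lemma nu_prod_mset: "nu (prod_mset A) = prod_mset (image_mset nu A)"
  by (induction A) (simp_all add: nu_mult nu_const flip: pCons_one)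

text \<open>The monic real polynomial with roots z and its conjugate, see
  \<open>quad_factor\<close>; for real z it is a square.\<close>

definition quad :: "complex \<Rightarrow> real poly" where "quad z = [:(cmod z)\<^sup>2, - 2 * Re z, 1:]"

lemma quad_factor: "map_poly of_real (quad z) = [:- z, 1:] * [:- cnj z, 1:]"
  by (simp add: quad_def map_poly_pCons complex_norm_square[symmetric] complex_add_cnj[symmetric]
      complex_mult_cnj cmod_power2 algebra_simps complex_eq_iff)

text \<open>A polynomial that annihilates x has \<open>nu\<close> 0, and multiplicativity passes
  this on to a factor. Squaring the polynomial avoids pairing conjugate roots: the square is a
  constant times the product of \<open>quad z\<close> over all complex roots with
  multiplicity.\<close>

lemma nu_quad_root:
  assumes "K = rat_span bs"
  shows "\<exists>z. nu (quad z) = 0"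
proof -
  obtain f :: "rat poly" where f: "f \<noteq> 0" "ev f = 0"
    using element_algebraic[OF assms x_mem] by (auto simp: ev_def)
  define F where "F = (map_poly of_rat f :: real poly)"
  define G where "G = (map_poly of_real F :: complex poly)"
  have F0: "F \<noteq> 0" using f(1) by (simp add: F_def map_poly_eq_0_iff)
  have nuF: "nu F = 0" using f(2) by (simp add: F_def nu_rat)
  define c where "c = Polynomial.lead_coeff F"
  have c0: "c \<noteq> 0" using F0 by (simp add: c_def)
  have lG: "Polynomial.lead_coeff G = of_real c"
    unfolding G_def c_def by (simp add: degree_map_poly coeff_map_poly)
  have cnjG: "map_poly cnj G = G"
    unfolding G_def by (subst map_poly_map_poly) (auto simp: o_def)
  have G: "Polynomial.smult (of_real c) (\<Prod>z\<in>#proots G. [:- z, 1:]) = G"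
    using complex_poly_decompose_multiset[of G] unfolding lG .
  have cprod: "map_poly cnj (\<Prod>z\<in>#A. [:- z, 1:]) = (\<Prod>z\<in>#A. [:- cnj z, 1:])" for A
    by (induction A) (simp_all add: map_poly_cnj_mult map_poly_pCons map_poly_1' del: mult_pCons_left)
  have G': "Polynomial.smult (of_real c) (\<Prod>z\<in>#proots G. [:- cnj z, 1:]) = G"
  proof -
    have "G = map_poly cnj (Polynomial.smult (of_real c) (\<Prod>z\<in>#proots G. [:- z, 1:]))" using G cnjG by simp
    also have "\<dots> = Polynomial.smult (of_real c) (map_poly cnj (\<Prod>z\<in>#proots G. [:- z, 1:]))"
      by (intro poly_eqI) (simp add: coeff_map_poly)
    finally show ?thesis unfolding cprod by simp
  qed
  have rprod: "map_poly of_real (\<Prod>z\<in>#A. quad z) = (\<Prod>z\<in>#A. [:- z, 1:]) * (\<Prod>z\<in>#A. [:- cnj z, 1:])" for A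
    by (induction A) (simp_all add: map_poly_of_real_mult quad_factor map_poly_1' mult_ac del: mult_pCons_left mult_pCons_right)
  have "map_poly of_real (F * F) = G * G" by (simp add: G_def map_poly_of_real_mult)
  also have "\<dots> = Polynomial.smult (of_real c) (\<Prod>z\<in>#proots G. [:- z, 1:]) * Polynomial.smult (of_real c) (\<Prod>z\<in>#proots G. [:- cnj z, 1:])"
    unfolding G G' ..
  also have "\<dots> = map_poly of_real (Polynomial.smult (c * c) (\<Prod>z\<in>#proots G. quad z))"
    unfolding map_poly_of_real_smult rprod by simp
  finally have "F * F = Polynomial.smult (c * c) (\<Prod>z\<in>#proots G. quad z)" by (rule map_poly_of_real_inject)
  hence "nu F * nu F = \<bar>c * c\<bar> * prod_mset (image_mset nu (image_mset quad (proots G)))"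
    by (metis nu_mult nu_smult nu_prod_mset)
  hence "0 \<in># image_mset nu (image_mset quad (proots G))"
    using nuF c0 by (simp add: prod_mset_zero_iff)
  thus ?thesis by auto
qed

lemma power_bounded_le_1:
  fixes y B :: real
  assumes "\<And>n. y ^ n \<le> B"
  shows "y \<le> 1"
  using real_arch_pow[of y B] assms by (meson not_le)

text \<open>If \<open>z\<close> is not real, the real polynomials modulo \<open>quad z\<close> form a copy of \<open>\<complex>\<close>, on which \<open>nu\<close> is
  multiplicative and bounded by a multiple of the usual absolute value; hence it is equal to it.\<close>

lemma nu_eq_cmod:
  assumes "K = rat_span bs"
  obtains z where "\<And>p. nu p = cmod (poly (map_poly of_real p) z)"
proof -
  obtain z where z: "nu (quad z) = 0" using nu_quad_root[OF assms] by blast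
  show ?thesis
  proof (cases "Im z = 0")
    case True
    define a where "a = Re z"
    have za: "z = of_real a" using True by (simp add: a_def complex_eq_iff)
    have "quad z = [:- a, 1:] * [:- a, 1:]" by (simp add: quad_def za power2_eq_square)
    hence "nu (quad z) = nu [:- a, 1:] * nu [:- a, 1:]" by (simp only: nu_mult)
    hence null: "nu [:- a, 1:] = 0" using z by simp
    have "nu p = cmod (poly (map_poly of_real p) z)" for p
    proof -
      have "[:- a, 1:] dvd p - [:poly p a:]" by (simp add: poly_eq_0_iff_dvd[symmetric])
      then obtain q where q: "p - [:poly p a:] = [:- a, 1:] * q" by (elim dvdE)
      hence "p = [:poly p a:] + [:- a, 1:] * q" by (simp add: algebra_simps)
      hence "nu p = nu [:poly p a:]" using nu_add_null[of "[:- a, 1:] * q"] null nu_mult by (metis mult_zero_left)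
      also have "\<dots> = cmod (of_real (poly p a))" by (simp add: nu_const)
      also have "(of_real (poly p a) :: complex) = poly (map_poly of_real p) z"
        unfolding za by (induction p) (simp_all add: map_poly_pCons)
      finally show ?thesis .
    qed
    thus ?thesis by (rule that)
  next
    case False
    define a b where "a = Re z" and "b = Im z"
    have b0: "b \<noteq> 0" using False by (simp add: b_def)
    have zab: "z = Complex a b" by (simp add: a_def b_def)
    \<comment> \<open>This is (X - a)/b. It takes the value i at z, so its square is -1 modulo
      \<open>quad z\<close>.\<close>
    define \<eta> where "\<eta> = [:- a / b, 1 / b:]"
    have eta: "\<eta> * \<eta> + 1 = Polynomial.smult (1 / b\<^sup>2) (quad z)"
    proof -
      have "quad z = [:a\<^sup>2 + b\<^sup>2, - 2 * a, 1:]" by (simp add: quad_def zab cmod_power2)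
      thus ?thesis using b0 by (simp add: \<eta>_def one_pCons power2_eq_square field_simps)
    qed
    \<comment> \<open>\<open>W w\<close> is \<open>nu\<close> of the polynomial that represents w in
      this copy of the complex numbers, with \<eta> in the role of i.\<close>
    define W where "W w = nu ([:Re w:] + Polynomial.smult (Im w) \<eta>)" for w
    have W_mult: "W (u * w) = W u * W w" for u w
    proof -
      have "([:Re u:] + Polynomial.smult (Im u) \<eta>) * ([:Re w:] + Polynomial.smult (Im w) \<eta>)
          = ([:Re (u * w):] + Polynomial.smult (Im (u * w)) \<eta>) + Polynomial.smult (Im u * Im w) (\<eta> * \<eta> + 1)"
        by (simp add: algebra_simps one_pCons smult_add_left smult_add_right smult_diff_left)
      hence "W u * W w = nu (([:Re (u * w):] + Polynomial.smult (Im (u * w)) \<eta>) + Polynomial.smult (Im u * Im w) (\<eta> * \<eta> + 1))"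
        unfolding W_def nu_mult[symmetric] by simp
      also have "\<dots> = W (u * w)"
        unfolding W_def using z by (intro nu_add_null) (simp add: nu_smult eta)
      finally show ?thesis ..
    qed
    have W1: "W 1 = 1" by (simp add: W_def nu_const)
    have W_power: "W (w ^ n) = W w ^ n" for w n by (induction n) (simp_all add: W1 W_mult)
    have W_le: "W w \<le> (1 + nu \<eta>) * cmod w" for w
    proof -
      have "W w \<le> \<bar>Re w\<bar> + \<bar>Im w\<bar> * nu \<eta>"
        unfolding W_def using nu_add_le[of "[:Re w:]" "Polynomial.smult (Im w) \<eta>"] by (simp add: nu_const nu_smult)
      also have "\<dots> \<le> cmod w + cmod w * nu \<eta>"
        by (intro add_mono mult_right_mono abs_Re_le_cmod abs_Im_le_cmod nu_nonneg)
      finally show ?thesis by (simp add: algebra_simps)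
    qed
    \<comment> \<open>The constant 1 + nu \<eta> disappears when the inequality is applied to all
      powers of w.\<close>
    have W_cmod_le: "W w \<le> cmod w" if "w \<noteq> 0" for w
    proof -
      have "(W w / cmod w) ^ n \<le> 1 + nu \<eta>" for n
        using W_le[of "w ^ n"] that by (simp add: W_power norm_power power_divide divide_le_eq)
      hence "W w / cmod w \<le> 1" by (rule power_bounded_le_1)
      thus ?thesis using that by (simp add: divide_le_eq)
    qed
    have W_cmod: "W w = cmod w" for w
    proof (cases "w = 0")
      case False
      \<comment> \<open>The upper bound for 1/w is a lower bound for w.\<close>
      have "W w * W (1 / w) = 1" using False by (simp add: W1 flip: W_mult)
      moreover have "W (1 / w) \<le> 1 / cmod w" using W_cmod_le[of "1 / w"] False by (simp add: norm_divide)
      moreover have "0 \<le> W w" by (simp add: W_def)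
      ultimately have "1 \<le> W w * (1 / cmod w)" by (metis mult_left_mono)
      hence "cmod w \<le> W w" using False by (simp add: le_divide_eq)
      thus ?thesis using W_cmod_le[OF False] by simp
    next
      case True
      thus ?thesis using nu_const[of 0] by (simp add: W_def)
    qed
    have "nu p = cmod (poly (map_poly of_real p) z)" for p
    proof -
      have q0: "quad z \<noteq> 0" and qd: "Polynomial.degree (quad z) = 2" by (simp_all add: quad_def)
      define q r where "q = p div quad z" and "r = p mod quad z"
      have "r = 0 \<or> Polynomial.degree r < 2" using degree_mod_less[OF q0, of p] qd by (simp add: r_def)
      hence deg: "Polynomial.degree r \<le> 1" by auto
      define r0 r1 where "r0 = poly.coeff r 0" and "r1 = poly.coeff r 1"
      have r: "r = [:r0, r1:]"
        using deg by (intro poly_eqI) (auto simp: r0_def r1_def coeff_pCons coeff_eq_0 split: nat.splits)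
      have p: "p = r + quad z * q" by (simp add: r_def q_def)
      have "poly (map_poly of_real (quad z)) z = 0" by (simp add: quad_factor)
      hence pz: "poly (map_poly of_real p) z = poly (map_poly of_real r) z"
        unfolding p map_poly_of_real_add map_poly_of_real_mult by simp
      \<comment> \<open>The value at z of the remainder r0 + r1 X.\<close>
      define w where "w = Complex (r0 + r1 * a) (r1 * b)"
      have "nu p = nu r" unfolding p by (rule nu_add_null) (simp add: nu_mult z)
      also have "r = [:Re w:] + Polynomial.smult (Im w) \<eta>"
        using b0 by (simp add: r \<eta>_def w_def)
      also have "nu \<dots> = cmod w" using W_cmod unfolding W_def .
      also have "w = poly (map_poly of_real r) z"
        by (simp add: r map_poly_pCons zab complex_eq_iff w_def)
      also note pz[symmetric]
      finally show ?thesis .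
    qed
    thus ?thesis by (rule that)
  qed
qed

end

section \<open>Local degrees and complex embeddings\<close>

lemma (in valued_subfield) local_degree_pos:
  assumes "set bs \<subseteq> K" "K = rat_span bs"
  shows "0 < local_degree K v"
  using Q.dim_carrier_pos[OF F_subfield completion_finite_dimension[OF assms(1)]] assms(2)
  unfolding local_degree_def by blast

lemma of_real_of_rat_eq: "of_real (of_rat q) = (of_rat q :: 'a::real_field)"
  by (cases q) (simp add: of_rat_rat)

context archimedean_element
begin

lemma root_of_algebraic:
  assumes "\<And>p. nu p = cmod (poly (map_poly of_real p) z)"
  shows "v (ev p) = cmod (poly (map_poly of_rat p) z)"
proof -
  have "map_poly of_real (map_poly of_rat p) = (map_poly of_rat p :: complex poly)"
    by (intro poly_eqI) (simp add: coeff_map_poly of_real_of_rat_eq)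
  thus ?thesis using assms[of "map_poly of_rat p"] by (simp add: nu_rat)
qed

lemma cauchy_of_rat:
  assumes "(\<lambda>n. of_rat (q n)) \<longlonglongrightarrow> (c::real)"
  shows "(\<lambda>n. of_rat (q n)) \<in> cauchy_seqs K v"
proof (rule cauchy_seqsI)
  fix e :: real assume "e > 0"
  then obtain M where M: "\<forall>m\<ge>M. \<forall>n\<ge>M. norm (of_rat (q m) - of_rat (q n) :: real) < e"
    using LIMSEQ_imp_Cauchy[OF assms] unfolding Cauchy_iff by blast
  have "v (of_rat (q m) - of_rat (q n)) = norm (of_rat (q m) - of_rat (q n) :: real)" for m n
    using v_of_rat[of "q m - q n"] by (simp add: of_rat_diff)
  thus "\<exists>M. \<forall>m\<ge>M. \<forall>n\<ge>M. v (of_rat (q m) - of_rat (q n)) < e" using M by auto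
qed simp

text \<open>Because \<open>nu (quad z)\<close> is 0, the completion contains the relation x^2 = 2
  Re(z) x - |z|^2, whose real coefficients are classes of rational sequences. The class of x is
  outside F: a rational sequence converging to x would have a real limit t with |z - t| = 0.\<close>

lemma even_local_degree:
  assumes bs: "set bs \<subseteq> K" "K = rat_span bs"
    and z: "\<And>p. nu p = cmod (poly (map_poly of_real p) z)" and nonreal: "Im z \<noteq> 0"
  shows "even (local_degree K v)"
proof -
  let ?X = "cls (\<lambda>n. x)"
  obtain a :: "nat \<Rightarrow> rat" where a: "(\<lambda>n. of_rat (a n)) \<longlonglongrightarrow> 2 * Re z" using rational_sequence by blast
  obtain c :: "nat \<Rightarrow> rat" where c: "(\<lambda>n. of_rat (c n)) \<longlonglongrightarrow> - (cmod z)\<^sup>2" using rational_sequence by blast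
  note ca = cauchy_of_rat[OF a] and cc = cauchy_of_rat[OF c]
  have "approximates (\<lambda>n. [:- c n, - a n, 1:]) (quad z)"
    unfolding approximates_def quad_def
  proof (intro conjI allI exI[of _ 2])
    fix i
    show "(\<lambda>n. real_of_rat (poly.coeff [:- c n, - a n, 1:] i)) \<longlonglongrightarrow> poly.coeff [:(cmod z)\<^sup>2, - 2 * Re z, 1:] i"
      using tendsto_minus[OF a] tendsto_minus[OF c]
      by (auto simp: coeff_pCons of_rat_minus split: nat.splits)
  qed (auto simp: numeral_2_eq_2)
  hence "(\<lambda>n. v (ev [:- c n, - a n, 1:])) \<longlonglongrightarrow> nu (quad z)" by (rule nu_limit)
  moreover have "nu (quad z) = 0" unfolding z quad_factor by simp
  moreover have "ev [:- c n, - a n, 1:] = x * x - (of_rat (a n) * x + of_rat (c n))" for n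
    by (simp add: ev_def map_poly_pCons of_rat_minus algebra_simps)
  ultimately have "(\<lambda>n. x * x - (of_rat (a n) * x + of_rat (c n))) \<in> N"
    unfolding null_seqs_iff by (auto intro!: diff_mem add_mem mult_mem x_mem of_rat_mem)
  moreover have cx: "(\<lambda>n. x) \<in> cauchy_seqs K v" using x_mem by simp
  ultimately have eq: "?X \<otimes>\<^bsub>Q\<^esub> ?X = cls (\<lambda>n. of_rat (a n)) \<otimes>\<^bsub>Q\<^esub> ?X \<oplus>\<^bsub>Q\<^esub> cls (\<lambda>n. of_rat (c n))"
    using ca cc cauchy_mult[OF ca cx] cauchy_mult[OF cx cx] cauchy_add[OF cauchy_mult[OF ca cx] cc]
    by (simp add: cls_eq_iff)
  have notF: "?X \<notin> F"
  proof
    assume "?X \<in> F"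
    then obtain q :: "nat \<Rightarrow> rat" where q: "(\<lambda>n. of_rat (q n)) \<in> cauchy_seqs K v" "?X = cls (\<lambda>n. of_rat (q n))"
      unfolding F_iff by blast
    have "Cauchy (\<lambda>n. of_rat (q n) :: real)"
    proof (rule CauchyI)
      fix e :: real assume "e > 0"
      have "v (of_rat (q m) - of_rat (q n)) = norm (of_rat (q m) - of_rat (q n) :: real)" for m n
        using v_of_rat[of "q m - q n"] by (simp add: of_rat_diff)
      thus "\<exists>M. \<forall>m\<ge>M. \<forall>n\<ge>M. norm (of_rat (q m) - of_rat (q n) :: real) < e"
        using cauchy_seqsD(2)[OF q(1) \<open>e > 0\<close>] by simp
    qed
    then obtain t :: real where t: "(\<lambda>n. of_rat (q n)) \<longlonglongrightarrow> t"
      by (auto simp: Cauchy_convergent_iff convergent_def)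
    have "approximates (\<lambda>n. [:- q n, 1:]) [:- t, 1:]"
      unfolding approximates_def
    proof (intro conjI allI exI[of _ 1])
      fix i
      show "(\<lambda>n. real_of_rat (poly.coeff [:- q n, 1:] i)) \<longlonglongrightarrow> poly.coeff [:- t, 1:] i"
        using tendsto_minus[OF t] by (auto simp: coeff_pCons of_rat_minus split: nat.splits)
    qed auto
    hence "(\<lambda>n. v (ev [:- q n, 1:])) \<longlonglongrightarrow> nu [:- t, 1:]" by (rule nu_limit)
    moreover have "ev [:- q n, 1:] = x - of_rat (q n)" for n
      by (simp add: ev_def map_poly_pCons of_rat_minus)
    moreover have "(\<lambda>n. x - of_rat (q n)) \<in> N"
      using cls_eq_iff[OF cx q(1)] q(2) by simp
    hence "(\<lambda>n. v (x - of_rat (q n))) \<longlonglongrightarrow> 0" by (simp add: null_seqs_iff)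
    ultimately have "nu [:- t, 1:] = 0" using LIMSEQ_unique by simp blast
    hence "cmod (z - of_real t) = 0" unfolding z by (simp add: map_poly_pCons)
    thus False using nonreal by simp
  qed
  show ?thesis unfolding local_degree_def
    by (rule Q.even_dim_of_quadratic_element[OF F_subfield _ cls_mem[OF cx] notF F_clsI[OF ca] F_clsI[OF cc] eq])
       (rule completion_finite_dimension[OF bs(1)], use bs(2) in simp)
qed

end

context archimedean_place
begin

text \<open>The number z depends on x, so only the field generated by x is embedded. That is enough,
  since each later use concerns a single element.\<close>

lemma archimedean_embedding:
  assumes bs: "set bs \<subseteq> K" "K = rat_span bs" and x: "x \<in> K"
  obtains z where "\<And>p. v (poly (map_poly of_rat p) x) = cmod (poly (map_poly of_rat p) z)"
    "Im z \<noteq> 0 \<Longrightarrow> even (local_degree K v)"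
proof -
  interpret archimedean_element K v x by unfold_locales (rule x)
  obtain z where z: "\<And>p. nu p = cmod (poly (map_poly of_real p) z)" using nu_eq_cmod[OF bs(2)] by blast
  show ?thesis
    by (rule that[OF root_of_algebraic[OF z, unfolded ev_def] even_local_degree[OF bs z]])
qed

text \<open>Both sides are homogeneous, so dividing by y leaves the single element x / y, to which
  \<open>archimedean_embedding\<close> applies; there it is the parallelogram law of the complex
  plane.\<close>

lemma parallelogram:
  assumes bs: "set bs \<subseteq> K" "K = rat_span bs" and x: "x \<in> K" and y: "y \<in> K"
  shows "(v (x + y))\<^sup>2 + (v (x - y))\<^sup>2 = 2 * (v x)\<^sup>2 + 2 * (v y)\<^sup>2"
proof (cases "y = 0")
  case False
  define t where "t = x / y"
  have t: "t \<in> K" unfolding t_def by (intro divide_mem x y)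
  obtain z where z: "\<And>p. v (poly (map_poly of_rat p) t) = cmod (poly (map_poly of_rat p) z)"
    using archimedean_embedding[OF bs t] by metis
  have z1: "v (t + 1) = cmod (z + 1)" using z[of "[:1, 1:]"] by (simp add: map_poly_pCons add.commute)
  have z2: "v (t - 1) = cmod (z - 1)" using z[of "[:-1, 1:]"] by (simp add: map_poly_pCons of_rat_minus)
  have z3: "v t = cmod z" using z[of "[:0, 1:]"] by (simp add: map_poly_pCons)
  have xt: "x = t * y" using False by (simp add: t_def)
  have "v (x + y) = v ((t + 1) * y)" "v (x - y) = v ((t - 1) * y)" by (simp_all add: xt algebra_simps)
  hence "v (x + y) = cmod (z + 1) * v y" "v (x - y) = cmod (z - 1) * v y" "v x = cmod z * v y"
    unfolding z1[symmetric] z2[symmetric] z3[symmetric]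
    using v_mult[of "t + 1" y] v_mult[of "t - 1" y] v_mult[of t y] t y add_mem[OF t one_mem] diff_mem[OF t one_mem]
    by (simp_all add: xt)
  moreover have "(cmod (z + 1))\<^sup>2 + (cmod (z - 1))\<^sup>2 = 2 * (cmod z)\<^sup>2 + 2"
    unfolding cmod_power2 by (simp add: power2_eq_square algebra_simps)
  hence "((cmod (z + 1))\<^sup>2 + (cmod (z - 1))\<^sup>2) * (v y)\<^sup>2 = (2 * (cmod z)\<^sup>2 + 2) * (v y)\<^sup>2" by simp
  ultimately show ?thesis by (simp add: power_mult_distrib algebra_simps)
qed simp

end

text \<open>Additivity yields integer multiples, and clearing the denominator yields rational
  ones.\<close>

lemma additive_zero_on_rat_span:
  fixes f :: "'a::field_char_0 \<Rightarrow> real"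
  assumes add: "\<And>x y. x \<in> V \<Longrightarrow> y \<in> V \<Longrightarrow> f (x + y) = f x + f y"
    and V: "rat_vs.subspace V" and bs: "set bs \<subseteq> V" "\<And>b. b \<in> set bs \<Longrightarrow> f b = 0"
    and x: "x \<in> rat_span bs"
  shows "f x = 0"
proof -
  have z: "f 0 = 0" using add[of 0 0] rat_vs.subspace_0[OF V] by simp
  have nat: "of_nat n * x \<in> V \<and> f (of_nat n * x) = of_nat n * f x" if "x \<in> V" for n x
  proof (induction n)
    case (Suc n)
    thus ?case using add[of x "of_nat n * x"] rat_vs.subspace_add[OF V that, of "of_nat n * x"] that
      by (simp add: algebra_simps)
  qed (simp add: z rat_vs.subspace_0[OF V])
  have neg: "f (- x) = - f x" if "x \<in> V" for x
    using add[of x "- x"] z rat_vs.subspace_neg[OF V that] that by simp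
  have scale: "f (of_rat q * x) = 0" if x: "x \<in> V" "f x = 0" for q x
  proof -
    have m: "of_rat r * x \<in> V" for r using rat_vs.subspace_scale[OF V x(1), of r] .
    obtain a b where q: "q = Rat.Fract a b" "b > 0" by (cases q) auto
    have int: "f (of_int i * x) = 0" for i
    proof (cases i rule: int_cases2)
      case (nonneg n)
      thus ?thesis using nat[OF x(1), of n] x(2) by simp
    next
      case (nonpos n)
      thus ?thesis using nat[OF x(1), of n] neg[of "of_nat n * x"] x(2) by simp
    qed
    have "of_nat (nat b) * (of_rat q * x) = of_int a * x" using q by (simp add: of_rat_rat)
    hence "of_nat (nat b) * f (of_rat q * x) = 0"
      using nat[OF m[of q], of "nat b"] int[of a] by metis
    thus ?thesis using q by simp
  qed
  have "x \<in> V \<and> f x = 0" if "x \<in> rat_span cs" "set cs \<subseteq> set bs" for cs x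
    using that
  proof (induction cs arbitrary: x)
    case Nil
    thus ?case using z rat_vs.subspace_0[OF V] by simp
  next
    case (Cons c cs)
    then obtain q y where *: "x = of_rat q * c + y" "y \<in> rat_span cs" by auto
    have y: "y \<in> V" "f y = 0" using Cons * by auto
    have c: "c \<in> V" "f c = 0" using Cons.prems bs by auto
    show ?case
      using add[of "of_rat q * c" y] scale[OF c] y rat_vs.subspace_scale[OF V c(1), of q]
        rat_vs.subspace_add[OF V _ y(1), of "of_rat q * c"] * by simp
  qed
  thus ?thesis using x by blast
qed

text \<open>Polarisation as in the Jordan-von Neumann theorem: the parallelogram law makes
  \<open>B\<close> additive in each argument, so its vanishing on pairs of generators spreads to K
  one argument at a time.\<close>

lemma quadratic_zero_on_rat_span:
  fixes D :: "'a::field_char_0 \<Rightarrow> real"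
  assumes K: "K = rat_span bs"
    and D: "\<And>x y. x \<in> K \<Longrightarrow> y \<in> K \<Longrightarrow> D (x + y) + D (x - y) = 2 * D x + 2 * D y"
    and b1: "\<And>b. b \<in> set bs \<Longrightarrow> D b = 0" and b2: "\<And>b c. b \<in> set bs \<Longrightarrow> c \<in> set bs \<Longrightarrow> D (b + c) = 0"
    and x: "x \<in> K"
  shows "D x = 0"
proof -
  have V: "rat_vs.subspace K" unfolding K rat_span_eq by (rule rat_vs.subspace_span)
  note mem = rat_vs.subspace_add[OF V] rat_vs.subspace_diff[OF V] rat_vs.subspace_0[OF V]
  have bsK: "set bs \<subseteq> K" unfolding K rat_span_eq by (rule rat_vs.span_superset)
  define B where "B x y = D (x + y) - D x - D y" for x y
  have B_add: "B (x + y) z = B x z + B y z" if "x \<in> K" "y \<in> K" "z \<in> K" for x y z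
  proof -
    have "D (x + y + z) + D (x + z - y) = 2 * D (x + z) + 2 * D y"
      using D[of "x + z" y] mem that by (simp add: algebra_simps)
    moreover have "D (x + z - y) + D (x + y - z) = 2 * D x + 2 * D (z - y)"
      using D[of x "z - y"] mem that by (simp add: algebra_simps)
    moreover have "D (x + y + z) + D (x + y - z) = 2 * D (x + y) + 2 * D z"
      using D[of "x + y" z] mem that by (simp add: algebra_simps)
    moreover have "D (y + z) + D (z - y) = 2 * D z + 2 * D y"
      using D[of z y] mem that by (simp add: algebra_simps)
    ultimately show ?thesis unfolding B_def by (simp add: add.commute)
  qed
  have B_comm: "B x y = B y x" for x y by (simp add: B_def add.commute)
  have 1: "B y b = 0" if "b \<in> set bs" "y \<in> K" for y b
  proof (rule additive_zero_on_rat_span[OF _ V bsK, where f = "\<lambda>y. B y b"])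
    show "B (x + y) b = B x b + B y b" if "x \<in> K" "y \<in> K" for x y
      using B_add that \<open>b \<in> set bs\<close> bsK by blast
    show "B c b = 0" if "c \<in> set bs" for c using that \<open>b \<in> set bs\<close> b1 b2 by (simp add: B_def)
    show "y \<in> rat_span bs" using that K by simp
  qed
  have "B x x = 0"
  proof (rule additive_zero_on_rat_span[OF _ V bsK, where f = "\<lambda>y. B y x"])
    show "B (y + z) x = B y x + B z x" if "y \<in> K" "z \<in> K" for y z using B_add that x by blast
    show "B c x = 0" if "c \<in> set bs" for c using 1[OF that x] by (simp add: B_comm)
    show "x \<in> rat_span bs" using x K by simp
  qed
  moreover have "D 0 = 0" using D[of 0 0] mem by simp
  \<comment> \<open>So B x x = D (x + x) - 2 D x is 2 D x.\<close>
  hence "D (x + x) = 4 * D x" using D[OF x x] by simp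
  ultimately show ?thesis by (simp add: B_def)
qed

text \<open>By the parallelogram law, the square of an archimedean absolute value is a quadratic form over
  \<open>\<rat>\<close>, so it is determined by its values on finitely many elements; each of these values is the modulus
  of one of the complex roots of a fixed polynomial.\<close>

lemma finite_archimedean_places:
  assumes "number_field K"
  shows "finite (archimedean_places K)"
proof -
  obtain bs where bs: "set bs \<subseteq> K" "K = rat_span bs" using number_field_rat_span[OF assms] .
  have place: "archimedean_place K v" if "v \<in> archimedean_places K" for v
    using assms that
    by (intro archimedean_place.intro valued_subfield.intro archimedean_place_axioms.intro)
       (auto simp: number_field_def archimedean_places_def)
  \<comment> \<open>A quadratic form is determined by its values on generators and on their pairwise
    sums, the latter encoding the polar form.\<close>
  define Y where "Y = set bs \<union> {b + c | b c. b \<in> set bs \<and> c \<in> set bs}"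
  have Y: "finite Y" "Y \<subseteq> K"
  proof -
    have "b + c \<in> K" if "b \<in> set bs" "c \<in> set bs" for b c
      using that unfolding bs(2) rat_span_eq by (intro rat_vs.span_add rat_vs.span_base)
    thus "Y \<subseteq> K" using bs(1) by (auto simp: Y_def)
  qed (auto simp: Y_def intro: finite_image_set2)
  have "\<exists>R. finite R \<and> (\<forall>v\<in>archimedean_places K. v x \<in> R)" if x: "x \<in> K" for x
  proof (cases "archimedean_places K = {}")
    case False
    then obtain v0 where "v0 \<in> archimedean_places K" by blast
    then interpret v0: archimedean_place K v0 by (rule place)
    \<comment> \<open>The equation f(x) = 0 holds in K itself, so the same f serves all archimedean
      places at once.\<close>
    obtain f :: "rat poly" where f: "f \<noteq> 0" "poly (map_poly of_rat f) x = 0"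
      using v0.element_algebraic[OF bs(2) x] by blast
    let ?R = "cmod ` {z. poly (map_poly of_rat f) z = 0}"
    have "finite ?R" using f(1) by (intro finite_imageI poly_roots_finite) (simp add: map_poly_eq_0_iff)
    moreover have "v x \<in> ?R" if v: "v \<in> archimedean_places K" for v
    proof -
      interpret v: archimedean_place K v by (rule place[OF v])
      obtain z where z: "\<And>p. v (poly (map_poly of_rat p) x) = cmod (poly (map_poly of_rat p) z)"
        using v.archimedean_embedding[OF bs x] by metis
      have "v x = cmod z" using z[of "[:0, 1:]"] by (simp add: map_poly_pCons)
      moreover have "poly (map_poly of_rat f) z = 0" using z[of f] f(2) by simp
      ultimately show ?thesis by blast
    qed
    ultimately show ?thesis by blast
  qed auto
  then obtain R where R: "\<And>x. x \<in> K \<Longrightarrow> finite (R x)"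
    "\<And>x v. x \<in> K \<Longrightarrow> v \<in> archimedean_places K \<Longrightarrow> v x \<in> R x" by metis
  have "inj_on (\<lambda>v. restrict v Y) (archimedean_places K)"
  proof (rule inj_onI)
    fix v w assume v: "v \<in> archimedean_places K" and w: "w \<in> archimedean_places K"
      and eq: "restrict v Y = restrict w Y"
    interpret v: archimedean_place K v by (rule place[OF v])
    interpret w: archimedean_place K w by (rule place[OF w])
    have eqX: "v x = w x" if "x \<in> Y" for x using eq that by (metis restrict_apply')
    have sq: "(v x)\<^sup>2 - (w x)\<^sup>2 = 0" if x: "x \<in> K" for x
    proof (rule quadratic_zero_on_rat_span[OF bs(2), where D = "\<lambda>x. (v x)\<^sup>2 - (w x)\<^sup>2"])
      fix x y assume xy: "x \<in> K" "y \<in> K"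
      show "(v (x + y))\<^sup>2 - (w (x + y))\<^sup>2 + ((v (x - y))\<^sup>2 - (w (x - y))\<^sup>2) =
          2 * ((v x)\<^sup>2 - (w x)\<^sup>2) + 2 * ((v y)\<^sup>2 - (w y)\<^sup>2)"
        using v.parallelogram[OF bs xy] w.parallelogram[OF bs xy] by simp
    next
      fix b c assume "b \<in> set bs" "c \<in> set bs"
      hence "b + c \<in> Y" by (auto simp: Y_def)
      thus "(v (b + c))\<^sup>2 - (w (b + c))\<^sup>2 = 0" using eqX by simp
    next
      fix b assume "b \<in> set bs"
      hence "b \<in> Y" by (auto simp: Y_def)
      thus "(v b)\<^sup>2 - (w b)\<^sup>2 = 0" using eqX by simp
    qed (rule x)
    have "v x = w x" if "x \<in> K" for x
      using sq[OF that] v.v_nonneg[OF that] w.v_nonneg[OF that] by simp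
    moreover have "v \<in> extensional K" "w \<in> extensional K"
      using v.absolute_value w.absolute_value by (auto simp: absolute_value_def)
    ultimately show "v = w" by (intro extensionalityI[of _ K]) auto
  qed
  moreover have "(\<lambda>v. restrict v Y) ` archimedean_places K \<subseteq> PiE Y R"
    using R(2) Y(2) by (auto simp: PiE_iff)
  moreover have "finite (PiE Y R)" using Y R(1) by (intro finite_PiE) auto
  ultimately show ?thesis by (meson finite_subset finite_imageD)
qed

section \<open>Finite places\<close>

locale padic_place = valued_subfield +
  fixes p :: nat
  assumes prime_p: "Factorial_Ring.prime p" and v_of_rat: "v (of_rat q) = padic_abs p q"
begin

lemma p_gt_1: "p > 1" using prime_p by (rule prime_gt_1_nat)

lemma v_of_int_le_1: "v (of_int i) \<le> 1"
proof (cases "i = 0")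
  case False
  have "v (of_int i) = padic_abs p (of_int i)" using v_of_rat[of "of_int i"] by simp
  also have "\<dots> = real p powi (- int (multiplicity (int p) i))" using False by (simp add: padic_abs_def)
  also have "\<dots> \<le> 1" using p_gt_1 by (simp add: power_int_minus inverse_le_1_iff)
  finally show ?thesis .
qed simp

lemma v_of_nat_le_1: "v (of_nat n) \<le> 1"
  using v_of_int_le_1[of "int n"] by simp

lemma v_p: "v (of_nat p) = 1 / real p"
proof -
  have "v (of_nat p) = padic_abs p (of_nat p)" using v_of_rat[of "of_nat p"] by simp
  also have "\<dots> = real p powi (- int (multiplicity (int p) (int p)))"
    using p_gt_1 by (simp add: padic_abs_def)
  also have "multiplicity (int p) (int p) = 1" using p_gt_1 by (intro multiplicity_self) auto
  finally show ?thesis by (simp add: power_int_minus divide_inverse)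
qed

lemma v_of_nat_coprime: "\<not> p dvd s \<Longrightarrow> v (of_nat s) = 1"
proof -
  assume s: "\<not> p dvd s"
  have s0: "s \<noteq> 0" using s by (intro notI) simp
  have "v (of_nat s) = padic_abs p (of_nat s)" using v_of_rat[of "of_nat s"] by simp
  also have "\<dots> = real p powi (- int (multiplicity (int p) (int s)))"
    using s0 by (simp add: padic_abs_def)
  also have "multiplicity (int p) (int s) = 0" using s by (intro not_dvd_imp_multiplicity_0) simp
  finally show ?thesis by simp
qed

text \<open>A geometric sequence of ratio above 1 outgrows n + 1. This absorbs the number of
  binomial terms in \<open>v_add_le_max\<close>.\<close>

lemma power_le_linear_imp_le_1:
  fixes y :: real
  assumes "\<And>n. y ^ n \<le> real n + 1"
  shows "y \<le> 1"
proof (rule ccontr)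
  assume "\<not> y \<le> 1"
  hence y: "y > 1" by simp
  have "(\<lambda>n. real n * (1 / y) ^ n + (1 / y) ^ n) \<longlonglongrightarrow> 0 + 0"
    using y by (intro tendsto_add powser_times_n_limit_0 LIMSEQ_realpow_zero) auto
  moreover have "1 \<le> real n * (1 / y) ^ n + (1 / y) ^ n" for n
  proof -
    have "y ^ n * (1 / y) ^ n \<le> (real n + 1) * (1 / y) ^ n"
      using assms y by (intro mult_right_mono) auto
    moreover have "y ^ n * (1 / y) ^ n = 1" using y by (simp flip: power_mult_distrib)
    ultimately show ?thesis by (simp add: algebra_simps)
  qed
  ultimately have "(1::real) \<le> 0 + 0" by (intro LIMSEQ_le_const[where X = "\<lambda>n. real n * (1 / y) ^ n + (1 / y) ^ n"]) auto
  thus False by simp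
qed

text \<open>Binomial coefficients have absolute value at most 1, so (x + y)^n is bounded by n + 1
  times M^n, and linear growth of the powers of v (x + y) / M forces this ratio to be at most
  1.\<close>

lemma v_add_le_max:
  assumes x: "x \<in> K" and y: "y \<in> K"
  shows "v (x + y) \<le> max (v x) (v y)"
proof (cases "x = 0 \<and> y = 0")
  case False
  define M where "M = max (v x) (v y)"
  have M0: "M > 0" using False v_pos[OF x] v_pos[OF y] by (auto simp: M_def less_max_iff_disj)
  have xy: "x + y \<in> K" using x y by (rule add_mem)
  have "(v (x + y) / M) ^ n \<le> real n + 1" for n
  proof -
    have "v (x + y) ^ n = v ((x + y) ^ n)" using v_power[OF xy] by simp
    also have "\<dots> = v (\<Sum>i\<le>n. of_nat (n choose i) * x ^ i * y ^ (n - i))" by (simp add: binomial_ring)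
    also have "\<dots> \<le> (\<Sum>i\<le>n. v (of_nat (n choose i) * x ^ i * y ^ (n - i)))"
      by (intro v_sum_le mult_mem power_mem of_nat_mem x y)
    also have "\<dots> \<le> (\<Sum>i\<le>n. M ^ n)"
    proof (intro sum_mono)
      fix i assume i: "i \<in> {..n}"
      have "v (of_nat (n choose i) * x ^ i * y ^ (n - i)) = v (of_nat (n choose i)) * v x ^ i * v y ^ (n - i)"
        by (simp add: v_mult v_power mult_mem power_mem x y)
      also have "\<dots> \<le> 1 * M ^ i * M ^ (n - i)"
        using x y M0 by (intro mult_mono power_mono v_of_nat_le_1 mult_nonneg_nonneg) (auto simp: M_def)
      also have "\<dots> = M ^ n" using i by (simp flip: power_add)
      finally show "v (of_nat (n choose i) * x ^ i * y ^ (n - i)) \<le> M ^ n" .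
    qed
    finally show ?thesis using M0 by (simp add: power_divide divide_le_eq algebra_simps)
  qed
  hence "v (x + y) / M \<le> 1" by (rule power_le_linear_imp_le_1)
  thus ?thesis using M0 by (simp add: divide_le_eq M_def)
qed (auto simp: x y)

lemma v_diff_le_max: "x \<in> K \<Longrightarrow> y \<in> K \<Longrightarrow> v (x - y) \<le> max (v x) (v y)"
  using v_add_le_max[of x "- y"] uminus_mem by simp

lemma v_add_less: "x \<in> K \<Longrightarrow> y \<in> K \<Longrightarrow> v x < e \<Longrightarrow> v y < e \<Longrightarrow> v (x + y) < e"
  using v_add_le_max[of x y] by simp

lemma v_add_le_bound: "x \<in> K \<Longrightarrow> y \<in> K \<Longrightarrow> v x \<le> e \<Longrightarrow> v y \<le> e \<Longrightarrow> v (x + y) \<le> e"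
  using v_add_le_max[of x y] by simp

lemma v_diff_less: "x \<in> K \<Longrightarrow> y \<in> K \<Longrightarrow> v x < e \<Longrightarrow> v y < e \<Longrightarrow> v (x - y) < e"
  using v_diff_le_max[of x y] by simp

lemma v_add_eq: "x \<in> K \<Longrightarrow> y \<in> K \<Longrightarrow> v y < v x \<Longrightarrow> v (x + y) = v x"
  using v_add_le_max[of x y] v_diff_le_max[of "x + y" y] add_mem[of x y] by simp

lemma v_sum_bound:
  assumes "\<And>i. i \<in> A \<Longrightarrow> f i \<in> K" "\<And>i. i \<in> A \<Longrightarrow> v (f i) \<le> e" "0 \<le> e"
  shows "v (sum f A) \<le> e"
  using assms
proof (induction A rule: infinite_finite_induct)
  case (insert a A)
  thus ?case using v_add_le_bound[of "f a" "sum f A" e] sum_mem[of A f] by simp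
qed auto

lemma v_sum_less:
  assumes "\<And>i. i \<in> A \<Longrightarrow> f i \<in> K" "\<And>i. i \<in> A \<Longrightarrow> v (f i) < e" "0 < e"
  shows "v (sum f A) < e"
  using assms
proof (induction A rule: infinite_finite_induct)
  case (insert a A)
  thus ?case using v_add_less[of "f a" "sum f A" e] sum_mem[of A f] by simp
qed auto

text \<open>The residue field of the p-adic valuation on the rationals is the prime field: the
  denominator b is a unit, and c is the residue of a times an inverse of b modulo p.\<close>

lemma integral_rat_residue:
  assumes "v (of_rat q) \<le> 1"
  shows "\<exists>c<p. v (of_rat q - of_nat c) < 1"
proof -
  obtain a b where ab: "quotient_of q = (a, b)" by (cases "quotient_of q") auto
  have b0: "b > 0" and cop: "coprime a b" using quotient_of_denom_pos[OF ab] quotient_of_coprime[OF ab] .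
  have q: "q = of_int a / of_int b" using quotient_of_div[OF ab] .
  have vb: "v (of_int b) = 1"
  proof -
    have "\<not> int p dvd b"
    proof
      assume pb: "int p dvd b"
      hence "\<not> int p dvd a" using cop prime_p coprime_common_divisor[OF cop, of "int p"] p_gt_1 by auto
      hence "a \<noteq> 0" "q \<noteq> 0" using q b0 by auto
      have "multiplicity (int p) b \<ge> 1"
        using pb b0 p_gt_1 by (intro multiplicity_geI) auto
      moreover have "multiplicity (int p) a = 0"
        using \<open>\<not> int p dvd a\<close> by (rule not_dvd_imp_multiplicity_0)
      moreover have "v (of_rat q) = real p powi (int (multiplicity (int p) b) - int (multiplicity (int p) a))"
        using \<open>q \<noteq> 0\<close> by (simp add: v_of_rat padic_abs_def ab)
      ultimately have "v (of_rat q) = real p ^ multiplicity (int p) b" by simp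
      moreover have "real p ^ multiplicity (int p) b > 1"
        using \<open>multiplicity (int p) b \<ge> 1\<close> p_gt_1 by (intro one_less_power) auto
      ultimately show False using assms by simp
    qed
    hence "\<not> p dvd nat b" using b0 by (metis int_dvd_int_iff int_nat_eq less_imp_le)
    hence "v (of_nat (nat b)) = 1" by (rule v_of_nat_coprime)
    thus ?thesis using b0 by simp
  qed
  have "coprime b (int p)"
  proof -
    have "\<not> int p dvd b"
    proof
      assume "int p dvd b"
      then obtain t where "b = int p * t" by auto
      hence "v (of_int b) = v (of_nat p) * v (of_int t)" by (simp add: v_mult)
      also have "\<dots> \<le> 1 / real p * 1" unfolding v_p by (intro mult_left_mono v_of_int_le_1) auto
      finally show False using vb p_gt_1 by simp
    qed
    thus ?thesis using prime_p prime_imp_coprime[of "int p" b] by (simp add: coprime_commute)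
  qed
  then obtain b' t where b': "b' * b + t * int p = 1"
    using bezout_int[of b "int p"] by auto
  define c where "c = nat ((a * b') mod int p)"
  have cp: "c < p" using p_gt_1 by (simp add: c_def nat_less_iff)
  define w where "w = (a * b') div int p"
  have ic: "int c = a * b' - int p * w"
    using p_gt_1 by (simp add: c_def w_def minus_mult_div_eq_mod)
  have "a - b * int c = a * (1 - b' * b) + int p * (b * w)"
    unfolding ic by (simp add: algebra_simps)
  also have "1 - b' * b = t * int p" using b' by simp
  finally have "a - b * int c = int p * (a * t + b * w)" by (simp add: algebra_simps)
  then obtain t where t: "a - b * int c = int p * t" by blast
  have "of_rat q - of_nat c = (of_int (a - b * int c) / of_int b :: 'a)"
    using b0 by (simp add: q of_rat_divide field_simps)
  hence "v (of_rat q - of_nat c) = v (of_nat p * of_int t) / v (of_int b)"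
    unfolding t by (simp add: v_divide mult_mem)
  also have "\<dots> = 1 / real p * v (of_int t)" unfolding vb by (simp add: v_mult v_p)
  also have "\<dots> \<le> 1 / real p * 1" by (intro mult_left_mono v_of_int_le_1) auto
  also have "\<dots> < 1" using p_gt_1 by simp
  finally show ?thesis using cp by blast
qed

text \<open>The residue of an algebraic unit is algebraic over the prime field, so its powers have only
  finitely many residues.\<close>

lemma unit_power_near_1:
  assumes K: "K = rat_span bs" and x: "x \<in> K" "v x = 1"
  shows "\<exists>m\<ge>1. v (x ^ m - 1) < 1"
proof -
  obtain f :: "rat poly" where f: "f \<noteq> 0" "poly (map_poly of_rat f) x = 0"
    using element_algebraic[OF K x(1)] by blast
  define D where "D = Polynomial.degree f"
  define a where "a i = v (of_rat (poly.coeff f i))" for i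
  define M where "M = Max (a ` {..D})"
  have aM: "a i \<le> M" if "i \<le> D" for i unfolding M_def using that by (intro Max_ge) auto
  have M0: "M > 0"
  proof -
    have "a D > 0" unfolding a_def D_def using f(1) by (intro v_pos) auto
    thus ?thesis using aM[of D] by simp
  qed
  have "M \<in> a ` {..D}" unfolding M_def by (intro Max_in) auto
  hence ne: "{i. i \<le> D \<and> a i = M} \<noteq> {}" by auto
  \<comment> \<open>The last index at which a coefficient has maximal absolute value. After division
    by that coefficient the higher terms vanish in the residue field, and a monic equation of degree
    k remains there.\<close>
  define k where "k = Max {i. i \<le> D \<and> a i = M}"
  have "k \<in> {i. i \<le> D \<and> a i = M}" unfolding k_def using ne by (intro Max_in) auto
  hence k: "k \<le> D" "a k = M" by auto
  have kmax: "a i < M" if "i \<le> D" "i > k" for i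
  proof -
    have "a i \<noteq> M"
    proof
      assume "a i = M"
      hence "i \<le> k" unfolding k_def using that by (intro Max_ge) auto
      thus False using that by simp
    qed
    thus ?thesis using aM[OF that(1)] by simp
  qed
  define b where "b i = poly.coeff f i / poly.coeff f k" for i
  have vb: "v (of_rat (b i)) = a i / M" for i
    using k(2) by (simp add: b_def of_rat_divide v_divide a_def)
  have fk0: "poly.coeff f k \<noteq> 0" using k(2) M0 by (auto simp: a_def)
  have bk: "b k = 1" using fk0 by (simp add: b_def)
  have vb1: "v (of_rat (b i)) \<le> 1" if "i \<le> D" for i using aM[OF that] M0 by (simp add: vb)
  have xn: "x ^ n \<in> K" "v (x ^ n) = 1" for n using x by (auto simp: v_power)
  have "poly (map_poly of_rat f) x = (\<Sum>i\<le>D. of_rat (poly.coeff f i) * x ^ i)"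
  proof -
    have "Polynomial.degree (map_poly of_rat f :: 'a poly) \<le> D"
      unfolding D_def by (rule degree_le) (simp add: coeff_map_poly coeff_eq_0)
    thus ?thesis by (subst poly_as_sum_le) (simp_all add: coeff_map_poly)
  qed
  hence "0 = (\<Sum>i\<le>D. of_rat (poly.coeff f i) * x ^ i) / of_rat (poly.coeff f k)" using f(2) by simp
  also have "\<dots> = (\<Sum>i\<le>D. of_rat (b i) * x ^ i)"
    by (simp add: sum_divide_distrib b_def of_rat_divide)
  also have "{..D} = {..<k} \<union> {k} \<union> {k<..D}" using k(1) by auto
  also have "(\<Sum>i\<in>{..<k} \<union> {k} \<union> {k<..D}. of_rat (b i) * x ^ i) =
      (\<Sum>i<k. of_rat (b i) * x ^ i) + x ^ k + (\<Sum>i\<in>{k<..D}. of_rat (b i) * x ^ i)"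
    by (subst sum.union_disjoint; (subst sum.union_disjoint)?) (auto simp: bk)
  finally have rel: "x ^ k + (\<Sum>i<k. of_rat (b i) * x ^ i) = - (\<Sum>i\<in>{k<..D}. of_rat (b i) * x ^ i)"
    by (simp add: algebra_simps eq_neg_iff_add_eq_0)
  have "v (\<Sum>i\<in>{k<..D}. of_rat (b i) * x ^ i) < 1"
  proof (rule v_sum_less)
    fix i assume "i \<in> {k<..D}"
    hence "a i < M" using kmax by simp
    thus "v (of_rat (b i) * x ^ i) < 1" using M0 xn by (simp add: v_mult vb)
  qed (auto intro!: mult_mem xn)
  moreover have sm: "(\<Sum>i\<in>I. of_rat (q i) * x ^ i) \<in> K" for I q
    by (intro sum_mem mult_mem of_rat_mem xn)
  ultimately have red: "v (x ^ k + (\<Sum>i<k. of_rat (b i) * x ^ i)) < 1" unfolding rel by simp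
  \<comment> \<open>For k = 0 the residual equation would read v 1 < 1.\<close>
  have k0: "k \<noteq> 0" using red by (intro notI) simp
  then obtain k' where k': "k = Suc k'" by (cases k) auto
  have R: "\<exists>q. (\<forall>i<k. v (of_rat (q i)) \<le> 1) \<and> v (x ^ n - (\<Sum>i<k. of_rat (q i) * x ^ i)) < 1" for n
  proof (induction n)
    case 0
    have "(\<Sum>i<k. of_rat (if i = 0 then 1 else 0) * x ^ i) = 1"
    proof -
      have "of_rat (if i = 0 then 1 else 0) * x ^ i = (if i = 0 then 1 else 0)" for i by simp
      thus ?thesis unfolding k' by simp
    qed
    thus ?case by (intro exI[of _ "\<lambda>i. if i = 0 then 1 else 0"]) simp
  next
    case (Suc n)
    then obtain q where q: "\<And>i. i < k \<Longrightarrow> v (of_rat (q i)) \<le> 1"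
      "v (x ^ n - (\<Sum>i<k. of_rat (q i) * x ^ i)) < 1" by blast
    define q' where "q' i = (if i = 0 then 0 else q (i - 1)) - q k' * b i" for i
    have "x * (\<Sum>i<k. of_rat (q i) * x ^ i) = (\<Sum>i<k'. of_rat (q i) * x ^ Suc i) + of_rat (q k') * x ^ k"
      by (simp add: k' sum_distrib_left algebra_simps)
    also have "(\<Sum>i<k'. of_rat (q i) * x ^ Suc i) = (\<Sum>i<k. of_rat (if i = 0 then 0 else q (i - 1)) * x ^ i)"
      unfolding k' by (subst sum.lessThan_Suc_shift) simp
    finally have "x ^ Suc n - (\<Sum>i<k. of_rat (q' i) * x ^ i) =
        x * (x ^ n - (\<Sum>i<k. of_rat (q i) * x ^ i)) + of_rat (q k') * (x ^ k + (\<Sum>i<k. of_rat (b i) * x ^ i))"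
      unfolding q'_def
      by (simp add: of_rat_diff of_rat_mult left_diff_distrib sum_subtractf sum_distrib_left algebra_simps)
    moreover have "v (x * (x ^ n - (\<Sum>i<k. of_rat (q i) * x ^ i))) < 1"
      using q(2) x xn sm by (simp add: v_mult diff_mem)
    moreover have "v (of_rat (q k') * (x ^ k + (\<Sum>i<k. of_rat (b i) * x ^ i))) < 1"
    proof -
      have "v (of_rat (q k') * (x ^ k + (\<Sum>i<k. of_rat (b i) * x ^ i)))
          = v (of_rat (q k')) * v (x ^ k + (\<Sum>i<k. of_rat (b i) * x ^ i))"
        by (intro v_mult of_rat_mem add_mem xn sm)
      also have "\<dots> \<le> 1 * v (x ^ k + (\<Sum>i<k. of_rat (b i) * x ^ i))"
        using q(1)[of k'] k' by (intro mult_right_mono v_nonneg add_mem xn sm) auto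
      finally show ?thesis using red by simp
    qed
    ultimately have "v (x ^ Suc n - (\<Sum>i<k. of_rat (q' i) * x ^ i)) < 1"
      by (simp del: power_Suc) (intro v_add_less mult_mem x diff_mem add_mem xn sm of_rat_mem)
    moreover have "v (of_rat (q' i)) \<le> 1" if i: "i < k" for i
    proof -
      have "v (of_rat (q k' * b i)) \<le> 1"
        using mult_mono[of "v (of_rat (q k'))" 1 "v (of_rat (b i))" 1] q(1)[of k'] vb1[of i] i k' k(1)
        by (simp add: of_rat_mult v_mult)
      moreover have "v (of_rat (if i = 0 then 0 else q (i - 1))) \<le> 1" using q(1)[of "i - 1"] i by simp
      ultimately show ?thesis
        unfolding q'_def of_rat_diff
        using v_diff_le_max[of "of_rat (if i = 0 then 0 else q (i - 1))" "of_rat (q k' * b i)"] by simp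
    qed
    ultimately show ?case by blast
  qed
  \<comment> \<open>Integral coefficients are replaced by residues below p, which leaves at most p^k
    coefficient vectors.\<close>
  have "\<exists>r. (\<forall>i<k. r i < p) \<and> v (x ^ n - (\<Sum>i<k. of_rat (of_nat (r i)) * x ^ i)) < 1" for n
  proof -
    obtain q where q: "\<And>i. i < k \<Longrightarrow> v (of_rat (q i)) \<le> 1"
      "v (x ^ n - (\<Sum>i<k. of_rat (q i) * x ^ i)) < 1" using R by blast
    have "\<forall>i. \<exists>c. i < k \<longrightarrow> c < p \<and> v (of_rat (q i) - of_nat c) < 1"
      using integral_rat_residue q(1) by blast
    then obtain r where r: "\<And>i. i < k \<Longrightarrow> r i < p" "\<And>i. i < k \<Longrightarrow> v (of_rat (q i) - of_nat (r i)) < 1"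
      by metis
    have "x ^ n - (\<Sum>i<k. of_rat (of_nat (r i)) * x ^ i) =
        (x ^ n - (\<Sum>i<k. of_rat (q i) * x ^ i)) + (\<Sum>i<k. (of_rat (q i) - of_nat (r i)) * x ^ i)"
      by (simp add: left_diff_distrib sum_subtractf)
    moreover have "v (\<Sum>i<k. (of_rat (q i) - of_nat (r i)) * x ^ i) < 1"
      by (rule v_sum_less) (auto simp: v_mult diff_mem mult_mem xn r)
    ultimately have "v (x ^ n - (\<Sum>i<k. of_rat (of_nat (r i)) * x ^ i)) < 1"
      using q(2) by (simp only:) (intro v_add_less diff_mem xn sm sum_mem mult_mem of_rat_mem of_nat_mem)
    thus ?thesis using r(1) by blast
  qed
  then obtain r where r: "\<And>n i. i < k \<Longrightarrow> r n i < p"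
    "\<And>n. v (x ^ n - (\<Sum>i<k. of_rat (of_nat (r n i)) * x ^ i)) < 1" by metis
  have "(\<lambda>n. restrict (r n) {..<k}) ` UNIV \<subseteq> PiE {..<k} (\<lambda>_. {..<p})" using r(1) by (auto split: if_splits)
  moreover have "finite (PiE {..<k} (\<lambda>_. {..<p}))" by (intro finite_PiE) auto
  ultimately have "finite (range (\<lambda>n. restrict (r n) {..<k}))" by (rule finite_subset)
  hence "\<not> inj (\<lambda>n. restrict (r n) {..<k})" using finite_imageD infinite_UNIV_nat by blast
  \<comment> \<open>Two powers of x share their residue; the smaller one has absolute value 1 and
    cancels.\<close>
  then obtain i j where ij: "i < j" "restrict (r i) {..<k} = restrict (r j) {..<k}"
    unfolding inj_def by (metis linorder_neqE_nat)
  hence "r i l = r j l" if "l < k" for l using that by (metis lessThan_iff restrict_apply')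
  hence eq: "(\<Sum>l<k. of_rat (of_nat (r i l)) * x ^ l) = (\<Sum>l<k. of_rat (of_nat (r j l)) * x ^ l)" by simp
  have "v ((x ^ j - (\<Sum>l<k. of_rat (of_nat (r j l)) * x ^ l)) - (x ^ i - (\<Sum>l<k. of_rat (of_nat (r i l)) * x ^ l))) < 1"
    by (rule v_diff_less[OF _ _ r(2) r(2)]) (intro diff_mem xn sm)+
  hence "v (x ^ j - x ^ i) < 1" unfolding eq by simp
  also have "x ^ j - x ^ i = x ^ i * (x ^ (j - i) - 1)"
    using ij(1) by (simp add: right_diff_distrib flip: power_add)
  also have "v \<dots> = v (x ^ (j - i) - 1)" using xn by (simp add: v_mult diff_mem)
  finally have "v (x ^ (j - i) - 1) < 1" .
  thus ?thesis using ij(1) by (intro exI[of _ "j - i"]) auto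
qed

text \<open>The binomial coefficients strictly inside the row p are divisible by p, so the mixed
  terms gain the factor 1/p.\<close>

lemma v_power_p_expand:
  assumes u: "u \<in> K" "v u \<le> 1"
  shows "v ((1 + u) ^ p - 1 - u ^ p) \<le> v u / real p"
proof -
  have sub: "{..p} = {0, p} \<union> {0<..<p}" using p_gt_1 by auto
  have "(1 + u) ^ p = (\<Sum>i\<le>p. of_nat (p choose i) * u ^ i)"
    using binomial_ring[of u 1 p] by (simp add: add.commute)
  also have "\<dots> = 1 + u ^ p + (\<Sum>i\<in>{0<..<p}. of_nat (p choose i) * u ^ i)"
    unfolding sub using p_gt_1 by (subst sum.union_disjoint) auto
  finally have "(1 + u) ^ p - 1 - u ^ p = (\<Sum>i\<in>{0<..<p}. of_nat (p choose i) * u ^ i)" by simp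
  also have "v \<dots> \<le> v u / real p"
  proof (rule v_sum_bound)
    fix i assume i: "i \<in> {0<..<p}"
    hence "p dvd (p choose i)" using prime_p by (intro dvd_choose_prime) auto
    then obtain t where t: "p choose i = p * t" by auto
    have "v (of_nat (p choose i) * u ^ i) = 1 / real p * v (of_nat t) * v u ^ i"
      unfolding t by (simp add: v_mult mult_mem power_mem u v_p v_power)
    also have "\<dots> \<le> 1 / real p * 1 * v u ^ 1"
      using u i by (intro mult_mono power_decreasing v_of_nat_le_1) auto
    finally show "v (of_nat (p choose i) * u ^ i) \<le> v u / real p" by simp
  qed (use u in \<open>auto intro: mult_mem power_mem\<close>)
  finally show ?thesis .
qed

text \<open>In the expansion 1 + s u + u^2 w with v w at most 1 the linear term dominates, because s
  is a unit and v u < 1.\<close>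

lemma v_power_coprime:
  assumes u: "u \<in> K" "v u < 1" and s: "\<not> p dvd s"
  shows "v ((1 + u) ^ s - 1) = v u"
proof (cases "u = 0")
  case False
  have "\<exists>w\<in>K. v w \<le> 1 \<and> (1 + u) ^ s = 1 + of_nat s * u + u * u * w" for s
  proof (induction s)
    case 0 show ?case by (intro bexI[of _ 0]) auto
  next
    case (Suc s)
    then obtain w where w: "w \<in> K" "v w \<le> 1" "(1 + u) ^ s = 1 + of_nat s * u + u * u * w" by blast
    have "v (w * (1 + u)) \<le> 1"
      using v_add_le_bound[of 1 u 1] mult_mono[of "v w" 1 "v (1 + u)" 1] u w
      by (simp add: v_mult add_mem)
    hence "v (w * (1 + u) + of_nat s) \<le> 1"
      by (intro v_add_le_bound v_of_nat_le_1 mult_mem add_mem w u) auto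
    moreover have "(1 + u) ^ Suc s = 1 + of_nat (Suc s) * u + u * u * (w * (1 + u) + of_nat s)"
      by (simp add: w(3) algebra_simps)
    ultimately show ?case using u w by (intro bexI[of _ "w * (1 + u) + of_nat s"]) (auto intro: add_mem mult_mem)
  qed
  then obtain w where w: "w \<in> K" "v w \<le> 1" "(1 + u) ^ s = 1 + of_nat s * u + u * u * w" by blast
  have vs: "v (of_nat s * u) = v u" using v_of_nat_coprime[OF s] u by (simp add: v_mult)
  have "v (u * u * w) = v u * (v u * v w)" using u w by (simp add: v_mult mult_mem)
  also have "\<dots> < v u * 1"
  proof (rule mult_strict_left_mono)
    have "v u * v w \<le> v u * 1" using u w by (intro mult_left_mono) auto
    thus "v u * v w < 1" using u by simp
  qed (rule v_pos[OF u(1) False])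
  finally have "v (of_nat s * u + u * u * w) = v (of_nat s * u)"
    using u w vs by (intro v_add_eq mult_mem of_nat_mem) auto
  thus ?thesis using w(3) vs by simp
qed simp

text \<open>Here m is the order of the residue of x, and \<phi> a is the distance of x^(m p^a) from
  1. A further power prime to p keeps this distance, a p-th power strictly contracts it. That x is
  not a root of unity keeps \<phi> positive.\<close>

theorem unit_power_minus_one:
  assumes K: "K = rat_span bs" and x: "x \<in> K" "v x = 1" and nru: "\<not> root_of_unity x"
  obtains m \<phi> where "m \<ge> 1" "\<not> p dvd m" "\<And>a. 0 < \<phi> a" "\<And>a. \<phi> a < 1" "\<And>a. \<phi> (Suc a) < \<phi> a" "\<phi> \<longlonglongrightarrow> 0"
    "\<And>n. n \<ge> 1 \<Longrightarrow> v (x ^ n - 1) = (if m dvd n then \<phi> (multiplicity p n) else 1)"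
proof -
  have xn: "x ^ n \<in> K" "v (x ^ n) = 1" for n using x by (auto simp: v_power)
  have xn1: "x ^ n - 1 \<in> K" for n by (intro diff_mem xn one_mem)
  have le1: "v (x ^ n - 1) \<le> 1" for n using v_diff_le_max[OF xn(1) one_mem, of n] xn by simp
  define m where "m = (LEAST m. m \<ge> 1 \<and> v (x ^ m - 1) < 1)"
  have m: "m \<ge> 1" "v (x ^ m - 1) < 1"
    using LeastI_ex[of "\<lambda>m. m \<ge> 1 \<and> v (x ^ m - 1) < 1"] unit_power_near_1[OF K x] by (auto simp: m_def)
  have m_least: "m \<le> l" if "l \<ge> 1" "v (x ^ l - 1) < 1" for l unfolding m_def using that by (intro Least_le) auto
  have mult: "v (x ^ (m * q) - 1) < 1" for q
  proof (induction q)
    case (Suc q)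
    have "x ^ (m * Suc q) - 1 = x ^ m * (x ^ (m * q) - 1) + (x ^ m - 1)"
      by (simp add: power_add algebra_simps)
    moreover have "v (x ^ m * (x ^ (m * q) - 1)) < 1" using Suc xn xn1 by (simp add: v_mult)
    ultimately show ?case using m(2) by (simp only:) (intro v_add_less mult_mem xn xn1)
  qed simp
  have not_mult: "v (x ^ n - 1) = 1" if "\<not> m dvd n" for n
  proof (rule ccontr)
    assume "v (x ^ n - 1) \<noteq> 1"
    hence n: "v (x ^ n - 1) < 1" using le1[of n] by simp
    define r where "r = n mod m"
    have nr: "n = m * (n div m) + r" by (simp add: r_def)
    have e: "x ^ r - 1 = (x ^ n - 1) - x ^ r * (x ^ (m * (n div m)) - 1)"
      by (subst nr) (simp add: power_add algebra_simps)
    have small: "v (x ^ r * (x ^ (m * (n div m)) - 1)) < 1"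
      using mult xn xn1 by (simp add: v_mult)
    have "v (x ^ r - 1) < 1" unfolding e by (rule v_diff_less[OF xn1 mult_mem[OF xn(1) xn1] n small])
    moreover have "r \<ge> 1" using that by (simp add: r_def Suc_le_eq mod_greater_zero_iff_not_dvd)
    ultimately have "m \<le> r" by (intro m_least)
    moreover have "r < m" using m(1) by (simp add: r_def)
    ultimately show False by simp
  qed
  have pm: "\<not> p dvd m"
  proof
    assume "p dvd m"
    \<comment> \<open>If m = p l, then (x^l - 1)^p is congruent to x^m - 1 and hence to 0 in the
      residue field. So the exponent l would already do, against the minimality of m.\<close>
    then obtain l where l: "m = p * l" by auto
    define u where "u = x ^ l - 1"
    have u: "u \<in> K" "v u \<le> 1" unfolding u_def using xn1 le1 by auto
    have "(1 + u) ^ p = x ^ m" by (simp add: u_def l power_mult mult.commute)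
    hence "v (x ^ m - 1 - u ^ p) \<le> v u / real p" using v_power_p_expand[OF u] by simp
    also have "\<dots> < 1" using u p_gt_1 by (simp add: divide_less_eq)
    finally have 1: "v (x ^ m - 1 - u ^ p) < 1" .
    have "v ((x ^ m - 1) - (x ^ m - 1 - u ^ p)) < 1"
      by (intro v_diff_less m 1 xn1 diff_mem power_mem u)
    hence "v u ^ p < 1" using u by (simp add: v_power)
    hence "v u < 1" using u by (metis linorder_not_less one_le_power)
    moreover have "l \<ge> 1" using l m(1) by (cases l) auto
    ultimately have "m \<le> l" unfolding u_def by (intro m_least)
    thus False using l p_gt_1 \<open>l \<ge> 1\<close> by simp
  qed
  define \<phi> where "\<phi> a = v (x ^ (m * p ^ a) - 1)" for a
  have phi_pos: "0 < \<phi> a" for a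
  proof -
    have "m * p ^ a \<ge> 1" using m(1) p_gt_1 by (simp add: Suc_le_eq)
    hence "x ^ (m * p ^ a) \<noteq> 1" using nru by (auto simp: root_of_unity_def)
    thus ?thesis unfolding \<phi>_def by (intro v_pos xn1) simp
  qed
  have phi_lt: "\<phi> a < 1" for a unfolding \<phi>_def by (rule mult)
  \<comment> \<open>A contraction factor valid at every level: 1/p comes from the mixed binomial
    terms, \<phi> 0 from the term u^p.\<close>
  define c where "c = max (1 / real p) (\<phi> 0)"
  have c: "0 < c" "c < 1" using phi_pos[of 0] phi_lt[of 0] p_gt_1 by (auto simp: c_def)
  have step: "\<phi> (Suc a) \<le> \<phi> a * max (1 / real p) (\<phi> a)" for a
  proof -
    define u where "u = x ^ (m * p ^ a) - 1"
    have u: "u \<in> K" "v u \<le> 1" unfolding u_def using xn1 le1 by auto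
    have "(1 + u) ^ p = x ^ (m * p ^ Suc a)" by (simp add: u_def power_mult[symmetric] algebra_simps)
    hence "v ((x ^ (m * p ^ Suc a) - 1) - u ^ p) \<le> v u / real p" using v_power_p_expand[OF u] by simp
    hence "v ((x ^ (m * p ^ Suc a) - 1) - u ^ p) \<le> v u * max (1 / real p) (v u)"
      using mult_left_mono[of "1 / real p" "max (1 / real p) (v u)" "v u"] u by simp
    moreover have "v (u ^ p) \<le> v u * max (1 / real p) (v u)"
    proof -
      have "v u ^ p \<le> v u ^ 2" using u p_gt_1 by (intro power_decreasing) auto
      also have "\<dots> \<le> v u * max (1 / real p) (v u)"
        unfolding power2_eq_square using u by (intro mult_left_mono) auto
      finally show ?thesis using u by (simp add: v_power)
    qed
    ultimately have "v (((x ^ (m * p ^ Suc a) - 1) - u ^ p) + u ^ p) \<le> v u * max (1 / real p) (v u)"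
      by (intro v_add_le_bound diff_mem xn1 power_mem u)
    thus ?thesis by (simp add: \<phi>_def u_def)
  qed
  have dec: "\<phi> (Suc a) < \<phi> a" for a
  proof -
    have "\<phi> a * max (1 / real p) (\<phi> a) < \<phi> a * 1"
      using phi_pos[of a] phi_lt[of a] p_gt_1 by (intro mult_strict_left_mono) auto
    thus ?thesis using step[of a] by simp
  qed
  have "\<phi> a \<le> c ^ a" for a
  proof -
    have anti: "\<phi> a \<le> \<phi> 0" for a using dec by (induction a) (auto intro: order_trans less_imp_le)
    show ?thesis
    proof (induction a)
      case (Suc a)
      have "\<phi> (Suc a) \<le> \<phi> a * max (1 / real p) (\<phi> a)" by (rule step)
      also have "\<dots> \<le> c ^ a * c"
        using Suc anti[of a] phi_pos[of a] c by (intro mult_mono) (auto simp: c_def)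
      finally show ?case by (simp add: mult.commute)
    qed (use phi_lt[of 0] in simp)
  qed
  note le = this
  have clim: "(\<lambda>a. c ^ a) \<longlonglongrightarrow> 0" using c by (intro LIMSEQ_realpow_zero) auto
  have lim: "\<phi> \<longlonglongrightarrow> 0"
    by (rule tendsto_sandwich[OF _ _ tendsto_const clim])
       (use phi_pos le in \<open>auto intro!: always_eventually less_imp_le\<close>)
  have val: "v (x ^ n - 1) = (if m dvd n then \<phi> (multiplicity p n) else 1)" if n: "n \<ge> 1" for n
  proof (cases "m dvd n")
    case True
    define a where "a = multiplicity p n"
    have "p ^ a dvd n" by (simp add: a_def multiplicity_dvd)
    moreover have "coprime m (p ^ a)"
      using prime_p pm by (metis coprime_commute coprime_power_left_iff prime_imp_coprime)
    ultimately have "m * p ^ a dvd n" using True by (simp add: divides_mult)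
    then obtain s where s: "n = m * p ^ a * s" by auto
    have "\<not> p dvd s"
    proof
      assume "p dvd s"
      then obtain t where "s = p * t" by auto
      hence "p ^ Suc a dvd n" by (simp add: s)
      moreover have "n \<noteq> 0" "\<not> is_unit p" using n p_gt_1 by auto
      ultimately have "Suc a \<le> multiplicity p n" by (intro multiplicity_geI) auto
      thus False by (simp add: a_def)
    qed
    hence "v ((1 + (x ^ (m * p ^ a) - 1)) ^ s - 1) = v (x ^ (m * p ^ a) - 1)"
      by (intro v_power_coprime xn1 mult)
    moreover have "(1 + (x ^ (m * p ^ a) - 1)) ^ s = x ^ n" unfolding s by (simp add: power_mult)
    ultimately show ?thesis using True by (simp only: \<phi>_def a_def if_True)
  next
    case False
    thus ?thesis using not_mult by simp
  qed
  show ?thesis by (rule that[OF m(1) pm phi_pos phi_lt dec lim val])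
qed

lemma v_power_minus_one_small:
  assumes "x \<in> K" "v x < 1" "n \<ge> 1"
  shows "v (x ^ n - 1) = 1"
proof -
  have "v (x ^ n) < 1" using assms by (simp add: v_power power_less_one_iff)
  hence "v (- 1 + x ^ n) = v (- 1)" using assms by (intro v_add_eq uminus_mem power_mem one_mem) auto
  thus ?thesis by simp
qed

lemma v_power_minus_one_large:
  assumes "x \<in> K" "v x > 1" "n \<ge> 1"
  shows "v (x ^ n - 1) = v x ^ n"
proof -
  have "v (x ^ n) > 1" using assms by (simp add: v_power one_less_power)
  hence "v (x ^ n + - 1) = v (x ^ n)" using assms by (intro v_add_eq uminus_mem power_mem one_mem) auto
  thus ?thesis using assms by (simp add: v_power)
qed

end

section \<open>Exponential sums and rational zeta functions\<close>

text \<open>A list admits repeated frequencies, so addition is concatenation and the coefficients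
  stay in C. Only n >= 1 is constrained, as in the exponent of the zeta series. Integer coefficients
  serve rationality, frequencies on the unit circle serve the Abel means.\<close>

definition exp_sum :: "complex set \<Rightarrow> complex set \<Rightarrow> (nat \<Rightarrow> complex) \<Rightarrow> bool" where
  "exp_sum C \<Omega> f \<longleftrightarrow> (\<exists>xs. set xs \<subseteq> C \<times> \<Omega> \<and> (\<forall>n\<ge>1. f n = (\<Sum>(a, w)\<leftarrow>xs. a * w ^ n)))"

lemma exp_sum_cong: "(\<And>n. n \<ge> 1 \<Longrightarrow> f n = g n) \<Longrightarrow> exp_sum C \<Omega> f \<Longrightarrow> exp_sum C \<Omega> g"
  unfolding exp_sum_def by metis

lemma exp_sum_term: "a \<in> C \<Longrightarrow> w \<in> \<Omega> \<Longrightarrow> exp_sum C \<Omega> (\<lambda>n. a * w ^ n)"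
  unfolding exp_sum_def by (intro exI[of _ "[(a, w)]"]) simp

lemma exp_sum_zero: "exp_sum C \<Omega> (\<lambda>n. 0)"
  unfolding exp_sum_def by (intro exI[of _ "[]"]) simp

lemma exp_sum_add:
  assumes "exp_sum C \<Omega> f" "exp_sum C \<Omega> g"
  shows "exp_sum C \<Omega> (\<lambda>n. f n + g n)"
proof -
  obtain xs where xs: "set xs \<subseteq> C \<times> \<Omega>" "\<And>n. n \<ge> 1 \<Longrightarrow> f n = (\<Sum>(a, w)\<leftarrow>xs. a * w ^ n)"
    using assms(1) unfolding exp_sum_def by blast
  obtain ys where ys: "set ys \<subseteq> C \<times> \<Omega>" "\<And>n. n \<ge> 1 \<Longrightarrow> g n = (\<Sum>(a, w)\<leftarrow>ys. a * w ^ n)"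
    using assms(2) unfolding exp_sum_def by blast
  show ?thesis unfolding exp_sum_def
    by (intro exI[of _ "xs @ ys"]) (use xs ys in auto)
qed

lemma exp_sum_sum: "(\<And>i. i \<in> I \<Longrightarrow> exp_sum C \<Omega> (f i)) \<Longrightarrow> exp_sum C \<Omega> (\<lambda>n. \<Sum>i\<in>I. f i n)"
  by (induction I rule: infinite_finite_induct) (auto intro: exp_sum_add exp_sum_zero)

lemma exp_sum_induct [consumes 1, case_names zero add cong]:
  assumes "exp_sum C \<Omega> f"
    and "P (\<lambda>n. 0)"
    and "\<And>a w g. a \<in> C \<Longrightarrow> w \<in> \<Omega> \<Longrightarrow> P g \<Longrightarrow> P (\<lambda>n. a * w ^ n + g n)"
    and "\<And>g h. P g \<Longrightarrow> (\<And>n. n \<ge> 1 \<Longrightarrow> g n = h n) \<Longrightarrow> P h"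
  shows "P f"
proof -
  obtain xs where xs: "set xs \<subseteq> C \<times> \<Omega>" "\<And>n. n \<ge> 1 \<Longrightarrow> f n = (\<Sum>(a, w)\<leftarrow>xs. a * w ^ n)"
    using assms(1) unfolding exp_sum_def by blast
  have "P (\<lambda>n. \<Sum>(a, w)\<leftarrow>xs. a * w ^ n)"
    using xs(1)
  proof (induction xs)
    case (Cons y ys)
    obtain a w where "y = (a, w)" by (cases y) auto
    thus ?case using Cons assms(3)[of a w] by simp
  qed (simp add: assms(2))
  thus ?thesis by (rule assms(4)) (simp add: xs(2))
qed

lemma exp_sum_mult:
  assumes C: "\<And>a b. a \<in> C \<Longrightarrow> b \<in> C \<Longrightarrow> a * b \<in> C" and W: "\<And>a b. a \<in> \<Omega> \<Longrightarrow> b \<in> \<Omega> \<Longrightarrow> a * b \<in> \<Omega>"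
    and f: "exp_sum C \<Omega> f" and g: "exp_sum C \<Omega> g"
  shows "exp_sum C \<Omega> (\<lambda>n. f n * g n)"
  using f
proof (induction rule: exp_sum_induct)
  case zero
  show ?case by (simp add: exp_sum_zero)
next
  case (add a w h)
  have "exp_sum C \<Omega> (\<lambda>n. a * w ^ n * g n)"
    using g
  proof (induction rule: exp_sum_induct)
    case zero
    show ?case by (simp add: exp_sum_zero)
  next
    case (add b u h)
    have "exp_sum C \<Omega> (\<lambda>n. (a * b) * (w * u) ^ n)" using add \<open>a \<in> C\<close> \<open>w \<in> \<Omega>\<close> by (intro exp_sum_term C W)
    from exp_sum_add[OF this add(3)] show ?case by (simp add: power_mult_distrib algebra_simps)
  next
    case (cong h1 h2)
    show ?case by (rule exp_sum_cong[OF _ cong(1)]) (simp add: cong(2))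
  qed
  from exp_sum_add[OF this add(3)] show ?case by (simp add: algebra_simps)
next
  case (cong h1 h2)
  show ?case by (rule exp_sum_cong[OF _ cong(1)]) (simp add: cong(2))
qed

text \<open>Equal frequencies are merged, at the price of leaving the coefficient set. Once the
  frequencies are distinct, the coefficients can be recovered as Abel means.\<close>

lemma exp_sum_finite_support:
  assumes "exp_sum C \<Omega> f"
  obtains A a where "finite A" "A \<subseteq> \<Omega>" "\<And>n. n \<ge> 1 \<Longrightarrow> f n = (\<Sum>w\<in>A. a w * w ^ n)"
proof -
  have "\<exists>A a. finite A \<and> A \<subseteq> \<Omega> \<and> (\<forall>n\<ge>1. f n = (\<Sum>w\<in>A. a w * w ^ n))"
    using assms
  proof (induction rule: exp_sum_induct)
    case zero
    show ?case by (intro exI[of _ "{}"]) simp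
  next
    case (add c w g)
    then obtain A a where A: "finite A" "A \<subseteq> \<Omega>" "\<And>n. n \<ge> 1 \<Longrightarrow> g n = (\<Sum>w\<in>A. a w * w ^ n)" by blast
    define b where "b u = (if u \<in> A then a u else 0) + (if u = w then c else 0)" for u
    have "c * w ^ n + g n = (\<Sum>u\<in>insert w A. b u * u ^ n)" if "n \<ge> 1" for n
    proof -
      have "(\<Sum>u\<in>insert w A. b u * u ^ n) =
          (\<Sum>u\<in>insert w A. if u \<in> A then a u * u ^ n else 0) + (\<Sum>u\<in>insert w A. if u = w then c * w ^ n else 0)"
        unfolding b_def distrib_right sum.distrib by (intro arg_cong2[of _ _ _ _ "(+)"] sum.cong) auto
      also have "(\<Sum>u\<in>insert w A. if u \<in> A then a u * u ^ n else 0) = (\<Sum>u\<in>A. a u * u ^ n)"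
        using A(1) by (intro sum.mono_neutral_cong_right) auto
      finally show ?thesis using A that by simp
    qed
    thus ?case using A add by (intro exI[of _ "insert w A"] exI[of _ b]) auto
  next
    case (cong g h)
    thus ?case by metis
  qed
  thus ?thesis using that by blast
qed

section \<open>Zeta series as solutions of a linear differential equation\<close>

definition zeta_fps :: "(nat \<Rightarrow> complex) \<Rightarrow> complex fps" where
  "zeta_fps c = fps_exp 1 oo Abs_fps (\<lambda>n. if n = 0 then 0 else c n / of_nat n)"

lemma zeta_series_eq: "zeta_series c = zeta_fps (\<lambda>n. of_real (c n))"
  by (simp add: zeta_series_def zeta_fps_def)

lemma zeta_fps_nth_0 [simp]: "zeta_fps c $ 0 = 1"
  by (simp add: zeta_fps_def fps_compose_nth)

lemma zeta_fps_deriv: "fps_deriv (zeta_fps c) = zeta_fps c * Abs_fps (\<lambda>n. c (Suc n))"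
proof -
  have "fps_deriv (Abs_fps (\<lambda>n. if n = 0 then 0 else c n / of_nat n)) = Abs_fps (\<lambda>n. c (Suc n))"
    by (rule fps_ext) (simp del: of_nat_Suc)
  thus ?thesis unfolding zeta_fps_def by (subst fps_compose_deriv) simp_all
qed

text \<open>The equation is a recursion for the coefficients. Together with
  \<open>zeta_fps_deriv\<close> it reduces identities between zeta series to a comparison of
  logarithmic derivatives, also for the analytic exponential in
  \<open>zeta_fps_on_disc\<close>.\<close>

lemma fps_linear_ode_unique:
  fixes F G A :: "complex fps"
  assumes "fps_deriv F = F * A" "fps_deriv G = G * A" "F $ 0 = G $ 0"
  shows "F = G"
proof (rule fps_ext)
  fix n
  show "F $ n = G $ n"
  proof (induction n rule: less_induct)
    case (less n)
    show ?case
    proof (cases n)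
      case (Suc m)
      have "of_nat (Suc m) * F $ Suc m = fps_deriv F $ m" by simp
      also have "\<dots> = (\<Sum>i=0..m. F $ i * A $ (m - i))" unfolding assms(1) by (simp add: fps_mult_nth)
      also have "\<dots> = (\<Sum>i=0..m. G $ i * A $ (m - i))" using less Suc by (intro sum.cong) auto
      also have "\<dots> = fps_deriv G $ m" unfolding assms(2) by (simp add: fps_mult_nth)
      also have "\<dots> = of_nat (Suc m) * G $ Suc m" by simp
      finally show ?thesis using Suc by (simp del: of_nat_Suc)
    qed (simp add: assms(3))
  qed
qed

lemma zeta_fps_add: "zeta_fps (\<lambda>n. c n + d n) = zeta_fps c * zeta_fps d"
proof (rule fps_linear_ode_unique[OF zeta_fps_deriv])
  have "Abs_fps (\<lambda>n. c (Suc n) + d (Suc n)) = Abs_fps (\<lambda>n. c (Suc n)) + Abs_fps (\<lambda>n. d (Suc n))"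
    by (rule fps_ext) simp
  thus "fps_deriv (zeta_fps c * zeta_fps d) = zeta_fps c * zeta_fps d * Abs_fps (\<lambda>n. c (Suc n) + d (Suc n))"
    by (simp add: zeta_fps_deriv algebra_simps)
qed simp

lemma zeta_fps_cong: "(\<And>n. n \<ge> 1 \<Longrightarrow> c n = d n) \<Longrightarrow> zeta_fps c = zeta_fps d"
  unfolding zeta_fps_def by (intro arg_cong2[of _ _ _ _ fps_compose] refl fps_ext) auto

lemma zeta_fps_0: "zeta_fps (\<lambda>n. 0) = 1"
  by (rule fps_linear_ode_unique[OF zeta_fps_deriv]) (simp_all add: fps_eq_iff fps_mult_nth)

text \<open>Formally the zeta series is exp(-log(1 - w x)); its product with 1 - w x has derivative
  0 and constant term 1.\<close>

lemma zeta_fps_geometric: "zeta_fps (\<lambda>n. w ^ n) * (1 - fps_const w * fps_X) = 1"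
proof -
  let ?Z = "zeta_fps (\<lambda>n. w ^ n)" and ?A = "Abs_fps (\<lambda>n. w ^ Suc n)"
  have A: "?A * (1 - fps_const w * fps_X) = fps_const w"
  proof (rule fps_ext)
    fix n
    have "?A * (1 - fps_const w * fps_X) = ?A - fps_const w * (?A * fps_X)" by (simp add: algebra_simps)
    thus "(?A * (1 - fps_const w * fps_X)) $ n = fps_const w $ n"
      by (cases n) simp_all
  qed
  have "fps_deriv (?Z * (1 - fps_const w * fps_X)) = ?Z * (?A * (1 - fps_const w * fps_X)) - ?Z * fps_const w"
    by (simp add: zeta_fps_deriv algebra_simps)
  also have "\<dots> = 0" unfolding A by simp
  finally have "?Z * (1 - fps_const w * fps_X) = fps_const ((?Z * (1 - fps_const w * fps_X)) $ 0)"
    by (simp only: fps_deriv_eq_0_iff)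
  thus ?thesis by (simp add: fps_mult_nth)
qed

lemma rational_series_mult: "rational_series F \<Longrightarrow> rational_series G \<Longrightarrow> rational_series (F * G)"
proof -
  assume "rational_series F" "rational_series G"
  then obtain P Q P' Q' where "Q \<noteq> 0" "fps_of_poly Q * F = fps_of_poly P"
    "Q' \<noteq> 0" "fps_of_poly Q' * G = fps_of_poly P'" unfolding rational_series_def by blast
  moreover from this have "fps_of_poly (Q * Q') * (F * G) = fps_of_poly (P * P')"
    by (metis (no_types, lifting) fps_of_poly_mult mult.assoc mult.left_commute)
  ultimately show ?thesis unfolding rational_series_def by (metis mult_eq_0_iff)
qed

lemma rational_series_inverse: "rational_series F \<Longrightarrow> F * G = 1 \<Longrightarrow> rational_series G"
proof -
  assume "rational_series F" and FG: "F * G = 1"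
  then obtain P Q where PQ: "Q \<noteq> 0" "fps_of_poly Q * F = fps_of_poly P" unfolding rational_series_def by blast
  have "fps_of_poly P * G = fps_of_poly Q" unfolding PQ(2)[symmetric] using FG by (simp add: mult.assoc)
  moreover have "P \<noteq> 0" using PQ FG by auto
  ultimately show ?thesis unfolding rational_series_def by blast
qed

lemma rational_series_1: "rational_series 1"
  unfolding rational_series_def by (intro exI[of _ 1]) simp

lemma rational_zeta_power: "rational_series (zeta_fps (\<lambda>n. w ^ n))"
proof -
  have e: "fps_of_poly [:1, - w:] = 1 - fps_const w * fps_X"
    by (rule fps_ext) (auto simp: coeff_pCons split: nat.splits)
  have "fps_of_poly [:1, - w:] * zeta_fps (\<lambda>n. w ^ n) = fps_of_poly 1"
    unfolding e fps_of_poly_1 by (subst mult.commute) (rule zeta_fps_geometric)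
  thus ?thesis unfolding rational_series_def by (intro exI[of _ 1] exI[of _ "[:1, - w:]"]) simp
qed

lemma rational_zeta_int_term: "rational_series (zeta_fps (\<lambda>n. of_int m * w ^ n))"
proof -
  have nat: "rational_series (zeta_fps (\<lambda>n. of_nat k * w ^ n))" for k
  proof (induction k)
    case (Suc k)
    have "zeta_fps (\<lambda>n. of_nat (Suc k) * w ^ n) = zeta_fps (\<lambda>n. w ^ n) * zeta_fps (\<lambda>n. of_nat k * w ^ n)"
      by (simp add: zeta_fps_add[symmetric] algebra_simps)
    thus ?case using rational_series_mult[OF rational_zeta_power Suc] by simp
  qed (simp add: zeta_fps_0 rational_series_1)
  show ?thesis
  proof (cases m rule: int_cases2)
    case (nonneg k)
    thus ?thesis using nat[of k] by simp
  next
    case (nonpos k)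
    have "zeta_fps (\<lambda>n. of_nat k * w ^ n) * zeta_fps (\<lambda>n. of_int m * w ^ n) = 1"
      by (simp add: nonpos zeta_fps_add[symmetric] zeta_fps_0)
    thus ?thesis by (rule rational_series_inverse[OF nat])
  qed
qed

theorem rational_zeta_exp_sum:
  assumes "exp_sum \<int> \<Omega> c"
  shows "rational_series (zeta_fps c)"
  using assms
proof (induction rule: exp_sum_induct)
  case zero
  show ?case by (simp add: zeta_fps_0 rational_series_1)
next
  case (add a w g)
  then obtain m where "a = of_int m" by (auto elim: Ints_cases)
  thus ?case using rational_series_mult[OF rational_zeta_int_term add(3), of m w]
    by (simp add: zeta_fps_add)
next
  case (cong g h)
  thus ?case using zeta_fps_cong[of g h] by simp
qed

text \<open>The quotient P / Q extends F to the plane without the zeros of Q outside the disc, and a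
  plane without finitely many points is connected.\<close>

theorem rational_not_natural_boundary:
  assumes "rational_series F"
  shows "\<not> has_natural_boundary F"
proof
  assume nb: "has_natural_boundary F"
  obtain P Q where PQ: "Q \<noteq> 0" "fps_of_poly Q * F = fps_of_poly P"
    using assms unfolding rational_series_def by blast
  let ?B = "eball 0 (fps_conv_radius F) :: complex set"
  define V where "V = {x. poly Q x \<noteq> 0}"
  define U where "U = ?B \<union> V"
  have fin: "finite {x. poly Q x = 0}" using PQ(1) by (rule poly_roots_finite)
  have V: "V = - {x. poly Q x = 0}" by (auto simp: V_def)
  have oV: "open V" unfolding V using finite_imp_closed[OF fin] by (rule open_Compl)
  have U: "U = UNIV - ({x. poly Q x = 0} - ?B)" by (auto simp: U_def V_def)
  have "connected U" unfolding U using fin by (intro connected_open_delete_finite) auto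
  have oU: "open U" unfolding U_def using oV by (intro open_Un) auto
  have eq: "eval_fps F x = poly P x / poly Q x" if "x \<in> ?B" "x \<in> V" for x
  proof -
    have "poly Q x * eval_fps F x = poly P x"
      using that(1) arg_cong[OF PQ(2), of "\<lambda>F. eval_fps F x"]
      by (subst (asm) eval_fps_mult) (auto simp: eval_fps_of_poly in_eball_iff)
    thus ?thesis using that(2) by (simp add: V_def field_simps)
  qed
  \<comment> \<open>Q may vanish inside the disc, where F is analytic all the same; so the series is
    used there and the quotient elsewhere.\<close>
  define g where "g x = (if x \<in> ?B then eval_fps F x else poly P x / poly Q x)" for x
  have "g holomorphic_on ?B"
    by (rule holomorphic_transform[OF holomorphic_on_eval_fps[OF order_refl]]) (auto simp: g_def)
  moreover have "g holomorphic_on V"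
    by (rule holomorphic_transform[where f = "\<lambda>x. poly P x / poly Q x"])
       (auto simp: g_def eq V_def intro!: holomorphic_intros)
  ultimately have "g analytic_on U"
    unfolding U_def using oV by (auto simp: analytic_on_Un analytic_on_open)
  moreover have "?B \<subset> U"
  proof -
    obtain R where R: "fps_conv_radius F = ereal R" "R > 0"
      using nb unfolding has_natural_boundary_def by (cases "fps_conv_radius F") auto
    \<comment> \<open>The complement of the disc is infinite and so contains a point that is no zero
      of Q; this makes the inclusion strict.\<close>
    have "\<not> UNIV - ball 0 R \<subseteq> {x::complex. poly Q x = 0}"
    proof
      assume "UNIV - ball 0 R \<subseteq> {x::complex. poly Q x = 0}"
      hence "finite (UNIV - ball 0 R :: complex set)" using fin finite_subset by blast
      hence "bounded (UNIV - ball 0 R \<union> ball 0 R :: complex set)"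
        using finite_imp_bounded bounded_Un bounded_ball by blast
      moreover have "UNIV - ball 0 R \<union> ball 0 R = (UNIV :: complex set)" by auto
      ultimately show False using not_bounded_UNIV by metis
    qed
    thus ?thesis unfolding U_def V_def R(1) by (auto simp: in_eball_iff)
  qed
  moreover have "\<forall>x\<in>?B. g x = eval_fps F x" by (simp add: g_def)
  ultimately show False using nb oU \<open>connected U\<close> unfolding has_natural_boundary_def by blast
qed

section \<open>Abel means\<close>

text \<open>The mean measures growth of order 1/(1 - r) along a radius, which is the growth of a
  logarithmic derivative at a zero or pole. Boundedness is built in so that the series converges for
  0 < r < 1.\<close>

definition abel_mean :: "(nat \<Rightarrow> complex) \<Rightarrow> complex \<Rightarrow> bool" where
  "abel_mean f L \<longleftrightarrow> bounded (range f) \<and>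
     ((\<lambda>r. of_real (1 - r) * (\<Sum>n. f n * of_real r ^ n)) \<longlongrightarrow> L) (at_left (1::real))"

lemma eventually_at_left_1: "eventually (\<lambda>r. 0 < r \<and> r < 1) (at_left (1::real))"
  using eventually_at_left_real[of 0 "1::real"] by simp

lemma bounded_seq_power_summable:
  fixes f :: "nat \<Rightarrow> complex"
  assumes "bounded (range f)" "0 < r" "r < (1::real)"
  shows "summable (\<lambda>n. norm (f n * of_real r ^ n))" "summable (\<lambda>n. f n * of_real r ^ n)"
proof -
  obtain B where B: "\<And>n. norm (f n) \<le> B" using assms(1) unfolding bounded_iff by auto
  have "summable (\<lambda>n. B * r ^ n)" using assms by (intro summable_mult summable_geometric) auto
  thus "summable (\<lambda>n. norm (f n * of_real r ^ n))"
    by (rule summable_comparison_test'[of _ 0]) (use assms B in \<open>auto simp: norm_mult norm_power intro!: mult_right_mono\<close>)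
  thus "summable (\<lambda>n. f n * of_real r ^ n)" by (rule summable_norm_cancel)
qed

text \<open>The weights (1 - r) r^n sum to 1.\<close>

lemma abel_sum_bound:
  fixes f :: "nat \<Rightarrow> complex"
  assumes "\<And>n. norm (f n) \<le> B" "0 < r" "r < (1::real)"
  shows "norm (of_real (1 - r) * (\<Sum>n. f n * of_real r ^ n)) \<le> B"
proof -
  have "bounded (range f)" using assms(1) unfolding bounded_iff by auto
  note s = bounded_seq_power_summable[OF this assms(2,3)]
  have "norm (\<Sum>n. f n * of_real r ^ n) \<le> (\<Sum>n. norm (f n * of_real r ^ n))" by (rule summable_norm[OF s(1)])
  also have "\<dots> \<le> (\<Sum>n. B * r ^ n)"
    by (rule suminf_le[OF _ s(1)])
       (use assms in \<open>auto simp: norm_mult norm_power intro!: mult_right_mono summable_mult summable_geometric\<close>)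
  also have "\<dots> = B / (1 - r)" using assms by (simp add: suminf_mult suminf_geometric summable_geometric)
  finally have "(1 - r) * norm (\<Sum>n. f n * of_real r ^ n) \<le> B"
    using assms by (simp add: pos_le_divide_eq mult.commute)
  moreover have "norm (of_real (1 - r) * (\<Sum>n. f n * of_real r ^ n)) = \<bar>1 - r\<bar> * norm (\<Sum>n. f n * of_real r ^ n)"
    by (simp only: norm_mult norm_of_real)
  ultimately show ?thesis using assms by simp
qed

lemma abel_mean_bounded: "abel_mean f L \<Longrightarrow> bounded (range f)"
  by (simp add: abel_mean_def)

lemma abel_mean_add: "abel_mean f L \<Longrightarrow> abel_mean g M \<Longrightarrow> abel_mean (\<lambda>n. f n + g n) (L + M)"
proof -
  assume f: "abel_mean f L" and g: "abel_mean g M"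
  have "((\<lambda>r. of_real (1 - r) * (\<Sum>n. f n * of_real r ^ n) + of_real (1 - r) * (\<Sum>n. g n * of_real r ^ n)) \<longlongrightarrow> L + M) (at_left (1::real))"
    using f g unfolding abel_mean_def by (intro tendsto_add) auto
  moreover have "eventually (\<lambda>r. of_real (1 - r) * (\<Sum>n. f n * of_real r ^ n) + of_real (1 - r) * (\<Sum>n. g n * of_real r ^ n)
      = of_real (1 - r) * (\<Sum>n. (f n + g n) * of_real r ^ n)) (at_left (1::real))"
    using eventually_at_left_1
  proof eventually_elim
    case (elim r)
    show ?case
      using bounded_seq_power_summable(2)[OF abel_mean_bounded[OF f], of r]
        bounded_seq_power_summable(2)[OF abel_mean_bounded[OF g], of r] elim
      by (simp add: distrib_right suminf_add[symmetric] distrib_left)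
  qed
  ultimately have "((\<lambda>r. of_real (1 - r) * (\<Sum>n. (f n + g n) * of_real r ^ n)) \<longlongrightarrow> L + M) (at_left (1::real))"
    by (rule Lim_transform_eventually)
  moreover have "bounded (range (\<lambda>n. f n + g n))"
  proof -
    obtain B C where "\<And>n. norm (f n) \<le> B" "\<And>n. norm (g n) \<le> C"
      using abel_mean_bounded[OF f] abel_mean_bounded[OF g] unfolding bounded_iff by auto
    hence "norm (f n + g n) \<le> B + C" for n using norm_triangle_le add_mono by metis
    thus ?thesis unfolding bounded_iff by blast
  qed
  ultimately show ?thesis unfolding abel_mean_def by blast
qed

lemma abel_mean_cmult: "abel_mean f L \<Longrightarrow> abel_mean (\<lambda>n. a * f n) (a * L)"
proof -
  assume f: "abel_mean f L"
  have "((\<lambda>r. a * (of_real (1 - r) * (\<Sum>n. f n * of_real r ^ n))) \<longlongrightarrow> a * L) (at_left (1::real))"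
    using f unfolding abel_mean_def by (intro tendsto_mult tendsto_const) auto
  moreover have "eventually (\<lambda>r. a * (of_real (1 - r) * (\<Sum>n. f n * of_real r ^ n))
      = of_real (1 - r) * (\<Sum>n. (a * f n) * of_real r ^ n)) (at_left (1::real))"
    using eventually_at_left_1
  proof eventually_elim
    case (elim r)
    show ?case
      using bounded_seq_power_summable(2)[OF abel_mean_bounded[OF f], of r] elim
      by (simp add: mult.assoc suminf_mult mult.left_commute)
  qed
  ultimately have "((\<lambda>r. of_real (1 - r) * (\<Sum>n. (a * f n) * of_real r ^ n)) \<longlongrightarrow> a * L) (at_left (1::real))"
    by (rule Lim_transform_eventually)
  moreover have "bounded (range (\<lambda>n. a * f n))"
  proof -
    obtain B where "\<And>n. norm (f n) \<le> B" using abel_mean_bounded[OF f] unfolding bounded_iff by auto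
    hence "norm (a * f n) \<le> norm a * B" for n by (simp add: norm_mult mult_left_mono)
    thus ?thesis unfolding bounded_iff by blast
  qed
  ultimately show ?thesis unfolding abel_mean_def by blast
qed

lemma abel_mean_diff: "abel_mean f L \<Longrightarrow> abel_mean g M \<Longrightarrow> abel_mean (\<lambda>n. f n - g n) (L - M)"
  using abel_mean_add[OF _ abel_mean_cmult[of g M "-1"], of f L] by simp

lemma abel_mean_0: "abel_mean (\<lambda>n. 0) 0"
  by (simp add: abel_mean_def image_constant_conv)

lemma abel_mean_sum:
  "(\<And>i. i \<in> I \<Longrightarrow> abel_mean (f i) (L i)) \<Longrightarrow> abel_mean (\<lambda>n. \<Sum>i\<in>I. f i n) (\<Sum>i\<in>I. L i)"
  by (induction I rule: infinite_finite_induct) (auto intro: abel_mean_add abel_mean_0)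

text \<open>By \<open>abel_sum_bound\<close> the weighted sums of f and g differ by at most e for
  every r. This handles factors that are uniform limits of periodic functions.\<close>

lemma abel_mean_uniform_limit_0:
  assumes f: "bounded (range f)"
    and approx: "\<And>e. e > 0 \<Longrightarrow> \<exists>g. abel_mean g 0 \<and> (\<forall>n. norm (f n - g n) \<le> e)"
  shows "abel_mean f 0"
  unfolding abel_mean_def
proof (intro conjI f tendstoI)
  fix e :: real assume e: "e > 0"
  then obtain g where g: "abel_mean g 0" "\<And>n. norm (f n - g n) \<le> e / 2" using approx[of "e / 2"] by auto
  have "eventually (\<lambda>r. dist (of_real (1 - r) * (\<Sum>n. g n * of_real r ^ n)) 0 < e / 2) (at_left (1::real))"
    using g(1) e unfolding abel_mean_def by (intro tendstoD) auto
  with eventually_at_left_1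
  show "eventually (\<lambda>r. dist (of_real (1 - r) * (\<Sum>n. f n * of_real r ^ n)) 0 < e) (at_left (1::real))"
  proof eventually_elim
    case (elim r)
    have r: "0 < r" "r < 1" using elim by auto
    have "(\<Sum>n. f n * of_real r ^ n) - (\<Sum>n. g n * of_real r ^ n) = (\<Sum>n. (f n - g n) * of_real r ^ n)"
      using bounded_seq_power_summable(2)[OF f r]
        bounded_seq_power_summable(2)[OF abel_mean_bounded[OF g(1)] r]
      by (simp add: suminf_diff left_diff_distrib)
    hence "of_real (1 - r) * (\<Sum>n. f n * of_real r ^ n) - of_real (1 - r) * (\<Sum>n. g n * of_real r ^ n)
        = of_real (1 - r) * (\<Sum>n. (f n - g n) * of_real r ^ n)"
      by (simp add: right_diff_distrib[symmetric])
    hence "norm (of_real (1 - r) * (\<Sum>n. f n * of_real r ^ n) - of_real (1 - r) * (\<Sum>n. g n * of_real r ^ n)) \<le> e / 2"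
      using abel_sum_bound[of "\<lambda>n. f n - g n" "e / 2" r] g(2) r by simp
    moreover have "norm (of_real (1 - r) * (\<Sum>n. g n * of_real r ^ n)) < e / 2" using elim by simp
    ultimately show ?case
      using norm_triangle_sub[of "of_real (1 - r) * (\<Sum>n. f n * of_real r ^ n)"
          "of_real (1 - r) * (\<Sum>n. g n * of_real r ^ n)"] by simp
  qed
qed

lemma abel_mean_finite_support:
  assumes "\<And>n. n \<ge> N \<Longrightarrow> f n = 0"
  shows "abel_mean f 0"
  unfolding abel_mean_def
proof (intro conjI)
  have "range f \<subseteq> insert 0 (f ` {..<N})" using assms by (auto simp: not_less[symmetric])
  hence "finite (range f)" by (rule finite_subset) auto
  thus "bounded (range f)" by (rule finite_imp_bounded)
  have "(\<Sum>n. f n * of_real r ^ n) = (\<Sum>n<N. f n * of_real r ^ n)" for r :: real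
    by (intro suminf_finite) (auto simp: assms)
  moreover have "((\<lambda>r. of_real (1 - r) * (\<Sum>n<N. f n * of_real r ^ n)) \<longlongrightarrow>
      of_real (1 - 1) * (\<Sum>n<N. f n * of_real 1 ^ n)) (at_left (1::real))"
    by (intro tendsto_intros)
  ultimately show "((\<lambda>r. of_real (1 - r) * (\<Sum>n. f n * of_real r ^ n)) \<longlongrightarrow> 0) (at_left (1::real))" by simp
qed

lemma abel_mean_null_seq:
  assumes "f \<longlonglongrightarrow> 0"
  shows "abel_mean f 0"
proof (rule abel_mean_uniform_limit_0)
  show "bounded (range f)" using assms by (intro convergent_imp_bounded)
  fix e :: real assume "e > 0"
  hence "eventually (\<lambda>n. dist (f n) 0 < e) sequentially" by (intro tendstoD[OF assms])
  then obtain N where N: "\<And>n. n \<ge> N \<Longrightarrow> norm (f n) < e" by (auto simp: eventually_sequentially)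
  have "abel_mean (\<lambda>n. if n < N then f n else 0) 0" by (rule abel_mean_finite_support[of N]) simp
  moreover have "norm (f n - (if n < N then f n else 0)) \<le> e" for n
    using N[of n] \<open>e > 0\<close> by (cases "n < N") auto
  ultimately show "\<exists>g. abel_mean g 0 \<and> (\<forall>n. norm (f n - g n) \<le> e)" by blast
qed

text \<open>The formulas for the coefficients hold from n = 1 on, and a single term contributes 0 to
  the mean.\<close>

lemma abel_mean_cong:
  assumes "abel_mean f L" "\<And>n. n \<ge> 1 \<Longrightarrow> f n = g n"
  shows "abel_mean g L"
proof -
  have "abel_mean (\<lambda>n. g n - f n) 0" by (rule abel_mean_finite_support[of 1]) (simp add: assms(2))
  from abel_mean_add[OF assms(1) this] show ?thesis by simp
qed

text \<open>Shifting by \<open>N\<close> does not change an Abel mean, so a quasi-periodic function has mean 0.\<close>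

lemma abel_mean_quasi_periodic:
  assumes f: "bounded (range f)" and per: "\<And>n. f (n + N) = l * f n" and l: "l \<noteq> 1"
  shows "abel_mean f 0"
proof -
  define S where "S r = (\<Sum>n. f n * of_real r ^ n)" for r :: real
  have eq: "of_real (1 - r) * S r * (1 - l * of_real r ^ N) = of_real (1 - r) * (\<Sum>n<N. f n * of_real r ^ n)"
    if r: "0 < r" "r < 1" for r
  proof -
    note s = bounded_seq_power_summable(2)[OF f r]
    have "S r = (\<Sum>n. f (n + N) * of_real r ^ (n + N)) + (\<Sum>n<N. f n * of_real r ^ n)"
      unfolding S_def by (rule suminf_split_initial_segment[OF s])
    also have "(\<Sum>n. f (n + N) * of_real r ^ (n + N)) = (\<Sum>n. (l * of_real r ^ N) * (f n * of_real r ^ n))"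
      by (simp add: per power_add algebra_simps)
    also have "\<dots> = (l * of_real r ^ N) * S r" unfolding S_def by (rule suminf_mult[OF s])
    finally have "S r * (1 - l * of_real r ^ N) = (\<Sum>n<N. f n * of_real r ^ n)"
      by (simp add: algebra_simps)
    thus ?thesis by (simp only: mult.assoc)
  qed
  have "((\<lambda>r. of_real (1 - r) * (\<Sum>n<N. f n * of_real r ^ n) / (1 - l * of_real r ^ N)) \<longlongrightarrow>
      of_real (1 - 1) * (\<Sum>n<N. f n * of_real 1 ^ n) / (1 - l * of_real 1 ^ N)) (at_left (1::real))"
    using l by (intro tendsto_intros) auto
  hence "((\<lambda>r. of_real (1 - r) * (\<Sum>n<N. f n * of_real r ^ n) / (1 - l * of_real r ^ N)) \<longlongrightarrow> 0) (at_left (1::real))"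
    by simp
  moreover have "eventually (\<lambda>r::real. 1 - l * of_real r ^ N \<noteq> 0) (at_left 1)"
  proof -
    have "((\<lambda>r. 1 - l * of_real r ^ N) \<longlongrightarrow> 1 - l * of_real 1 ^ N) (at_left (1::real))" by (intro tendsto_intros)
    thus ?thesis using l by (intro tendsto_imp_eventually_ne) auto
  qed
  hence "eventually (\<lambda>r. of_real (1 - r) * (\<Sum>n<N. f n * of_real r ^ n) / (1 - l * of_real r ^ N)
      = of_real (1 - r) * S r) (at_left (1::real))"
    using eventually_at_left_1
  proof eventually_elim
    case (elim r)
    thus ?case using eq[of r] by (simp add: nonzero_divide_eq_eq)
  qed
  ultimately have "((\<lambda>r. of_real (1 - r) * S r) \<longlongrightarrow> 0) (at_left (1::real))" by (rule Lim_transform_eventually)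
  thus ?thesis using f unfolding abel_mean_def S_def by simp
qed

lemma abel_mean_power:
  assumes "norm w = 1"
  shows "abel_mean (\<lambda>n. w ^ n) (if w = 1 then 1 else 0)"
proof (cases "w = 1")
  case True
  have "eventually (\<lambda>r. 1 = of_real (1 - r) * (\<Sum>n. 1 ^ n * of_real r ^ n :: complex)) (at_left (1::real))"
    using eventually_at_left_1
  proof eventually_elim
    case (elim r)
    hence "(\<Sum>n. of_real r ^ n :: complex) = 1 / (1 - of_real r)" by (intro suminf_geometric) auto
    moreover have "of_real r \<noteq> (1::complex)" using elim by auto
    ultimately show ?case by simp
  qed
  hence "((\<lambda>r. of_real (1 - r) * (\<Sum>n. 1 ^ n * of_real r ^ n :: complex)) \<longlongrightarrow> 1) (at_left (1::real))"
    by (rule Lim_transform_eventually[OF tendsto_const])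
  thus ?thesis using True by (simp add: abel_mean_def image_constant_conv)
next
  case False
  have "abel_mean (\<lambda>n. w ^ n) 0"
    by (rule abel_mean_quasi_periodic[of _ 1 w]) (use False assms in \<open>auto simp: bounded_iff norm_power\<close>)
  thus ?thesis using False by simp
qed

lemma abel_mean_exp_sum:
  assumes "finite A" "A \<subseteq> sphere 0 1" "\<And>n. n \<ge> 1 \<Longrightarrow> f n = (\<Sum>w\<in>A. a w * w ^ n)"
  shows "abel_mean f (if 1 \<in> A then a 1 else 0)"
proof -
  have "abel_mean (\<lambda>n. \<Sum>w\<in>A. a w * w ^ n) (\<Sum>w\<in>A. a w * (if w = 1 then 1 else 0))"
    using assms(2) by (intro abel_mean_sum abel_mean_cmult abel_mean_power) auto
  also have "(\<Sum>w\<in>A. a w * (if w = 1 then 1 else 0)) = (if 1 \<in> A then a 1 else 0)"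
    using assms(1) by (simp add: mult_delta_right)
  finally show ?thesis by (rule abel_mean_cong) (simp add: assms(3))
qed

text \<open>For a nonnegative \<open>f\<close>, the mean of \<open>f\<close> bounds the mean of \<open>f n * w ^ n\<close> for every \<open>w\<close> on the unit
  circle, that is, all Fourier coefficients of \<open>f\<close>.\<close>

lemma abel_mean_pos:
  assumes f: "exp_sum UNIV (sphere 0 1) (\<lambda>n. of_real (f n))"
    and nonneg: "\<And>n. n \<ge> 1 \<Longrightarrow> 0 \<le> f n" and n0: "n0 \<ge> 1" "f n0 \<noteq> 0"
  obtains L where "L > 0" "abel_mean (\<lambda>n. of_real (f n)) (of_real L)"
proof -
  obtain A :: "complex set" and a where A: "finite A" "A \<subseteq> sphere 0 1"
    "\<And>n. n \<ge> 1 \<Longrightarrow> of_real (f n) = (\<Sum>w\<in>A. a w * w ^ n)"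
    by (rule exp_sum_finite_support[OF f]) blast
  \<comment> \<open>The sign of f 0 is unknown; setting that term to 0 makes F nonnegative
    throughout.\<close>
  define F where "F n = (if n = 0 then 0 else of_real (f n) :: complex)" for n
  define L where "L = (if 1 \<in> A then a 1 else 0)"
  have mean: "abel_mean F L"
    unfolding L_def F_def by (rule abel_mean_exp_sum[OF A(1,2)]) (simp add: A(3))
  have Fre: "F n = of_real (norm (F n))" for n using nonneg[of n] by (auto simp: F_def)
  have val: "of_real (1 - r) * (\<Sum>n. F n * of_real r ^ n) = of_real ((1 - r) * (\<Sum>n. norm (F n * of_real r ^ n)))"
    if r: "0 < r" "r < 1" for r
  proof -
    have "of_real (norm (F n * of_real r ^ n)) = F n * of_real r ^ n" for n
    proof -
      have "norm (F n * of_real r ^ n) = norm (F n) * r ^ n" using r by (simp add: norm_mult norm_power)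
      thus ?thesis by (simp only: of_real_mult of_real_power Fre[symmetric])
    qed
    hence "(\<Sum>n. F n * of_real r ^ n) = (\<Sum>n. of_real (norm (F n * of_real r ^ n)))" by simp
    also have "\<dots> = of_real (\<Sum>n. norm (F n * of_real r ^ n))"
      using bounded_seq_power_summable(1)[OF abel_mean_bounded[OF mean] r] by (intro suminf_of_real[symmetric])
    finally show ?thesis by simp
  qed
  have lim: "((\<lambda>r. of_real (1 - r) * (\<Sum>n. F n * of_real r ^ n)) \<longlongrightarrow> L) (at_left (1::real))"
    using mean by (simp add: abel_mean_def)
  have le: "norm M \<le> norm L" if M: "abel_mean (\<lambda>n. F n * w ^ n) M" and w: "norm w = 1" for M w
  proof (rule tendsto_le[OF trivial_limit_at_left_real])
    show "((\<lambda>r. norm (of_real (1 - r) * (\<Sum>n. F n * of_real r ^ n))) \<longlongrightarrow> norm L) (at_left (1::real))"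
      by (intro tendsto_norm lim)
    show "((\<lambda>r. norm (of_real (1 - r) * (\<Sum>n. F n * w ^ n * of_real r ^ n))) \<longlongrightarrow> norm M) (at_left (1::real))"
      using M by (intro tendsto_norm) (simp add: abel_mean_def)
    show "\<forall>\<^sub>F r in at_left 1. norm (of_real (1 - r) * (\<Sum>n. F n * w ^ n * of_real r ^ n))
        \<le> norm (of_real (1 - r) * (\<Sum>n. F n * of_real r ^ n))"
      using eventually_at_left_1
    proof eventually_elim
      case (elim r)
      note s = bounded_seq_power_summable(1)[OF abel_mean_bounded[OF mean], of r]
      have eqn: "norm (F n * w ^ n * of_real r ^ n) = norm (F n * of_real r ^ n)" for n
        using w by (simp add: norm_mult norm_power)
      have "norm (\<Sum>n. F n * w ^ n * of_real r ^ n) \<le> (\<Sum>n. norm (F n * of_real r ^ n))"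
        using summable_norm[of "\<lambda>n. F n * w ^ n * of_real r ^ n"] s elim unfolding eqn by simp
      moreover have "0 \<le> (\<Sum>n. norm (F n * of_real r ^ n))" using s elim by (intro suminf_nonneg) auto
      ultimately show ?case using elim unfolding val[OF conjunct1[OF elim] conjunct2[OF elim]]
        by (simp add: norm_mult mult_left_mono)
    qed
  qed
  \<comment> \<open>The weighted sums are nonnegative reals, so their limit equals its own
    modulus.\<close>
  have Lreal: "L = of_real (norm L)"
  proof (rule tendsto_unique[OF trivial_limit_at_left_real lim])
    have "((\<lambda>r. of_real (norm (of_real (1 - r) * (\<Sum>n. F n * of_real r ^ n)))) \<longlongrightarrow> (of_real (norm L) :: complex)) (at_left (1::real))"
      by (intro tendsto_of_real tendsto_norm lim)
    moreover have "eventually (\<lambda>r. of_real (norm (of_real (1 - r) * (\<Sum>n. F n * of_real r ^ n))) =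
        of_real (1 - r) * (\<Sum>n. F n * of_real r ^ n)) (at_left (1::real))"
      using eventually_at_left_1
    proof eventually_elim
      case (elim r)
      have "0 \<le> (\<Sum>n. norm (F n * of_real r ^ n))"
        using bounded_seq_power_summable(1)[OF abel_mean_bounded[OF mean], of r] elim by (intro suminf_nonneg) auto
      hence "0 \<le> (1 - r) * (\<Sum>n. norm (F n * of_real r ^ n))" using elim by simp
      thus ?case unfolding val[OF conjunct1[OF elim] conjunct2[OF elim]] norm_of_real by (simp only: abs_of_nonneg)
    qed
    ultimately show "((\<lambda>r. of_real (1 - r) * (\<Sum>n. F n * of_real r ^ n)) \<longlongrightarrow> of_real (norm L)) (at_left (1::real))"
      by (rule Lim_transform_eventually)
  qed
  have "L \<noteq> 0"
  proof
    assume L0: "L = 0"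
    \<comment> \<open>Multiplication by u^(-n) moves the frequency u to 1. So the mean of F n u^(-n)
      is \<open>a u\<close>, and its modulus is at most that of L, which is 0.\<close>
    have "a u = 0" if u: "u \<in> A" for u
    proof -
      have nu: "norm u = 1" using A(2) u by auto
      hence u0: "u \<noteq> 0" by auto
      have "abel_mean (\<lambda>n. \<Sum>w\<in>A. a w * (w / u) ^ n) (\<Sum>w\<in>A. a w * (if w / u = 1 then 1 else 0))"
        using A(2) nu by (intro abel_mean_sum abel_mean_cmult abel_mean_power) (auto simp: norm_divide)
      also have "(\<Sum>w\<in>A. a w * (if w / u = 1 then 1 else 0)) = (\<Sum>w\<in>A. if w = u then a w else 0)"
        using u0 by (intro sum.cong) auto
      also have "\<dots> = a u" using A(1) u by simp
      finally have "abel_mean (\<lambda>n. F n * (1 / u) ^ n) (a u)"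
        by (rule abel_mean_cong) (simp add: F_def A(3) sum_distrib_right sum_divide_distrib power_divide)
      moreover have "norm (1 / u) = 1" using nu by (simp add: norm_divide)
      ultimately have "norm (a u) \<le> norm L" by (rule le)
      thus ?thesis using L0 by simp
    qed
    hence "of_real (f n0) = (0::complex)" using A(3)[OF n0(1)] by simp
    thus False using n0(2) by simp
  qed
  moreover have "abel_mean (\<lambda>n. of_real (f n)) (of_real (norm L))"
    using mean unfolding Lreal[symmetric] by (rule abel_mean_cong) (simp add: F_def)
  ultimately show ?thesis using that[of "norm L"] by simp
qed

text \<open>Dropping the terms off the progression only decreases the sum, since d is nonnegative.
  With r^N as the variable of the subsequence and 1 - r^N at most N (1 - r), a mean of d would have
  to be at least L / N.\<close>

lemma not_abel_mean_0_of_subsequence: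
  fixes d :: "nat \<Rightarrow> real"
  assumes d: "\<And>n. n \<ge> 1 \<Longrightarrow> 0 \<le> d n" and N: "N \<ge> 1" "n0 \<ge> 1"
    and L: "L > 0" "abel_mean (\<lambda>s. of_real (d (n0 + N * s))) (of_real L)"
  shows "\<not> abel_mean (\<lambda>n. of_real (d n)) 0"
proof
  assume mean0: "abel_mean (\<lambda>n. of_real (d n)) 0"
  define D where "D n = (if n = 0 then 0 else d n)" for n
  have D0: "0 \<le> D n" for n using d by (simp add: D_def)
  have meanD: "abel_mean (\<lambda>n. of_real (D n)) 0" using mean0 by (rule abel_mean_cong) (simp add: D_def)
  have Deq: "D (n0 + N * s) = d (n0 + N * s)" for s using N by (simp add: D_def)
  define G where "G s = D (n0 + N * s)" for s
  have meanG: "abel_mean (\<lambda>s. of_real (G s)) (of_real L)" using L(2) by (simp add: G_def Deq)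
  have real_sum: "(of_real (1 - r) * (\<Sum>n. of_real (h n) * of_real r ^ n) :: complex) = of_real ((1 - r) * (\<Sum>n. h n * r ^ n))"
    "summable (\<lambda>n. h n * r ^ n)"
    if "bounded (range (\<lambda>n. of_real (h n) :: complex))" "0 < r" "r < 1" for h :: "nat \<Rightarrow> real" and r :: real
  proof -
    note s = bounded_seq_power_summable(2)[OF that]
    show *: "summable (\<lambda>n. h n * r ^ n)"
      using s by (simp flip: of_real_power of_real_mult add: summable_of_real_iff)
    show "(of_real (1 - r) * (\<Sum>n. of_real (h n) * of_real r ^ n) :: complex) = of_real ((1 - r) * (\<Sum>n. h n * r ^ n))"
      using suminf_of_real[OF *, where 'a = complex] by simp
  qed
  have limD: "((\<lambda>r. (1 - r) * (\<Sum>n. D n * r ^ n)) \<longlongrightarrow> 0) (at_left (1::real))"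
  proof -
    have "((\<lambda>r. of_real ((1 - r) * (\<Sum>n. D n * r ^ n)) :: complex) \<longlongrightarrow> of_real 0) (at_left (1::real))"
      unfolding of_real_0
      by (rule Lim_transform_eventually[OF conjunct2[OF meanD[unfolded abel_mean_def]]])
         (use eventually_at_left_1 in eventually_elim, rule real_sum(1)[OF abel_mean_bounded[OF meanD]], auto)
    thus ?thesis unfolding tendsto_of_real_iff .
  qed
  have limG: "((\<lambda>r. (1 - r) * (\<Sum>n. G n * r ^ n)) \<longlongrightarrow> L) (at_left (1::real))"
  proof -
    have "((\<lambda>r. of_real ((1 - r) * (\<Sum>n. G n * r ^ n)) :: complex) \<longlongrightarrow> of_real L) (at_left (1::real))"
      by (rule Lim_transform_eventually[OF conjunct2[OF meanG[unfolded abel_mean_def]]])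
         (use eventually_at_left_1 in eventually_elim, rule real_sum(1)[OF abel_mean_bounded[OF meanG]], auto)
    thus ?thesis unfolding tendsto_of_real_iff .
  qed
  have pw: "filterlim (\<lambda>r::real. r ^ N) (at_left 1) (at_left 1)"
  proof (rule filterlim_at_withinI)
    have "((\<lambda>r::real. r ^ N) \<longlongrightarrow> 1 ^ N) (at_left 1)" by (intro tendsto_intros)
    thus "((\<lambda>r::real. r ^ N) \<longlongrightarrow> 1) (at_left 1)" by simp
    show "\<forall>\<^sub>F r in at_left (1::real). r ^ N \<in> {..<1} - {1}"
      using eventually_at_left_1 by eventually_elim (use N in \<open>auto simp: power_less_one_iff\<close>)
  qed
  have t1: "((\<lambda>r. r ^ n0 * ((1 - r ^ N) * (\<Sum>s. G s * (r ^ N) ^ s))) \<longlongrightarrow> 1 ^ n0 * L) (at_left (1::real))"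
    by (intro tendsto_mult tendsto_power tendsto_ident_at filterlim_compose[OF limG pw])
  have t2: "((\<lambda>r. real N * ((1 - r) * (\<Sum>n. D n * r ^ n))) \<longlongrightarrow> real N * 0) (at_left (1::real))"
    by (intro tendsto_mult tendsto_const limD)
  have ev: "\<forall>\<^sub>F r in at_left (1::real). r ^ n0 * ((1 - r ^ N) * (\<Sum>s. G s * (r ^ N) ^ s)) \<le> real N * ((1 - r) * (\<Sum>n. D n * r ^ n))"
    using eventually_at_left_1
  proof eventually_elim
    case (elim r)
    hence r: "0 < r" "r < 1" by auto
    have rN: "0 < r ^ N" "r ^ N < 1" using r N by (auto simp: power_less_one_iff)
    have sG: "summable (\<lambda>s. G s * (r ^ N) ^ s)" using real_sum(2)[OF abel_mean_bounded[OF meanG] rN] .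
    have sD: "summable (\<lambda>n. D n * r ^ n)" using real_sum(2)[OF abel_mean_bounded[OF meanD] r] .
    have "r ^ n0 * (\<Sum>s. G s * (r ^ N) ^ s) = (\<Sum>s. r ^ n0 * (G s * (r ^ N) ^ s))"
      using sG by (rule suminf_mult[symmetric])
    also have "\<dots> = (\<Sum>s. ((\<lambda>n. D n * r ^ n) \<circ> (\<lambda>s. n0 + N * s)) s)"
      by (simp add: G_def power_add power_mult[symmetric] mult_ac)
    also have "\<dots> \<le> (\<Sum>n. D n * r ^ n)"
      by (rule suminf_reindex_mono[OF sD]) (use N r D0 in \<open>auto simp: inj_on_def\<close>)
    finally have *: "r ^ n0 * (\<Sum>s. G s * (r ^ N) ^ s) \<le> (\<Sum>n. D n * r ^ n)" .
    have bern: "1 - r ^ N \<le> real N * (1 - r)"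
      using Bernoulli_inequality[of "r - 1" N] r by (simp add: algebra_simps)
    have "r ^ n0 * ((1 - r ^ N) * (\<Sum>s. G s * (r ^ N) ^ s)) = (1 - r ^ N) * (r ^ n0 * (\<Sum>s. G s * (r ^ N) ^ s))"
      by simp
    also have "\<dots> \<le> (1 - r ^ N) * (\<Sum>n. D n * r ^ n)" using * rN by (intro mult_left_mono) auto
    also have "\<dots> \<le> (real N * (1 - r)) * (\<Sum>n. D n * r ^ n)"
      using bern r D0 by (intro mult_right_mono suminf_nonneg sD) auto
    finally show ?case by (simp add: mult.assoc)
  qed
  have "1 ^ n0 * L \<le> real N * 0" by (rule tendsto_le[OF trivial_limit_at_left_real t2 t1 ev])
  thus False using L by simp
qed

section \<open>Natural boundaries\<close>

lemma ereal_less_of_less_of_le: "a < b \<Longrightarrow> ereal b \<le> R \<Longrightarrow> ereal a < R"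
  by (metis less_ereal.simps(1) less_le_trans)

text \<open>\<open>zeta_fps\<close> is a formal composition, so its analytic properties are gained
  indirectly: the exponential of the convergent logarithm is holomorphic on the disc, and its Taylor
  series H solves the same differential equation with the same constant term.\<close>

lemma zeta_fps_on_disc:
  assumes W: "W > 0" and c: "\<And>n. n \<ge> 1 \<Longrightarrow> norm (c n) \<le> B * W ^ n"
  shows "fps_conv_radius (zeta_fps c) \<ge> ereal (1 / W)"
    and "norm x < 1 / W \<Longrightarrow> (\<lambda>n. c (Suc n) * x ^ n) sums eval_fps (Abs_fps (\<lambda>n. c (Suc n))) x"
    and "norm x < 1 / W \<Longrightarrow> eval_fps (fps_deriv (zeta_fps c)) x
           = eval_fps (zeta_fps c) x * eval_fps (Abs_fps (\<lambda>n. c (Suc n))) x"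
proof -
  define L where "L = Abs_fps (\<lambda>n. if n = 0 then 0 else c n / of_nat n)"
  define D where "D = Abs_fps (\<lambda>n. c (Suc n))"
  have "0 \<le> B * W" using order_trans[OF norm_ge_zero c[of 1]] by simp
  hence B: "B \<ge> 0" using W by (simp add: zero_le_mult_iff)
  have bnd: "summable (\<lambda>n. norm (c (Suc n)) * r ^ n)" if r: "0 < r" "r < 1 / W" for r
  proof -
    have "summable (\<lambda>n. B * W * (W * r) ^ n)"
      using r W by (intro summable_mult summable_geometric) (auto simp: field_simps)
    thus ?thesis
    proof (rule summable_comparison_test'[of _ 0])
      fix n
      have "norm (c (Suc n)) * r ^ n \<le> (B * W ^ Suc n) * r ^ n" using r by (intro mult_right_mono c) auto
      thus "norm (norm (c (Suc n)) * r ^ n) \<le> B * W * (W * r) ^ n"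
        using r by (simp add: power_mult_distrib mult_ac)
    qed
  qed
  have radD: "fps_conv_radius D \<ge> ereal (1 / W)"
    unfolding fps_conv_radius_def
  proof (rule conv_radius_geI_ex')
    fix r assume r: "0 < r" "ereal r < ereal (1 / W)"
    show "summable (\<lambda>n. fps_nth D n * of_real r ^ n)"
      by (rule summable_norm_cancel) (use bnd[of r] r in \<open>simp add: D_def norm_mult norm_power\<close>)
  qed
  have derivL: "fps_deriv L = D"
    unfolding L_def D_def by (rule fps_ext) (simp del: of_nat_Suc)
  have radL: "fps_conv_radius L \<ge> ereal (1 / W)"
    unfolding fps_conv_radius_def
  proof (rule conv_radius_geI_ex')
    fix r assume r: "0 < r" "ereal r < ereal (1 / W)"
    have "summable (\<lambda>n. r * (norm (c (Suc n)) * r ^ n))" using bnd[of r] r by (intro summable_mult) simp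
    hence "summable (\<lambda>n. norm (fps_nth L (Suc n) * of_real r ^ Suc n))"
    proof (rule summable_comparison_test'[of _ 0])
      fix n
      have "norm (c (Suc n)) / real (Suc n) \<le> norm (c (Suc n)) / 1" by (intro divide_left_mono) auto
      hence "norm (c (Suc n)) / real (Suc n) * r ^ Suc n \<le> norm (c (Suc n)) * r ^ Suc n"
        using r by (intro mult_right_mono) auto
      thus "norm (norm (fps_nth L (Suc n) * of_real r ^ Suc n)) \<le> r * (norm (c (Suc n)) * r ^ n)"
        using r by (simp add: L_def norm_mult norm_power norm_divide mult_ac del: of_nat_Suc)
    qed
    hence "summable (\<lambda>n. norm (fps_nth L n * of_real r ^ n))" by (subst (asm) summable_Suc_iff)
    thus "summable (\<lambda>n. fps_nth L n * of_real r ^ n)" by (rule summable_norm_cancel)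
  qed
  let ?ball = "eball 0 (ereal (1 / W)) :: complex set"
  define F where "F x = exp (eval_fps L x)" for x
  have dF: "(F has_field_derivative F x * eval_fps D x) (at x)" if "norm x < 1 / W" for x
  proof -
    have "ereal (norm x) < fps_conv_radius L" using that radL by (rule ereal_less_of_less_of_le)
    hence "(eval_fps L has_field_derivative eval_fps D x) (at x)"
      using has_field_derivative_eval_fps[of x L] derivL by simp
    thus ?thesis unfolding F_def by (rule DERIV_fun_exp)
  qed
  have hol: "F holomorphic_on ?ball"
    by (rule holomorphic_onI) (use dF in \<open>auto simp: in_eball_iff field_differentiable_def intro: has_field_derivative_at_within\<close>)
  define H where "H = fps_expansion F 0"
  have radH: "fps_conv_radius H \<ge> ereal (1 / W)" unfolding H_def by (rule conv_radius_fps_expansion[OF hol])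
  have evH: "eval_fps H x = F x" if "norm x < 1 / W" for x
    using eval_fps_expansion'[OF hol, of x] that by (simp add: H_def)
  have lt: "ereal (norm x) < fps_conv_radius H" "ereal (norm x) < fps_conv_radius D" if "norm x < 1 / W" for x :: complex
    using ereal_less_of_less_of_le[OF that radH] ereal_less_of_less_of_le[OF that radD] by auto
  have dH: "eval_fps (fps_deriv H) x = eval_fps (H * D) x" if x: "norm x < 1 / W" for x
  proof -
    have "(eval_fps H has_field_derivative eval_fps (fps_deriv H) x) (at x)"
      by (rule has_field_derivative_eval_fps[OF lt(1)[OF x]])
    moreover have "(eval_fps H has_field_derivative F x * eval_fps D x) (at x)"
    proof (rule has_field_derivative_transform_within)
      show "(F has_field_derivative F x * eval_fps D x) (at x)" by (rule dF[OF x])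
      show "0 < 1 / W - norm x" using x by simp
      fix y assume "dist y x < 1 / W - norm x"
      hence "norm y < 1 / W" using norm_triangle_ineq2[of y x] by (simp add: dist_norm)
      thus "F y = eval_fps H y" by (simp add: evH)
    qed simp
    ultimately have "eval_fps (fps_deriv H) x = F x * eval_fps D x" by (rule DERIV_unique)
    thus ?thesis using eval_fps_mult[OF lt[OF x]] evH[OF x] by simp
  qed
  have W0: "0 < ereal (1 / W)" using W by simp
  have "fps_deriv H = H * D"
  proof (rule eval_fps_eqD)
    show "fps_conv_radius (fps_deriv H) > 0" using fps_conv_radius_deriv[of H] radH W0 by (meson less_le_trans)
    have "ereal (1 / W) \<le> fps_conv_radius (H * D)"
      using fps_conv_radius_mult[of H D] radH radD by (meson min.bounded_iff order_trans)
    thus "fps_conv_radius (H * D) > 0" using W0 by (meson less_le_trans)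
    have "eventually (\<lambda>z::complex. z \<in> ball 0 (1 / W)) (nhds 0)" using W by (intro eventually_nhds_in_open) auto
    thus "eventually (\<lambda>z. eval_fps (fps_deriv H) z = eval_fps (H * D) z) (nhds 0)"
      by eventually_elim (use dH in auto)
  qed
  moreover have "H $ 0 = 1" using evH[of 0] W by (simp add: F_def eval_fps_at_0 L_def)
  ultimately have Z: "zeta_fps c = H"
    by (intro fps_linear_ode_unique[OF zeta_fps_deriv[of c, folded D_def]]) simp_all
  show "fps_conv_radius (zeta_fps c) \<ge> ereal (1 / W)" unfolding Z by (rule radH)
  show "(\<lambda>n. c (Suc n) * x ^ n) sums eval_fps (Abs_fps (\<lambda>n. c (Suc n))) x" if "norm x < 1 / W"
    using sums_eval_fps[OF lt(2)[OF that]] by (simp add: D_def)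
  show "eval_fps (fps_deriv (zeta_fps c)) x = eval_fps (zeta_fps c) x * eval_fps (Abs_fps (\<lambda>n. c (Suc n))) x"
    if "norm x < 1 / W"
    unfolding Z D_def[symmetric] dH[OF that] by (rule eval_fps_mult[OF lt[OF that]])
qed

text \<open>At a boundary point where an analytic extension \<open>g\<close> of the zeta function does not vanish, the
  logarithmic derivative of \<open>g\<close> is bounded, which makes the Abel mean vanish.\<close>

lemma analytic_extension_zero:
  fixes b :: "nat \<Rightarrow> complex"
  assumes W: "W > 0" and b: "bounded (range b)" and c: "\<And>n. n \<ge> 1 \<Longrightarrow> c n = of_real W ^ n * b n"
    and U: "open U" "ball 0 (1 / W) \<subseteq> U" and g: "g holomorphic_on U"
    and gZ: "\<And>x. norm x < 1 / W \<Longrightarrow> g x = eval_fps (zeta_fps c) x"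
    and \<zeta>: "norm \<zeta> = 1" "\<zeta> / of_real W \<in> U" and mean: "\<not> abel_mean (\<lambda>n. b n * \<zeta> ^ n) 0"
  shows "g (\<zeta> / of_real W) = 0"
proof (rule ccontr)
  let ?x1 = "\<zeta> / of_real W"
  assume nz: "g ?x1 \<noteq> 0"
  obtain B where B: "\<And>n. norm (b n) \<le> B" using b unfolding bounded_iff by auto
  have cB: "norm (c n) \<le> B * W ^ n" if "n \<ge> 1" for n
    using B[of n] W that by (simp add: c norm_mult norm_power mult.commute mult_right_mono)
  note disc = zeta_fps_on_disc[OF W cB, simplified]
  define f where "f n = b n * \<zeta> ^ n" for n
  have bf: "bounded (range f)"
    unfolding bounded_iff using B \<zeta>(1) by (auto simp: f_def norm_mult norm_power intro!: exI[of _ B])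
  \<comment> \<open>Inside the disc x Z'(x) / Z(x) is the sum of c n x^n over n >= 1. Adding b 0
    supplies the term n = 0, which Z does not see.\<close>
  define h where "h x = x * deriv g x / g x + b 0" for x
  define x where "x r = of_real r * ?x1" for r :: real
  have limx: "(x \<longlongrightarrow> ?x1) (at_left 1)"
  proof -
    have "((\<lambda>r. of_real r * ?x1) \<longlongrightarrow> of_real 1 * ?x1) (at_left (1::real))" by (intro tendsto_intros)
    thus ?thesis by (simp add: x_def[abs_def])
  qed
  have g': "deriv g holomorphic_on U" by (rule holomorphic_deriv[OF g U(1)])
  have cg: "isCont g ?x1" "isCont (deriv g) ?x1"
    using holomorphic_on_imp_continuous_on[OF g] holomorphic_on_imp_continuous_on[OF g'] U(1) \<zeta>(2)
    by (auto simp: continuous_on_eq_continuous_at)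
  have "isCont h ?x1" unfolding h_def using cg nz by (intro continuous_intros)
  hence limh: "((\<lambda>r. h (x r)) \<longlongrightarrow> h ?x1) (at_left 1)"
    using limx isCont_tendsto_compose by blast
  have "((\<lambda>r. of_real (1 - r) * h (x r)) \<longlongrightarrow> of_real (1 - 1) * h ?x1) (at_left 1)"
    by (intro tendsto_mult limh tendsto_of_real tendsto_diff tendsto_const tendsto_ident_at)
  hence "((\<lambda>r. of_real (1 - r) * h (x r)) \<longlongrightarrow> 0) (at_left 1)" by simp
  moreover have "eventually (\<lambda>r. of_real (1 - r) * h (x r) = of_real (1 - r) * (\<Sum>n. f n * of_real r ^ n)) (at_left 1)"
  proof -
    have "((\<lambda>r. g (x r)) \<longlongrightarrow> g ?x1) (at_left 1)" using limx cg(1) isCont_tendsto_compose by blast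
    hence "eventually (\<lambda>r. g (x r) \<noteq> 0) (at_left 1)" using nz by (rule tendsto_imp_eventually_ne)
    thus ?thesis using eventually_at_left_1
    proof eventually_elim
      case (elim r)
      have r: "0 < r" "r < 1" using elim by auto
      have xr: "norm (x r) < 1 / W"
        using r W \<zeta>(1) by (simp add: x_def norm_mult norm_divide divide_strict_right_mono)
      have dg: "deriv g (x r) = eval_fps (fps_deriv (zeta_fps c)) (x r)"
      proof -
        have "ereal (norm (x r)) < fps_conv_radius (zeta_fps c)"
          by (rule ereal_less_of_less_of_le[OF xr disc(1)])
        hence "(eval_fps (zeta_fps c) has_field_derivative eval_fps (fps_deriv (zeta_fps c)) (x r)) (at (x r))"
          by (rule has_field_derivative_eval_fps)
        hence "(g has_field_derivative eval_fps (fps_deriv (zeta_fps c)) (x r)) (at (x r))"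
        proof (rule has_field_derivative_transform_within)
          show "0 < 1 / W - norm (x r)" using xr by simp
          fix y assume "dist y (x r) < 1 / W - norm (x r)"
          hence "norm y < 1 / W" using norm_triangle_ineq2[of y "x r"] by (simp add: dist_norm)
          thus "eval_fps (zeta_fps c) y = g y" by (simp add: gZ)
        qed simp
        thus ?thesis by (rule DERIV_imp_deriv)
      qed
      have "x r * deriv g (x r) / g (x r) = x r * eval_fps (Abs_fps (\<lambda>n. c (Suc n))) (x r)"
        using elim disc(3)[OF xr] gZ[OF xr] by (simp add: dg)
      also have "\<dots> = x r * (\<Sum>n. c (Suc n) * x r ^ n)" using disc(2)[OF xr] by (simp add: sums_iff)
      also have "\<dots> = (\<Sum>n. x r * (c (Suc n) * x r ^ n))"
        using disc(2)[OF xr] by (intro suminf_mult[symmetric]) (simp add: sums_iff)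
      also have "\<dots> = (\<Sum>n. f (Suc n) * of_real r ^ Suc n)"
      proof (rule suminf_cong)
        fix n
        have "x r * (c (Suc n) * x r ^ n) = c (Suc n) * x r ^ Suc n" by simp
        also have "\<dots> = (of_real W ^ Suc n * b (Suc n)) * (of_real r ^ Suc n * (\<zeta> ^ Suc n / of_real W ^ Suc n))"
          using c[of "Suc n"] by (simp only: x_def power_mult_distrib power_divide)
        also have "\<dots> = f (Suc n) * of_real r ^ Suc n" using W by (simp add: f_def del: power_Suc)
        finally show "x r * (c (Suc n) * x r ^ n) = f (Suc n) * of_real r ^ Suc n" .
      qed
      also have "\<dots> = (\<Sum>n. f n * of_real r ^ n) - f 0"
        using suminf_split_head[OF bounded_seq_power_summable(2)[OF bf r]] by simp
      finally show ?case by (simp add: h_def f_def)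
    qed
  qed
  ultimately have "((\<lambda>r. of_real (1 - r) * (\<Sum>n. f n * of_real r ^ n)) \<longlongrightarrow> 0) (at_left 1)"
    by (rule Lim_transform_eventually)
  hence "abel_mean f 0" using bf by (simp add: abel_mean_def)
  thus False using mean by (simp add: f_def[abs_def])
qed

text \<open>At a point of the circle inside the domain of an extension the zeros from
  \<open>analytic_extension_zero\<close> accumulate; the identity theorem then makes g vanish, while
  g 0 = 1. A limit point needs zeros other than the point itself, hence \<zeta> \<noteq> x in
  \<open>dense\<close>.\<close>

theorem natural_boundary_criterion:
  fixes b :: "nat \<Rightarrow> complex"
  assumes W: "W > 0" and b: "bounded (range b)" and c: "\<And>n. n \<ge> 1 \<Longrightarrow> c n = of_real W ^ n * b n"
    and dense: "\<And>x e. norm x = 1 \<Longrightarrow> e > 0 \<Longrightarrow>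
      \<exists>\<zeta>. norm \<zeta> = 1 \<and> \<zeta> \<noteq> x \<and> dist \<zeta> x < e \<and> \<not> abel_mean (\<lambda>n. b n * \<zeta> ^ n) 0"
  shows "has_natural_boundary (zeta_fps c)"
proof -
  have no_ext: False
    if U: "open U" "connected U" "ball 0 (1 / W) \<subseteq> U" and g: "g holomorphic_on U"
      and gZ: "\<And>x. norm x < 1 / W \<Longrightarrow> g x = eval_fps (zeta_fps c) x"
      and x0: "x0 \<in> U" "norm x0 = 1 / W" for U g x0
  proof -
    have lim: "x0 islimpt {z \<in> U. g z = 0}"
      unfolding islimpt_approachable
    proof (intro allI impI)
      fix e :: real assume "e > 0"
      obtain d where d: "d > 0" "ball x0 d \<subseteq> U" using U(1) x0(1) openE by blast
      obtain \<zeta> where z: "norm \<zeta> = 1" "\<zeta> \<noteq> of_real W * x0" "dist \<zeta> (of_real W * x0) < min d e * W"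
        "\<not> abel_mean (\<lambda>n. b n * \<zeta> ^ n) 0"
        using dense[of "of_real W * x0" "min d e * W"] W x0(2) d(1) \<open>e > 0\<close> by (auto simp: norm_mult)
      have "\<zeta> / of_real W - x0 = (\<zeta> - of_real W * x0) / of_real W" using W by (simp add: field_simps)
      hence "dist (\<zeta> / of_real W) x0 = dist \<zeta> (of_real W * x0) / W"
        using W by (simp add: dist_norm norm_divide)
      hence near: "dist (\<zeta> / of_real W) x0 < min d e" using z(3) pos_divide_less_eq[OF W] by metis
      hence "\<zeta> / of_real W \<in> U" using d(2) by (auto simp: dist_commute)
      moreover from this have "g (\<zeta> / of_real W) = 0"
        by (intro analytic_extension_zero[OF W b c U(1,3) g gZ z(1) _ z(4)])
      moreover have "\<zeta> / of_real W \<noteq> x0" using z(2) W by (auto simp: field_simps)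
      ultimately show "\<exists>x'\<in>{z \<in> U. g z = 0}. x' \<noteq> x0 \<and> dist x' x0 < e" using near by auto
    qed
    have "0 \<in> ball (0::complex) (1 / W)" using W by simp
    hence "0 \<in> U" using U(3) by (rule subsetD[rotated])
    have "g 0 = 0"
      by (rule analytic_continuation[OF g U(1,2) _ x0(1) lim _ \<open>0 \<in> U\<close>]) simp_all
    moreover have "g 0 = 1" using gZ[of 0] W by (simp add: eval_fps_at_0)
    ultimately show False by simp
  qed
  obtain B where B: "\<And>n. norm (b n) \<le> B" using b unfolding bounded_iff by auto
  have cB: "norm (c n) \<le> B * W ^ n" if "n \<ge> 1" for n
    using B[of n] W that by (simp add: c norm_mult norm_power mult.commute mult_right_mono)
  have ge: "fps_conv_radius (zeta_fps c) \<ge> ereal (1 / W)" using zeta_fps_on_disc(1)[OF W cB] by simp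
  have rad: "fps_conv_radius (zeta_fps c) = ereal (1 / W)"
  proof (rule ccontr)
    let ?U = "eball 0 (fps_conv_radius (zeta_fps c)) :: complex set"
    assume "fps_conv_radius (zeta_fps c) \<noteq> ereal (1 / W)"
    hence gt: "ereal (1 / W) < fps_conv_radius (zeta_fps c)" using ge by simp
    \<comment> \<open>If the radius of convergence were larger, the series itself would be an
      extension beyond |x| = 1/W.\<close>
    show False
    proof (rule no_ext[of ?U "eval_fps (zeta_fps c)" "of_real (1 / W)"])
      show "connected ?U" by (rule connected_eball)
      show "ball 0 (1 / W) \<subseteq> ?U" using ge by (rule ball_eball_mono)
      show "eval_fps (zeta_fps c) holomorphic_on ?U" by (rule holomorphic_on_eval_fps) simp
      show "of_real (1 / W) \<in> ?U" using gt W by (simp add: in_eball_iff norm_divide)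
      show "norm (complex_of_real (1 / W)) = 1 / W" using W by (simp add: norm_divide)
    qed auto
  qed
  show ?thesis
    unfolding has_natural_boundary_def
  proof (intro conjI notI)
    show "0 < fps_conv_radius (zeta_fps c)" "fps_conv_radius (zeta_fps c) < \<infinity>" using rad W by simp_all
    assume "\<exists>U g. open U \<and> connected U \<and> eball 0 (fps_conv_radius (zeta_fps c)) \<subset> U \<and>
      g analytic_on U \<and> (\<forall>x\<in>eball 0 (fps_conv_radius (zeta_fps c)). g x = eval_fps (zeta_fps c) x)"
    then obtain U g where Ug: "open U" "connected U" "eball 0 (fps_conv_radius (zeta_fps c)) \<subset> U"
      "g analytic_on U" "\<forall>x\<in>eball 0 (fps_conv_radius (zeta_fps c)). g x = eval_fps (zeta_fps c) x" by blast
    have ball: "ball 0 (1 / W) \<subset> U" using Ug(3) unfolding rad by (simp add: eball_ereal)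
    then obtain y where y: "y \<in> U" "y \<notin> ball 0 (1 / W)" by blast
    have "0 \<in> ball (0::complex) (1 / W)" using W by simp
    hence "0 \<in> U" using ball by blast
    \<comment> \<open>The moduli of the points of U form an interval that contains 0 and a value at
      least 1/W; hence U meets the circle.\<close>
    have "connected (norm ` U)" by (intro connected_continuous_image continuous_intros Ug(2))
    moreover have "0 \<in> norm ` U" using \<open>0 \<in> U\<close> by force
    moreover have "norm y \<in> norm ` U" using y by blast
    ultimately have "1 / W \<in> norm ` U"
      using y(2) W unfolding connected_iff_interval by (metis divide_nonneg_pos less_eq_real_def mem_ball_0 not_le zero_less_one)
    then obtain x0 where "x0 \<in> U" "norm x0 = 1 / W" by auto
    thus False
      using no_ext[of U g x0] Ug ball unfolding rad
      by (auto simp: eball_ereal analytic_on_open)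
  qed
qed

section \<open>Density of the roots of unity of prime power order\<close>

lemma norm_cis_diff_le: "norm (cis s - cis t) \<le> \<bar>s - t\<bar>"
proof -
  have "cis s - cis t = cis t * (cis (s - t) - 1)" by (simp add: right_diff_distrib cis_mult)
  hence "norm (cis s - cis t) = norm (exp (\<i> * of_real (s - t)) - 1)"
    by (simp add: norm_mult cis_conv_exp)
  also have "\<dots> = 2 * \<bar>sin ((s - t) / 2)\<bar>" by (rule dist_exp_i_1)
  also have "\<dots> \<le> 2 * \<bar>(s - t) / 2\<bar>" by (intro mult_left_mono abs_sin_x_le_abs_x) auto
  finally show ?thesis by simp
qed

text \<open>Fractions c / p^j with c prime to p are dense, because one of two consecutive integers
  is prime to p. The equivalence says that \<zeta> has exact order p^j.\<close>

lemma primitive_roots_dense: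
  fixes x :: complex
  assumes p: "Factorial_Ring.prime (p::nat)" and x: "norm x = 1" and e: "e > 0"
  shows "\<exists>j\<ge>J. \<exists>\<zeta>. (\<forall>l. \<zeta> ^ l = 1 \<longleftrightarrow> p ^ j dvd l) \<and> norm \<zeta> = 1 \<and> \<zeta> \<noteq> x \<and> dist \<zeta> x < e"
proof -
  have p2: "p \<ge> 2" using p by (rule prime_ge_2_nat)
  have "\<exists>t\<ge>0. x = cis t"
  proof -
    obtain t where "0 \<le> t" "x = Complex (cos t) (sin t)"
      using complex_unimodular_polar[OF x] by metis
    thus ?thesis by (auto simp: cis.ctr)
  qed
  then obtain t where t: "t \<ge> 0" "x = cis t" by blast
  \<comment> \<open>The numerator c is at most y + 2, so the angle is missed by at most two steps of
    2 pi / q, that is, by 4 pi / q.\<close>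
  obtain j0 where j0: "4 * pi / e < real p ^ j0" using real_arch_pow[of "real p"] p2 by auto
  \<comment> \<open>The summand 2 makes q at least 4; then 0 < s - t <= pi, so that
    \<open>cis s\<close> differs from x.\<close>
  define j where "j = j0 + J + 2"
  define q where "q = p ^ j"
  have q1: "real q \<ge> real p ^ j0" unfolding q_def j_def of_nat_power using p2 by (intro power_increasing) auto
  have q4: "q \<ge> 4"
  proof -
    have "(2::nat) ^ 2 \<le> p ^ 2" using p2 by (intro power_mono) auto
    also have "\<dots> \<le> q" unfolding q_def j_def using p2 by (intro power_increasing) auto
    finally show ?thesis by simp
  qed
  have "4 * pi / e < real q" using less_le_trans[OF j0 q1] .
  hence "4 * pi < e * real q" using e by (simp add: pos_divide_less_eq mult.commute)
  hence qe: "4 * pi / real q < e" using q4 by (simp add: pos_divide_less_eq)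
  define y where "y = t * real q / (2 * pi)"
  define a where "a = nat \<lfloor>y\<rfloor> + 1"
  have y0: "y \<ge> 0" using t(1) by (simp add: y_def)
  have a: "y < real a" "real a \<le> y + 1" using y0 unfolding a_def by linarith+
  have "\<exists>c\<in>{a, a + 1}. \<not> p dvd c"
  proof (rule ccontr)
    assume "\<not> (\<exists>c\<in>{a, a + 1}. \<not> p dvd c)"
    hence "p dvd a" "p dvd a + 1" by auto
    hence "p dvd 1" using dvd_add_right_iff[of p a 1] by simp
    thus False using p2 by simp
  qed
  then obtain c where c: "\<not> p dvd c" "y < real c" "real c \<le> y + 2" using a by force
  define s where "s = 2 * pi * real c / real q"
  have ty: "t = 2 * pi * y / real q" using q4 by (simp add: y_def)
  have s: "0 < s - t" "s - t \<le> 4 * pi / real q"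
  proof -
    have "s - t = 2 * pi * (real c - y) / real q" by (simp add: s_def ty right_diff_distrib diff_divide_distrib)
    thus "0 < s - t" "s - t \<le> 4 * pi / real q" using c q4 by (auto simp: divide_right_mono)
  qed
  have sexp: "cis s = exp (2 * of_real pi * \<i> * of_nat c / of_nat q)"
    by (simp add: s_def cis_conv_exp mult_ac)
  have root: "cis s ^ l = 1 \<longleftrightarrow> p ^ j dvd l" for l
  proof -
    have "cis s ^ l = exp (2 * of_real pi * \<i> * of_nat (c * l) / of_nat q)"
      unfolding sexp exp_of_nat_mult[symmetric] by (simp add: mult_ac)
    hence "cis s ^ l = 1 \<longleftrightarrow> q dvd c * l" using complex_root_unity_eq_1[of q "c * l"] q4 by simp
    also have "\<dots> \<longleftrightarrow> q dvd l"
    proof -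
      have "coprime p c" using p c(1) by (rule prime_imp_coprime)
      hence "coprime q c" by (simp add: q_def)
      thus ?thesis by (simp add: coprime_dvd_mult_right_iff)
    qed
    finally show ?thesis by (simp add: q_def)
  qed
  have "dist (cis s) x < e" using norm_cis_diff_le[of s t] s qe by (simp add: t dist_norm)
  moreover have "cis s \<noteq> x"
  proof
    assume "cis s = x"
    hence "cis (s - t) = 1" unfolding t by (simp flip: cis_divide)
    hence "cos (s - t) = 1" by (metis cis.sel(1) one_complex.sel(1))
    then obtain n :: int where n: "s - t = of_int n * 2 * pi" by (auto simp: cos_one_2pi_int)
    have "4 * pi / real q \<le> pi" using q4 by (simp add: field_simps)
    hence "0 < of_int n * 2 * pi" "of_int n * 2 * pi < 2 * pi" using s n pi_gt_zero by linarith+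
    hence "0 < real_of_int n" "real_of_int n < 1" by (simp_all add: zero_less_mult_iff)
    hence "0 < n" "n < 1" by simp_all
    thus False by linarith
  qed
  moreover have "j \<ge> J" by (simp add: j_def)
  ultimately show ?thesis using root by (intro exI[of _ j] conjI exI[of _ "cis s"]) auto
qed

section \<open>Products of valuation factors\<close>

lemma prime_power_dvd_lcm:
  fixes q a b :: nat
  assumes "Factorial_Ring.prime q" "a > 0" "b > 0" "q ^ j dvd lcm a b"
  shows "q ^ j dvd a \<or> q ^ j dvd b"
proof -
  have u: "\<not> is_unit q" using assms(1) by auto
  have "j \<le> multiplicity q (lcm a b)"
    using assms u by (intro multiplicity_geI) (auto simp: lcm_eq_0_iff)
  also have "multiplicity q (lcm a b) = max (multiplicity q a) (multiplicity q b)"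
    using assms by (intro multiplicity_lcm) auto
  finally show ?thesis by (auto simp: le_max_iff_disj intro: multiplicity_dvd')
qed

text \<open>The gcd makes the function periodic also across n = 0, where
  \<open>multiplicity q 0\<close> is 0 by convention but the truncated multiplicity has to be
  k.\<close>

definition trunc_mult :: "nat \<Rightarrow> nat \<Rightarrow> nat \<Rightarrow> nat" where
  "trunc_mult q k n = multiplicity q (gcd n (q ^ k))"

lemma trunc_mult_periodic:
  assumes "q ^ k dvd N"
  shows "trunc_mult q k (n + N) = trunc_mult q k n"
proof -
  obtain t where "N = t * q ^ k" using assms by (metis dvd_def mult.commute)
  hence "gcd (n + N) (q ^ k) = gcd n (q ^ k)"
    using gcd_add_mult[of "q ^ k" t n] by (simp add: gcd.commute add.commute)
  thus ?thesis by (simp add: trunc_mult_def)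
qed

lemma trunc_mult_eq:
  assumes "Factorial_Ring.prime q" "n \<ge> 1"
  shows "trunc_mult q k n = min (multiplicity q n) k"
proof -
  have u: "\<not> is_unit q" using assms(1) by auto
  have "multiplicity q (gcd n (q ^ k)) = min (multiplicity q n) (multiplicity q (q ^ k))"
    using assms by (intro multiplicity_gcd) (auto simp: prime_gt_0_nat)
  also have "multiplicity q (q ^ k) = k" using assms u by (intro multiplicity_same_power) auto
  finally show ?thesis by (simp add: trunc_mult_def)
qed

lemma multiplicity_times_coprime:
  fixes q a b :: nat
  assumes "Factorial_Ring.prime q" "a > 0" "\<not> q dvd b"
  shows "multiplicity q (a * b) = multiplicity q a"
proof -
  have "b \<noteq> 0" using assms(3) by (intro notI) simp
  hence "multiplicity q (a * b) = multiplicity q a + multiplicity q b"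
    using assms by (intro prime_elem_multiplicity_mult_distrib) auto
  thus ?thesis using assms(3) by (simp add: not_dvd_imp_multiplicity_0)
qed

text \<open>Q is a product of one exponent for each frequency; a frequency that is no root of unity
  contributes an arbitrary positive factor. In this way resonance becomes a question of
  divisibility.\<close>

lemma finite_set_common_root_order:
  fixes A :: "complex set"
  assumes "finite A"
  obtains Q where "Q \<ge> 1" "\<And>w k. w \<in> A \<Longrightarrow> k \<ge> 1 \<Longrightarrow> w ^ k = 1 \<Longrightarrow> w ^ Q = 1"
proof -
  have "\<forall>w. \<exists>k\<ge>1. (\<exists>l\<ge>1. w ^ l = 1) \<longrightarrow> w ^ k = (1::complex)" by auto
  then obtain ord where ord: "\<And>w. ord w \<ge> 1" "\<And>w. \<exists>l\<ge>1. w ^ l = 1 \<Longrightarrow> w ^ ord w = (1::complex)" by metis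
  show ?thesis
  proof (rule that[of "\<Prod>w\<in>A. ord w"])
    show "1 \<le> (\<Prod>w\<in>A. ord w)" by (rule prod_ge_1) (use ord(1) in auto)
    fix w k assume w: "w \<in> A" "k \<ge> 1" "w ^ k = 1"
    have "ord w dvd (\<Prod>w\<in>A. ord w)" using assms w(1) by (intro dvd_prodI) auto
    then obtain t where "(\<Prod>w\<in>A. ord w) = ord w * t" by auto
    moreover have "w ^ ord w = 1" using ord(2) w by blast
    ultimately show "w ^ (\<Prod>w\<in>A. ord w) = 1" by (simp add: power_mult)
  qed
qed

text \<open>Each term g n (w \<zeta>)^n is quasi-periodic with multiplier (w \<zeta>)^N. If that
  were 1, w would be a root of unity, so w^Q = 1 and \<zeta>^lcm(N, Q) = 1. But the prime power q^j
  divides neither N nor Q, hence not their lcm.\<close>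

lemma abel_mean_nonresonant:
  assumes A: "finite A" "A \<subseteq> sphere 0 1" and f: "\<And>n. n \<ge> 1 \<Longrightarrow> f n = (\<Sum>w\<in>A. a w * w ^ n)"
    and Q: "Q \<ge> 1" "\<And>w k. w \<in> A \<Longrightarrow> k \<ge> 1 \<Longrightarrow> w ^ k = 1 \<Longrightarrow> w ^ Q = 1"
    and q: "Factorial_Ring.prime q" and zeta: "norm \<zeta> = 1" "\<And>l. \<zeta> ^ l = 1 \<longleftrightarrow> q ^ j dvd l"
    and N: "N \<ge> 1" "\<not> q ^ j dvd N" "\<not> q ^ j dvd Q" and g: "\<And>n. g (n + N) = g n"
  shows "abel_mean (\<lambda>n. g n * f n * \<zeta> ^ n) 0"
proof -
  have gmod: "g (r + N * t) = g r" for r t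
    by (induction t) (use g in \<open>simp_all add: add.assoc[symmetric]\<close>, metis add.assoc add.commute g)
  have "g n \<in> g ` {..<N}" for n
  proof -
    have "g n = g (n mod N)" using gmod[of "n mod N" "n div N"] by simp
    thus ?thesis using N(1) by simp
  qed
  hence "range g \<subseteq> g ` {..<N}" by auto
  hence "finite (range g)" by (rule finite_subset) simp
  hence "bounded (range g)" by (rule finite_imp_bounded)
  then obtain B where B: "\<And>n. norm (g n) \<le> B" unfolding bounded_iff by auto
  have "abel_mean (\<lambda>n. g n * (w * \<zeta>) ^ n) 0" if w: "w \<in> A" for w
  proof (rule abel_mean_quasi_periodic[where N = N and l = "(w * \<zeta>) ^ N"])
    have nw: "norm w = 1" using A(2) w by auto
    show "bounded (range (\<lambda>n. g n * (w * \<zeta>) ^ n))"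
      unfolding bounded_iff using B nw zeta(1) by (auto simp: norm_mult norm_power intro!: exI[of _ B])
    show "g (n + N) * (w * \<zeta>) ^ (n + N) = (w * \<zeta>) ^ N * (g n * (w * \<zeta>) ^ n)" for n
      by (simp add: g power_add)
    show "(w * \<zeta>) ^ N \<noteq> 1"
    proof
      assume 1: "(w * \<zeta>) ^ N = 1"
      have zq: "\<zeta> ^ (q ^ j) = 1" using zeta(2) by simp
      have "w ^ (N * q ^ j) = (w * \<zeta>) ^ (N * q ^ j)"
        using zq by (simp add: power_mult_distrib power_mult mult.commute[of N])
      also have "\<dots> = 1" using 1 by (simp add: power_mult)
      finally have "w ^ Q = 1" using N(1) q by (intro Q(2)[OF w, of "N * q ^ j"]) (auto simp: Suc_le_eq prime_gt_0_nat)
      hence wl: "w ^ lcm N Q = 1" by (metis dvd_def dvd_lcm2 power_mult power_one)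
      have "(w * \<zeta>) ^ lcm N Q = 1" using 1 by (metis dvd_def dvd_lcm1 power_mult power_one)
      hence "\<zeta> ^ lcm N Q = 1" using wl by (simp add: power_mult_distrib)
      hence "q ^ j dvd lcm N Q" by (simp add: zeta(2))
      thus False using prime_power_dvd_lcm[OF q, of N Q j] N Q(1) by auto
    qed
  qed
  hence "abel_mean (\<lambda>n. \<Sum>w\<in>A. a w * (g n * (w * \<zeta>) ^ n)) (\<Sum>w\<in>A. a w * 0)"
    by (intro abel_mean_sum abel_mean_cmult)
  hence "abel_mean (\<lambda>n. \<Sum>w\<in>A. a w * (g n * (w * \<zeta>) ^ n)) 0" by simp
  thus ?thesis
    by (rule abel_mean_cong) (simp add: f sum_distrib_left sum_distrib_right power_mult_distrib mult_ac)
qed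

definition val_factor :: "nat \<Rightarrow> nat \<Rightarrow> (nat \<Rightarrow> real) \<Rightarrow> nat \<Rightarrow> real" where
  "val_factor q m \<phi> n = (if m dvd n then \<phi> (multiplicity q n) else 1)"

text \<open>Replacing the factors at the prime \<open>p i0\<close> by their truncations below level \<open>j\<close> changes the
  product only at multiples of \<open>p i0 ^ j\<close>, where \<open>\<zeta> ^ n = 1\<close> and the change has constant sign; the
  truncated product has mean 0 against \<open>\<zeta> ^ n\<close>.\<close>

theorem abel_mean_val_factors_nonzero:
  fixes p m :: "'i \<Rightarrow> nat" and \<phi> :: "'i \<Rightarrow> nat \<Rightarrow> real" and T :: "nat \<Rightarrow> real"
  assumes I: "finite I" "i0 \<in> I" and p: "\<And>i. i \<in> I \<Longrightarrow> Factorial_Ring.prime (p i)"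
    and m: "\<And>i. i \<in> I \<Longrightarrow> m i \<ge> 1"
    and phi: "\<And>i a. i \<in> I \<Longrightarrow> 0 < \<phi> i a" "\<And>i a. i \<in> I \<Longrightarrow> \<phi> i a < 1"
      "\<And>i a. i \<in> I \<Longrightarrow> \<phi> i (Suc a) < \<phi> i a" "\<And>i. i \<in> I \<Longrightarrow> \<phi> i \<longlonglongrightarrow> 0"
    and T: "exp_sum UNIV (sphere 0 1) (\<lambda>n. of_real (T n))" "\<And>n. n \<ge> 1 \<Longrightarrow> 0 < T n"
  shows "\<exists>J. \<forall>j\<ge>J. \<forall>\<zeta>. norm \<zeta> = 1 \<and> (\<forall>l. \<zeta> ^ l = 1 \<longleftrightarrow> p i0 ^ j dvd l) \<longrightarrow>
     \<not> abel_mean (\<lambda>n. of_real ((\<Prod>i\<in>I. val_factor (p i) (m i) (\<phi> i) n) * T n) * \<zeta> ^ n) 0"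
proof -
  obtain A :: "complex set" and a where A: "finite A" "A \<subseteq> sphere 0 1"
    "\<And>n. n \<ge> 1 \<Longrightarrow> of_real (T n) = (\<Sum>w\<in>A. a w * w ^ n)"
    by (rule exp_sum_finite_support[OF T(1)]) blast
  obtain Q where Q: "Q \<ge> 1" "\<And>w k. w \<in> A \<Longrightarrow> k \<ge> 1 \<Longrightarrow> w ^ k = 1 \<Longrightarrow> w ^ Q = 1"
    by (rule finite_set_common_root_order[OF A(1)]) blast
  have "bounded (range (\<lambda>n. of_real (T n) :: complex))"
    using abel_mean_exp_sum[OF A] by (rule abel_mean_bounded)
  then obtain B where B: "\<And>n. \<bar>T n\<bar> \<le> B" unfolding bounded_iff by auto
  define P where "P = p i0"
  have P: "Factorial_Ring.prime P" using p I(2) by (simp add: P_def)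
  have P1: "P > 1" using P by (rule prime_gt_1_nat)
  define M where "M = (\<Prod>i\<in>I. m i)"
  have M1: "M \<ge> 1" unfolding M_def by (rule prod_ge_1) (use m in auto)
  have mM: "m i dvd M" if "i \<in> I" for i unfolding M_def using I(1) that by (intro dvd_prodI) auto
  have phi_mono: "\<phi> i b \<le> \<phi> i a" if "i \<in> I" "a \<le> b" for i a b
    using that(2) by (induction b rule: dec_induct) (use phi(3)[OF that(1)] in \<open>auto intro: order_trans less_imp_le\<close>)
  have phi_strict: "\<phi> i b < \<phi> i a" if "i \<in> I" "a < b" for i a b
    using phi_mono[OF that(1), of "Suc a" b] phi(3)[OF that(1), of a] that(2) by simp
  define J where "J = Suc (multiplicity P (M * Q))"
  have nodvd: "\<not> P ^ j dvd M" "\<not> P ^ j dvd Q" if "j \<ge> J" for j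
  proof -
    have "\<not> P ^ j dvd M * Q"
    proof
      assume "P ^ j dvd M * Q"
      hence "j \<le> multiplicity P (M * Q)" using M1 Q(1) P by (intro multiplicity_geI) auto
      thus False using that by (simp add: J_def)
    qed
    thus "\<not> P ^ j dvd M" "\<not> P ^ j dvd Q" by (auto intro: dvd_mult dvd_mult2)
  qed
  show ?thesis
  proof (intro exI[of _ J] allI impI notI, elim conjE)
    fix j and \<zeta> :: complex assume j: "j \<ge> J" and zn: "norm \<zeta> = 1" and z: "\<forall>l. \<zeta> ^ l = 1 \<longleftrightarrow> p i0 ^ j dvd l"
    let ?H = "\<lambda>n. \<Prod>i\<in>I. val_factor (p i) (m i) (\<phi> i) n"
    assume mean0: "abel_mean (\<lambda>n. of_real (?H n * T n) * \<zeta> ^ n) 0"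
    have z: "\<And>l. \<zeta> ^ l = 1 \<longleftrightarrow> P ^ j dvd l" using z by (simp add: P_def)
    have j1: "j \<ge> 1" using j by (simp add: J_def)
    \<comment> \<open>Only the prime P is truncated here, at level j - 1; multiplicities at the
      other primes stay as they are.\<close>
    define h where "h i n = (if m i dvd n then \<phi> i (if p i = P then min (multiplicity P n) (j - 1)
        else multiplicity (p i) n) else 1)" for i n
    have vf01: "0 < val_factor (p i) (m i) (\<phi> i) n" "val_factor (p i) (m i) (\<phi> i) n \<le> 1" if "i \<in> I" for i n
      using phi[OF that] by (auto simp: val_factor_def less_imp_le)
    have h01: "0 < h i n" "0 \<le> h i n" "h i n \<le> 1" if "i \<in> I" for i n
      using phi[OF that] by (auto simp: h_def less_imp_le)
    have vf_le: "val_factor (p i) (m i) (\<phi> i) n \<le> h i n" if "i \<in> I" for i n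
      using phi_mono[OF that] by (auto simp: h_def val_factor_def)
    let ?h = "\<lambda>n. \<Prod>i\<in>I. h i n"
    have hle: "\<bar>?h n\<bar> \<le> 1" for n
      unfolding abs_prod by (rule prod_le_1) (use h01 in \<open>auto simp: abs_of_pos less_imp_le\<close>)
    have meanh: "abel_mean (\<lambda>n. of_real (?h n * T n) * \<zeta> ^ n) 0"
    proof (rule abel_mean_uniform_limit_0)
      have "\<bar>?h n * T n\<bar> \<le> 1 * B" for n unfolding abs_mult using hle B by (intro mult_mono) auto
      thus "bounded (range (\<lambda>n. of_real (?h n * T n) * \<zeta> ^ n))"
        unfolding bounded_iff using zn by (auto simp: norm_mult norm_power simp flip: of_real_mult of_real_prod intro!: exI[of _ B])
      fix e :: real assume e: "e > 0"
      have B0: "B \<ge> 0" using B[of 0] by simp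
      have "(\<lambda>K. (\<Sum>i\<in>I. \<phi> i K) * B) \<longlonglongrightarrow> (\<Sum>i\<in>I. 0) * B"
        by (intro tendsto_intros phi(4))
      hence "eventually (\<lambda>K. (\<Sum>i\<in>I. \<phi> i K) * B < e) sequentially"
        using e by (intro order_tendstoD(2)) auto
      then obtain K where K: "(\<Sum>i\<in>I. \<phi> i K) * B < e" by (auto simp: eventually_sequentially)
      \<comment> \<open>The other primes are now truncated too, at a level K with small \<phi> i K.
        This makes the product periodic at the cost of a uniform error.\<close>
      define kk where "kk i = (if p i = P then j - 1 else K)" for i
      define gi where "gi i n = (if m i dvd n then \<phi> i (trunc_mult (p i) (kk i) n) else 1)" for i n
      define R where "R = (\<Prod>i\<in>{i\<in>I. p i \<noteq> P}. p i ^ K)"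
      \<comment> \<open>A common period of all \<open>gi\<close>. It is not divisible by P^j,
        because R involves only primes other than P and P^j does not divide M.\<close>
      define N where "N = lcm M (P ^ (j - 1) * R)"
      have R0: "R > 0" unfolding R_def using p prime_gt_0_nat by (intro prod_pos) auto
      have E0: "P ^ (j - 1) * R > 0" using R0 P1 by simp
      have N1: "N \<ge> 1" unfolding N_def using M1 E0 by (simp add: Suc_le_eq lcm_pos_nat)
      have nN: "\<not> P ^ j dvd N"
      proof
        assume "P ^ j dvd N"
        hence "P ^ j dvd P ^ (j - 1) * R"
          using prime_power_dvd_lcm[OF P, of M "P ^ (j - 1) * R" j] M1 E0 nodvd(1)[OF j] by (auto simp: N_def)
        moreover have "P ^ j = P ^ (j - 1) * P" using j1 by (cases j) auto
        ultimately have "P dvd R" using P1 by (simp add: dvd_times_left_cancel_iff)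
        then obtain i where i: "i \<in> I" "p i \<noteq> P" "P dvd p i ^ K"
          unfolding R_def using I(1) P by (subst (asm) prime_dvd_prod_iff) auto
        hence "P dvd p i" using P prime_dvd_power by blast
        thus False using i P p[OF i(1)] primes_dvd_imp_eq by blast
      qed
      have per: "gi i (n + N) = gi i n" if i: "i \<in> I" for i n
      proof -
        have "m i dvd N" using mM[OF i] by (auto simp: N_def intro: dvd_trans)
        hence "m i dvd n + N \<longleftrightarrow> m i dvd n" by (rule dvd_add_left_iff)
        moreover have "p i ^ kk i dvd N"
        proof -
          have "p i ^ kk i dvd P ^ (j - 1) * R"
          proof (cases "p i = P")
            case False
            hence "p i ^ K dvd R" unfolding R_def using I(1) i by (intro dvd_prodI) auto
            thus ?thesis using False by (simp add: kk_def)
          qed (simp add: kk_def)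
          thus ?thesis by (auto simp: N_def intro: dvd_trans)
        qed
        ultimately show ?thesis by (simp add: gi_def trunc_mult_periodic)
      qed
      define g where "g n = (of_real (\<Prod>i\<in>I. gi i n) :: complex)" for n
      have "abel_mean (\<lambda>n. g n * of_real (T n) * \<zeta> ^ n) 0"
      proof (rule abel_mean_nonresonant[OF A Q P zn z N1 nN nodvd(2)[OF j]])
        show "g (n + N) = g n" for n unfolding g_def using per by simp
      qed
      \<comment> \<open>The formula \<open>trunc_mult_eq\<close> starts at n = 1; keeping the
        original term at n = 0 makes the error bound hold for all n.\<close>
      hence "abel_mean (\<lambda>n. if n = 0 then of_real (?h n * T n) * \<zeta> ^ n else g n * of_real (T n) * \<zeta> ^ n) 0"
        by (rule abel_mean_cong) auto
      moreover have "norm (of_real (?h n * T n) * \<zeta> ^ n - (if n = 0 then of_real (?h n * T n) * \<zeta> ^ n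
          else g n * of_real (T n) * \<zeta> ^ n)) \<le> e" for n
      proof (cases "n = 0")
        case False
        hence n: "n \<ge> 1" by simp
        have "of_real (?h n * T n) * \<zeta> ^ n - g n * of_real (T n) * \<zeta> ^ n
            = of_real (((\<Prod>i\<in>I. h i n) - (\<Prod>i\<in>I. gi i n)) * T n) * \<zeta> ^ n"
          by (simp add: g_def algebra_simps)
        hence "norm (of_real (?h n * T n) * \<zeta> ^ n - g n * of_real (T n) * \<zeta> ^ n)
            = \<bar>(\<Prod>i\<in>I. h i n) - (\<Prod>i\<in>I. gi i n)\<bar> * \<bar>T n\<bar>"
          by (simp only: norm_mult norm_power zn norm_of_real abs_mult power_one mult_1_right)
        also have "\<dots> \<le> (\<Sum>i\<in>I. \<phi> i K) * B"
        proof (rule mult_mono)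
          have "\<bar>(\<Prod>i\<in>I. h i n) - (\<Prod>i\<in>I. gi i n)\<bar> \<le> (\<Sum>i\<in>I. \<bar>h i n - gi i n\<bar>)"
            using norm_prod_diff[of I "\<lambda>i. h i n" "\<lambda>i. gi i n"] h01 phi
            by (force simp: gi_def less_imp_le)
          also have "\<dots> \<le> (\<Sum>i\<in>I. \<phi> i K)"
          proof (rule sum_mono)
            fix i assume i: "i \<in> I"
            have tm: "trunc_mult (p i) k n = min (multiplicity (p i) n) k" for k
              by (rule trunc_mult_eq[OF p[OF i] n])
            show "\<bar>h i n - gi i n\<bar> \<le> \<phi> i K"
            proof (cases "m i dvd n \<and> p i \<noteq> P \<and> multiplicity (p i) n > K")
              case True
              hence "h i n - gi i n = \<phi> i (multiplicity (p i) n) - \<phi> i K"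
                by (simp add: h_def gi_def tm kk_def)
              moreover have "\<phi> i (multiplicity (p i) n) \<le> \<phi> i K" using True by (intro phi_mono[OF i]) simp
              ultimately show ?thesis using phi(1)[OF i, of "multiplicity (p i) n"] by simp
            next
              case False
              hence "h i n - gi i n = 0" by (auto simp: h_def gi_def tm kk_def min_def)
              thus ?thesis using phi(1)[OF i, of K] by simp
            qed
          qed
          finally show "\<bar>(\<Prod>i\<in>I. h i n) - (\<Prod>i\<in>I. gi i n)\<bar> \<le> (\<Sum>i\<in>I. \<phi> i K)" .
        qed (use B less_imp_le[OF phi(1)] in \<open>auto intro: sum_nonneg\<close>)
        also have "\<dots> \<le> e" using K by simp
        finally show ?thesis using False by simp
      qed (use e in simp)
      ultimately show "\<exists>g. abel_mean g 0 \<and> (\<forall>n. norm (of_real (?h n * T n) * \<zeta> ^ n - g n) \<le> e)" by blast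
    qed
    \<comment> \<open>The contradiction comes from d: it has mean 0 as a difference of two sequences
      of mean 0, yet it is nonnegative and has positive mean along a progression.\<close>
    define d where "d n = (?h n - ?H n) * T n" for n
    have "abel_mean (\<lambda>n. of_real (d n)) 0"
    proof (rule abel_mean_cong)
      show "abel_mean (\<lambda>n. of_real (?h n * T n) * \<zeta> ^ n - of_real (?H n * T n) * \<zeta> ^ n) 0"
        using abel_mean_diff[OF meanh mean0] by simp
      fix n :: nat assume n: "n \<ge> 1"
      show "of_real (?h n * T n) * \<zeta> ^ n - of_real (?H n * T n) * \<zeta> ^ n = of_real (d n)"
      proof (cases "P ^ j dvd n")
        case True
        hence "\<zeta> ^ n = 1" by (simp add: z)
        thus ?thesis by (simp add: d_def algebra_simps)
      next
        case False
        have "multiplicity P n \<le> j - 1"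
        proof (rule ccontr)
          assume "\<not> multiplicity P n \<le> j - 1"
          hence "j \<le> multiplicity P n" by simp
          thus False using False multiplicity_dvd' by blast
        qed
        hence "h i n = val_factor (p i) (m i) (\<phi> i) n" for i by (auto simp: h_def val_factor_def)
        thus ?thesis by (simp add: d_def)
      qed
    qed
    moreover have "\<not> abel_mean (\<lambda>n. of_real (d n)) 0"
    proof -
      \<comment> \<open>On the progression n0 + N s = n0 (1 + Pi s) every \<open>m i\<close>
        divides, and 1 + Pi s is prime to every \<open>p i\<close>, so no multiplicity changes and
        all factors are constant. Since P^j divides n0, the truncation is visible there.\<close>
      define n0 where "n0 = M * P ^ j"
      define Pi where "Pi = (\<Prod>i\<in>I. p i)"
      define N where "N = n0 * Pi"
      have n01: "n0 \<ge> 1" using M1 P1 by (simp add: n0_def Suc_le_eq)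
      have Pi1: "Pi \<ge> 1" unfolding Pi_def by (rule prod_ge_1) (use p prime_ge_1_nat in auto)
      have N1: "N \<ge> 1" using n01 Pi1 by (simp add: N_def Suc_le_eq)
      have mult: "multiplicity (p i) (n0 + N * s) = multiplicity (p i) n0" if i: "i \<in> I" for i s
      proof -
        have "p i dvd Pi" unfolding Pi_def using I(1) i by (intro dvd_prodI) auto
        hence nd: "\<not> p i dvd 1 + Pi * s"
          using p[OF i] by (metis dvd_add_left_iff dvd_mult2 not_prime_unit)
        have e: "n0 + N * s = n0 * (1 + Pi * s)" by (simp add: N_def algebra_simps)
        show ?thesis unfolding e by (rule multiplicity_times_coprime[OF p[OF i] _ nd]) (use n01 in simp)
      qed
      have dvds: "m i dvd n0 + N * s" if "i \<in> I" for i s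
        using mM[OF that] by (auto simp: n0_def N_def)
      define \<kappa> where "\<kappa> = ?h n0 - ?H n0"
      have dk: "d (n0 + N * s) = \<kappa> * T (n0 + N * s)" for s
      proof -
        have "h i (n0 + N * s) = h i n0" "val_factor (p i) (m i) (\<phi> i) (n0 + N * s) = val_factor (p i) (m i) (\<phi> i) n0"
          if "i \<in> I" for i
          using mult[OF that, of s] dvds[OF that, of s] dvds[OF that, of 0] by (auto simp: h_def val_factor_def)
        thus ?thesis by (simp add: d_def \<kappa>_def)
      qed
      have kpos: "\<kappa> > 0"
      proof -
        have "P ^ j dvd n0" by (simp add: n0_def)
        hence "j \<le> multiplicity P n0" using n01 P by (intro multiplicity_geI) auto
        hence "val_factor (p i0) (m i0) (\<phi> i0) n0 < h i0 n0"
          using dvds[OF I(2), of 0] j1 phi_strict[OF I(2), of "j - 1" "multiplicity P n0"]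
          by (simp add: val_factor_def h_def P_def[symmetric] min_def)
        moreover have "(\<Prod>i\<in>I - {i0}. val_factor (p i) (m i) (\<phi> i) n0) \<le> (\<Prod>i\<in>I - {i0}. h i n0)"
          using vf01 vf_le by (intro prod_mono) (auto simp: less_imp_le)
        moreover have "0 < (\<Prod>i\<in>I - {i0}. val_factor (p i) (m i) (\<phi> i) n0)"
          using vf01 by (intro prod_pos) auto
        ultimately have "val_factor (p i0) (m i0) (\<phi> i0) n0 * (\<Prod>i\<in>I - {i0}. val_factor (p i) (m i) (\<phi> i) n0)
            < h i0 n0 * (\<Prod>i\<in>I - {i0}. h i n0)"
          using vf01(1)[OF I(2), of n0] by (intro mult_less_le_imp_less) auto
        thus ?thesis unfolding \<kappa>_def prod.remove[OF I] by simp
      qed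
      \<comment> \<open>Restriction to a progression replaces the frequency w by w^N, again on the
        unit circle.\<close>
      have "exp_sum UNIV (sphere 0 1) (\<lambda>s. of_real (T (n0 + N * s)))"
      proof (rule exp_sum_cong)
        show "exp_sum UNIV (sphere 0 1) (\<lambda>s. \<Sum>w\<in>A. (a w * w ^ n0) * (w ^ N) ^ s)"
          using A(2) by (intro exp_sum_sum exp_sum_term) (auto simp: norm_power)
        show "(\<Sum>w\<in>A. (a w * w ^ n0) * (w ^ N) ^ s) = of_real (T (n0 + N * s))" for s
          using A(3)[of "n0 + N * s"] n01 by (simp add: power_add power_mult mult.assoc)
      qed
      moreover have "0 \<le> T (n0 + N * s)" "T (n0 + N * 1) \<noteq> 0" for s
        using T(2)[of "n0 + N * s"] T(2)[of "n0 + N * 1"] n01 by auto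
      ultimately obtain L where L: "L > 0" "abel_mean (\<lambda>s. of_real (T (n0 + N * s))) (of_real L)"
        using abel_mean_pos[of "\<lambda>s. T (n0 + N * s)" 1] by blast
      have "abel_mean (\<lambda>s. of_real (d (n0 + N * s))) (of_real (\<kappa> * L))"
        using abel_mean_cmult[OF L(2), of "of_real \<kappa>"] by (simp add: dk)
      moreover have "0 \<le> d n" if "n \<ge> 1" for n
        unfolding d_def using T(2)[OF that] vf01 vf_le
        by (intro mult_nonneg_nonneg) (auto intro!: prod_mono simp: less_imp_le)
      ultimately show ?thesis
        using not_abel_mean_0_of_subsequence[of d N n0 "\<kappa> * L"] N1 n01 kpos L(1) by simp
    qed
    ultimately show False by simp
  qed
qed

section \<open>The dichotomy\<close>

text \<open>The two parts serve the two outcomes. An exponential sum with integer coefficients gives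
  rationality. The factorisation isolates the growth W^n, a positive part T with frequencies on the
  unit circle, and a correction tending to 1 that takes up the frequencies of smaller modulus. Both
  parts survive products.\<close>

definition regular_factor :: "(nat \<Rightarrow> real) \<Rightarrow> bool" where
  "regular_factor f \<longleftrightarrow> exp_sum \<int> UNIV (\<lambda>n. of_real (f n)) \<and>
     (\<exists>W>0. \<exists>T e. (\<forall>n\<ge>1. f n = W ^ n * T n * e n) \<and>
        exp_sum UNIV (sphere 0 1) (\<lambda>n. of_real (T n)) \<and> (\<forall>n\<ge>1. T n > 0) \<and> e \<longlonglongrightarrow> 1)"

definition singular_factor :: "(nat \<Rightarrow> real) \<Rightarrow> bool" where
  "singular_factor f \<longleftrightarrow> (\<exists>q m \<phi>. Factorial_Ring.prime q \<and> m \<ge> 1 \<and> (\<forall>a. 0 < \<phi> a) \<and> (\<forall>a. \<phi> a < 1) \<and>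
     (\<forall>a. \<phi> (Suc a) < \<phi> a) \<and> \<phi> \<longlonglongrightarrow> 0 \<and> (\<forall>n\<ge>1. f n = val_factor q m \<phi> n))"

lemma exp_sum_one: "1 \<in> C \<Longrightarrow> 1 \<in> \<Omega> \<Longrightarrow> exp_sum C \<Omega> (\<lambda>n. 1)"
  using exp_sum_term[of 1 C 1 \<Omega>] by simp

lemma regular_factorI:
  assumes "exp_sum \<int> UNIV (\<lambda>n. of_real (f n))" "W > 0" "\<And>n. n \<ge> 1 \<Longrightarrow> f n = W ^ n * T n * e n"
    "exp_sum UNIV (sphere 0 1) (\<lambda>n. of_real (T n))" "\<And>n. n \<ge> 1 \<Longrightarrow> T n > 0" "e \<longlonglongrightarrow> 1"
  shows "regular_factor f"
  using assms unfolding regular_factor_def by blast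

lemma regular_factor_cong: "regular_factor f \<Longrightarrow> (\<And>n. n \<ge> 1 \<Longrightarrow> f n = g n) \<Longrightarrow> regular_factor g"
proof -
  assume f: "regular_factor f" and eq: "\<And>n. n \<ge> 1 \<Longrightarrow> f n = g n"
  have "exp_sum \<int> UNIV (\<lambda>n. of_real (g n))"
    by (rule exp_sum_cong[where f = "\<lambda>n. of_real (f n)"]) (use f eq in \<open>auto simp: regular_factor_def\<close>)
  thus ?thesis using f eq unfolding regular_factor_def by simp
qed

lemma regular_factor_power_real:
  assumes "W > 0"
  shows "exp_sum \<int> UNIV (\<lambda>n. of_real (W ^ n))" "regular_factor (\<lambda>n. W ^ n)"
proof -
  show 1: "exp_sum \<int> UNIV (\<lambda>n. of_real (W ^ n))"
    using exp_sum_term[of 1 \<int> "of_real W" UNIV] by simp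
  show "regular_factor (\<lambda>n. W ^ n)"
    by (rule regular_factorI[OF 1 assms, of "\<lambda>n. 1" "\<lambda>n. 1"]) (auto intro: exp_sum_one)
qed

lemma regular_factor_1: "regular_factor (\<lambda>n. 1)"
  using regular_factor_power_real(2)[of 1] by simp

lemma regular_factor_mult:
  assumes "regular_factor f" "regular_factor g"
  shows "regular_factor (\<lambda>n. f n * g n)"
proof -
  obtain W T e where f: "exp_sum \<int> UNIV (\<lambda>n. of_real (f n))" "W > 0" "\<And>n. n \<ge> 1 \<Longrightarrow> f n = W ^ n * T n * e n"
    "exp_sum UNIV (sphere 0 1) (\<lambda>n. of_real (T n))" "\<And>n. n \<ge> 1 \<Longrightarrow> T n > 0" "e \<longlonglongrightarrow> 1"
    using assms(1) unfolding regular_factor_def by blast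
  obtain W' T' e' where g: "exp_sum \<int> UNIV (\<lambda>n. of_real (g n))" "W' > 0" "\<And>n. n \<ge> 1 \<Longrightarrow> g n = W' ^ n * T' n * e' n"
    "exp_sum UNIV (sphere 0 1) (\<lambda>n. of_real (T' n))" "\<And>n. n \<ge> 1 \<Longrightarrow> T' n > 0" "e' \<longlonglongrightarrow> 1"
    using assms(2) unfolding regular_factor_def by blast
  show ?thesis
  proof (rule regular_factorI)
    show "exp_sum \<int> UNIV (\<lambda>n. of_real (f n * g n))"
      using exp_sum_mult[OF _ _ f(1) g(1)] by simp
    show "W * W' > 0" using f g by simp
    show "f n * g n = (W * W') ^ n * (T n * T' n) * (e n * e' n)" if "n \<ge> 1" for n
      using f(3) g(3) that by (simp add: power_mult_distrib)
    show "exp_sum UNIV (sphere 0 1) (\<lambda>n. of_real (T n * T' n))"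
      using exp_sum_mult[OF _ _ f(4) g(4)] by (simp add: norm_mult)
    show "T n * T' n > 0" if "n \<ge> 1" for n using f(5) g(5) that by simp
    show "(\<lambda>n. e n * e' n) \<longlonglongrightarrow> 1" using tendsto_mult[OF f(6) g(6)] by simp
  qed
qed

lemma regular_factor_prod: "(\<And>i. i \<in> I \<Longrightarrow> regular_factor (f i)) \<Longrightarrow> regular_factor (\<lambda>n. \<Prod>i\<in>I. f i n)"
  by (induction I rule: infinite_finite_induct) (auto intro: regular_factor_mult regular_factor_1)

lemma regular_factor_pow: "regular_factor f \<Longrightarrow> regular_factor (\<lambda>n. f n ^ k)"
  using regular_factor_prod[of "{..<k}" "\<lambda>_. f"] by simp

text \<open>As x is real and neither 1 nor -1, one of 1 and x^n dominates, so the sign of x^n - 1 is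
  explicit: for |x| > 1 it is the n-th power of the sign of x.\<close>

lemma regular_factor_real_root:
  assumes z: "\<And>n. n \<ge> 1 \<Longrightarrow> x ^ n \<noteq> (1::real)"
  shows "regular_factor (\<lambda>n. \<bar>x ^ n - 1\<bar>)"
proof -
  have x2: "x ^ 2 \<noteq> 1" using z[of 2] by simp
  hence "\<bar>x\<bar> \<noteq> 1" by (auto simp: abs_if power2_eq_square split: if_splits)
  then consider "\<bar>x\<bar> < 1" | "\<bar>x\<bar> > 1" by linarith
  thus ?thesis
  proof cases
    case 1
    have eq: "\<bar>x ^ n - 1\<bar> = 1 - x ^ n" for n
    proof -
      have "\<bar>x ^ n\<bar> \<le> 1" using 1 by (simp add: power_abs power_le_one)
      thus ?thesis by simp
    qed
    have "exp_sum \<int> UNIV (\<lambda>n. 1 + (- 1) * of_real x ^ n)"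
      by (intro exp_sum_add exp_sum_one exp_sum_term) auto
    hence "exp_sum \<int> UNIV (\<lambda>n. of_real \<bar>x ^ n - 1\<bar>)" by (simp add: eq)
    moreover have "(\<lambda>n. 1 - x ^ n) \<longlonglongrightarrow> 1 - 0" using 1 by (intro tendsto_diff tendsto_const LIMSEQ_power_zero) simp
    ultimately show ?thesis
      by (intro regular_factorI[of _ 1 "\<lambda>n. 1" "\<lambda>n. 1 - x ^ n"]) (auto simp: eq intro: exp_sum_one)
  next
    case 2
    have x0: "x \<noteq> 0" using 2 by auto
    have eq: "\<bar>x ^ n - 1\<bar> = \<bar>x\<bar> ^ n - (x / \<bar>x\<bar>) ^ n" if "n \<ge> 1" for n
    proof -
      have "\<bar>x\<bar> ^ n > 1" using 2 that by (intro one_less_power) auto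
      moreover have "(x / \<bar>x\<bar>) ^ n * \<bar>x\<bar> ^ n = x ^ n" using x0 by (simp flip: power_mult_distrib)
      moreover have "(x / \<bar>x\<bar>) ^ n = 1 \<or> (x / \<bar>x\<bar>) ^ n = -1"
      proof (cases "x > 0")
        case False
        hence "x / \<bar>x\<bar> = -1" using x0 by simp
        thus ?thesis by (simp add: minus_one_power_iff)
      qed simp
      ultimately show ?thesis by auto
    qed
    have "exp_sum \<int> UNIV (\<lambda>n. 1 * of_real \<bar>x\<bar> ^ n + (- 1) * of_real (x / \<bar>x\<bar>) ^ n)"
      by (intro exp_sum_add exp_sum_term) auto
    hence "exp_sum \<int> UNIV (\<lambda>n. of_real \<bar>x ^ n - 1\<bar>)" by (rule exp_sum_cong[rotated]) (simp add: eq)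
    moreover have "(\<lambda>n. 1 - (1 / x) ^ n) \<longlonglongrightarrow> 1 - 0"
      using 2 by (intro tendsto_diff tendsto_const LIMSEQ_power_zero) simp
    moreover have "\<bar>x ^ n - 1\<bar> = \<bar>x\<bar> ^ n * 1 * (1 - (1 / x) ^ n)" if "n \<ge> 1" for n
    proof -
      have "x / \<bar>x\<bar> = \<bar>x\<bar> * (1 / x)" using x0 by (simp add: field_simps)
      hence "(x / \<bar>x\<bar>) ^ n = \<bar>x\<bar> ^ n * (1 / x) ^ n" by (simp only: power_mult_distrib)
      thus ?thesis using eq[OF that] by (simp add: right_diff_distrib)
    qed
    ultimately show ?thesis
      using 2 by (intro regular_factorI[of _ "\<bar>x\<bar>" "\<lambda>n. 1" "\<lambda>n. 1 - (1 / x) ^ n"]) (auto intro: exp_sum_one)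
  qed
qed

text \<open>The square expands to |z|^(2n) - z^n - cnj(z)^n + 1. On the unit circle T is the whole
  function; otherwise a single frequency dominates and T = 1.\<close>

lemma regular_factor_complex_root:
  assumes z: "\<And>n. n \<ge> 1 \<Longrightarrow> z ^ n \<noteq> (1::complex)"
  shows "regular_factor (\<lambda>n. (cmod (z ^ n - 1))\<^sup>2)"
proof -
  have sq: "of_real ((cmod (z ^ n - 1))\<^sup>2) = (1 * (z * cnj z) ^ n + (- 1) * z ^ n) + ((- 1) * cnj z ^ n + 1 * 1 ^ n)" for n
    unfolding complex_norm_square by (simp add: algebra_simps power_mult_distrib)
  have es: "exp_sum \<int> UNIV (\<lambda>n. of_real ((cmod (z ^ n - 1))\<^sup>2))"
    unfolding sq by (intro exp_sum_add exp_sum_term) auto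
  have pos: "(cmod (z ^ n - 1))\<^sup>2 > 0" if "n \<ge> 1" for n using z[OF that] by simp
  consider "cmod z < 1" | "cmod z = 1" | "cmod z > 1" by linarith
  thus ?thesis
  proof cases
    case 1
    have "(\<lambda>n. (cmod (z ^ n - 1))\<^sup>2) \<longlonglongrightarrow> (cmod (0 - 1))\<^sup>2"
      using 1 by (intro tendsto_intros LIMSEQ_power_zero)
    thus ?thesis
      by (intro regular_factorI[OF es, of 1 "\<lambda>n. 1" "\<lambda>n. (cmod (z ^ n - 1))\<^sup>2"]) (auto intro: exp_sum_one)
  next
    case 2
    have "exp_sum UNIV (sphere 0 1) (\<lambda>n. of_real ((cmod (z ^ n - 1))\<^sup>2))"
      unfolding sq using 2 by (intro exp_sum_add exp_sum_term) (auto simp: norm_mult)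
    thus ?thesis
      by (intro regular_factorI[OF es, of 1 "\<lambda>n. (cmod (z ^ n - 1))\<^sup>2" "\<lambda>n. 1"]) (use pos in auto)
  next
    case 3
    have z0: "z \<noteq> 0" using 3 by auto
    have "(\<lambda>n. (cmod (1 - (1 / z) ^ n))\<^sup>2) \<longlonglongrightarrow> (cmod (1 - 0))\<^sup>2"
      using 3 by (intro tendsto_intros LIMSEQ_power_zero) (simp add: norm_divide divide_less_eq)
    moreover have "(cmod (z ^ n - 1))\<^sup>2 = ((cmod z)\<^sup>2) ^ n * 1 * (cmod (1 - (1 / z) ^ n))\<^sup>2" for n
    proof -
      have "z ^ n - 1 = z ^ n * (1 - (1 / z) ^ n)" using z0 by (simp add: right_diff_distrib power_divide)
      thus ?thesis by (simp add: norm_mult norm_power power_mult_distrib power_mult[symmetric] mult.commute)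
    qed
    ultimately show ?thesis
      using z0 by (intro regular_factorI[OF es, of "(cmod z)\<^sup>2" "\<lambda>n. 1" "\<lambda>n. (cmod (1 - (1 / z) ^ n))\<^sup>2"])
        (auto intro: exp_sum_one)
  qed
qed

text \<open>This is where the parity of the local degree enters: for non-real z an even power of the
  modulus is a power of its square.\<close>

lemma regular_factor_root:
  assumes z: "\<And>n. n \<ge> 1 \<Longrightarrow> z ^ n \<noteq> (1::complex)" and d: "Im z \<noteq> 0 \<Longrightarrow> even d"
  shows "regular_factor (\<lambda>n. cmod (z ^ n - 1) ^ d)"
proof (cases "Im z = 0")
  case True
  hence zr: "z = of_real (Re z)" by (simp add: complex_eq_iff)
  have "Re z ^ n \<noteq> 1" if "n \<ge> 1" for n using z[OF that] zr by (metis of_real_1 of_real_power)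
  moreover have "cmod (z ^ n - 1) = \<bar>Re z ^ n - 1\<bar>" for n
    by (subst zr) (metis norm_of_real of_real_1 of_real_diff of_real_power)
  ultimately show ?thesis using regular_factor_pow[OF regular_factor_real_root] by simp
next
  case False
  then obtain k where "d = 2 * k" using d by auto
  thus ?thesis using regular_factor_pow[OF regular_factor_complex_root[OF z], of k]
    by (simp add: power_mult)
qed

lemma singular_factor_pow:
  assumes "singular_factor f" "d \<ge> 1"
  shows "singular_factor (\<lambda>n. f n ^ d)"
proof -
  obtain q m \<phi> where f: "Factorial_Ring.prime q" "m \<ge> 1" "\<And>a. 0 < \<phi> a" "\<And>a. \<phi> a < 1"
     "\<And>a. \<phi> (Suc a) < \<phi> a" "\<phi> \<longlonglongrightarrow> 0" "\<And>n. n \<ge> 1 \<Longrightarrow> f n = val_factor q m \<phi> n"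
    using assms(1) unfolding singular_factor_def by blast
  have "\<phi> a ^ d < 1" for a using f(3,4)[of a] assms(2) by (simp add: power_less_one_iff less_imp_le)
  moreover have "\<phi> (Suc a) ^ d < \<phi> a ^ d" for a
    using f(3,5) assms(2) by (intro power_strict_mono) (auto intro: less_imp_le)
  moreover have "(\<lambda>a. \<phi> a ^ d) \<longlonglongrightarrow> 0" using tendsto_power[OF f(6), of d] assms(2) by (simp add: power_0_left)
  moreover have "f n ^ d = val_factor q m (\<lambda>a. \<phi> a ^ d) n" if "n \<ge> 1" for n
    using f(7)[OF that] by (simp add: val_factor_def)
  ultimately show ?thesis unfolding singular_factor_def using f(1-3)
    by (intro exI[of _ q] exI[of _ m] exI[of _ "\<lambda>a. \<phi> a ^ d"]) auto
qed

text \<open>The singular factors together with T have a nonvanishing mean against \<zeta>^n. The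
  correction e tends to 1, so it changes the coefficients by a null sequence, which has mean
  0.\<close>

theorem natural_boundary_of_singular_factor:
  assumes I: "finite I" "i0 \<in> I" "singular_factor (f i0)"
    and f: "\<And>i. i \<in> I \<Longrightarrow> regular_factor (f i) \<or> singular_factor (f i)"
  shows "has_natural_boundary (zeta_fps (\<lambda>n. of_real (\<Prod>i\<in>I. f i n)))"
proof -
  define S where "S = {i \<in> I. singular_factor (f i)}"
  have S: "finite S" "i0 \<in> S" "S \<subseteq> I" using I by (auto simp: S_def)
  define D where "D i q m \<phi> \<longleftrightarrow> Factorial_Ring.prime q \<and> m \<ge> 1 \<and> (\<forall>a. 0 < \<phi> a) \<and> (\<forall>a. \<phi> a < 1) \<and>
     (\<forall>a. \<phi> (Suc a) < \<phi> a) \<and> \<phi> \<longlonglongrightarrow> 0 \<and> (\<forall>n\<ge>1. f i n = val_factor q m \<phi> n)" for i q m \<phi>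
  \<comment> \<open>The three parameters of a singular factor are packed into one triple, so that
    one choice function provides them.\<close>
  have "\<forall>i\<in>S. \<exists>t. D i (fst t) (fst (snd t)) (snd (snd t))"
  proof
    fix i assume "i \<in> S"
    then obtain q m \<phi> where "D i q m \<phi>" unfolding S_def singular_factor_def D_def by blast
    thus "\<exists>t. D i (fst t) (fst (snd t)) (snd (snd t))" by (intro exI[of _ "(q, m, \<phi>)"]) simp
  qed
  then obtain t where t: "\<And>i. i \<in> S \<Longrightarrow> D i (fst (t i)) (fst (snd (t i))) (snd (snd (t i)))" by metis
  define q m \<phi> where "q i = fst (t i)" and "m i = fst (snd (t i))" and "\<phi> i = snd (snd (t i))" for i
  have s: "\<And>i. i \<in> S \<Longrightarrow> Factorial_Ring.prime (q i)" "\<And>i. i \<in> S \<Longrightarrow> m i \<ge> 1"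
    "\<And>i a. i \<in> S \<Longrightarrow> 0 < \<phi> i a" "\<And>i a. i \<in> S \<Longrightarrow> \<phi> i a < 1" "\<And>i a. i \<in> S \<Longrightarrow> \<phi> i (Suc a) < \<phi> i a"
    "\<And>i. i \<in> S \<Longrightarrow> \<phi> i \<longlonglongrightarrow> 0" "\<And>i n. i \<in> S \<Longrightarrow> n \<ge> 1 \<Longrightarrow> f i n = val_factor (q i) (m i) (\<phi> i) n"
    using t unfolding D_def q_def m_def \<phi>_def by blast+
  have "regular_factor (\<lambda>n. \<Prod>i\<in>I - S. f i n)"
    using f by (intro regular_factor_prod) (auto simp: S_def)
  then obtain W T e where r: "W > 0" "\<And>n. n \<ge> 1 \<Longrightarrow> (\<Prod>i\<in>I - S. f i n) = W ^ n * T n * e n"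
    "exp_sum UNIV (sphere 0 1) (\<lambda>n. of_real (T n))" "\<And>n. n \<ge> 1 \<Longrightarrow> T n > 0" "e \<longlonglongrightarrow> (1::real)"
    unfolding regular_factor_def by blast
  define H where "H n = (\<Prod>i\<in>S. val_factor (q i) (m i) (\<phi> i) n)" for n
  have vf: "0 \<le> val_factor (q i) (m i) (\<phi> i) n" "val_factor (q i) (m i) (\<phi> i) n \<le> 1" if "i \<in> S" for i n
    using s(3,4)[OF that] by (auto simp: val_factor_def less_imp_le)
  have H: "\<bar>H n\<bar> \<le> 1" for n
    unfolding H_def abs_prod by (rule prod_le_1) (use vf in auto)
  obtain A :: "complex set" and a where A: "finite A" "A \<subseteq> sphere 0 1"
    "\<And>n. n \<ge> 1 \<Longrightarrow> of_real (T n) = (\<Sum>w\<in>A. a w * w ^ n)"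
    by (rule exp_sum_finite_support[OF r(3)]) blast
  have "bounded (range (\<lambda>n. of_real (T n) :: complex))"
    using abel_mean_exp_sum[OF A] by (rule abel_mean_bounded)
  then obtain B where B: "\<And>n. \<bar>T n\<bar> \<le> B" unfolding bounded_iff by auto
  have HT: "\<bar>H n * T n\<bar> \<le> B" for n
    unfolding abs_mult using mult_mono[OF H B] by simp
  have B0: "B \<ge> 0" using B[of 0] by simp
  obtain E where E: "\<And>n. \<bar>e n\<bar> \<le> E"
    using convergent_imp_bounded[OF r(5)] unfolding bounded_iff by auto
  define b where "b n = (of_real (H n * T n * e n) :: complex)" for n
  have "\<exists>J. \<forall>j\<ge>J. \<forall>\<zeta>. norm \<zeta> = 1 \<and> (\<forall>l. \<zeta> ^ l = 1 \<longleftrightarrow> q i0 ^ j dvd l) \<longrightarrow>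
      \<not> abel_mean (\<lambda>n. of_real (H n * T n) * \<zeta> ^ n) 0"
    unfolding H_def
    by (rule abel_mean_val_factors_nonzero[of S i0 q m \<phi> T])
       (fact S s(1-6) r(3,4))+
  then obtain J where J: "\<And>j \<zeta>. j \<ge> J \<Longrightarrow> norm \<zeta> = 1 \<Longrightarrow> (\<And>l. \<zeta> ^ l = 1 \<longleftrightarrow> q i0 ^ j dvd l) \<Longrightarrow>
      \<not> abel_mean (\<lambda>n. of_real (H n * T n) * \<zeta> ^ n) 0" by blast
  show ?thesis
  proof (rule natural_boundary_criterion[OF r(1)])
    have "\<bar>H n * T n * e n\<bar> \<le> B * E" for n
      unfolding abs_mult[of "H n * T n"] using HT E B0 by (intro mult_mono) auto
    thus "bounded (range b)" unfolding bounded_iff b_def by (auto simp del: of_real_mult)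
    fix n :: nat assume n: "n \<ge> 1"
    have "(\<Prod>i\<in>I. f i n) = (\<Prod>i\<in>I - S. f i n) * (\<Prod>i\<in>S. f i n)"
      using I(1) S(3) by (simp add: prod.subset_diff)
    also have "(\<Prod>i\<in>S. f i n) = H n" unfolding H_def using s(7) n by simp
    finally show "of_real (\<Prod>i\<in>I. f i n) = of_real W ^ n * b n" by (simp add: r(2)[OF n] b_def mult_ac)
  next
    fix x :: complex and d :: real assume x: "norm x = 1" "d > 0"
    obtain j \<zeta> where z: "j \<ge> J" "\<And>l. \<zeta> ^ l = 1 \<longleftrightarrow> q i0 ^ j dvd l" "norm \<zeta> = 1" "\<zeta> \<noteq> x" "dist \<zeta> x < d"
      using primitive_roots_dense[OF s(1)[OF S(2)] x, of J] by blast
    have "\<not> abel_mean (\<lambda>n. b n * \<zeta> ^ n) 0"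
    proof
      assume 1: "abel_mean (\<lambda>n. b n * \<zeta> ^ n) 0"
      have 2: "abel_mean (\<lambda>n. of_real (H n * T n * (e n - 1)) * \<zeta> ^ n) 0"
      proof (rule abel_mean_null_seq, rule Lim_null_comparison)
        show "\<forall>\<^sub>F n in sequentially. norm (of_real (H n * T n * (e n - 1)) * \<zeta> ^ n) \<le> B * \<bar>e n - 1\<bar>"
        proof (intro always_eventually allI)
          fix n
          have "norm (of_real (H n * T n * (e n - 1)) * \<zeta> ^ n) = \<bar>H n * T n\<bar> * \<bar>e n - 1\<bar>"
            by (simp only: norm_mult norm_power z(3) norm_of_real abs_mult power_one mult_1_right)
          also have "\<dots> \<le> B * \<bar>e n - 1\<bar>" by (intro mult_right_mono HT) auto
          finally show "norm (of_real (H n * T n * (e n - 1)) * \<zeta> ^ n) \<le> B * \<bar>e n - 1\<bar>" .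
        qed
        have "(\<lambda>n. B * \<bar>e n - 1\<bar>) \<longlonglongrightarrow> B * \<bar>1 - 1\<bar>" by (intro tendsto_intros r(5))
        thus "(\<lambda>n. B * \<bar>e n - 1\<bar>) \<longlonglongrightarrow> 0" by simp
      qed
      have "abel_mean (\<lambda>n. of_real (H n * T n) * \<zeta> ^ n) 0"
        by (rule abel_mean_cong[OF abel_mean_diff[OF 1 2, simplified]]) (simp add: b_def algebra_simps)
      thus False using J[OF z(1,3,2)] by blast
    qed
    thus "\<exists>\<zeta>. norm \<zeta> = 1 \<and> \<zeta> \<noteq> x \<and> dist \<zeta> x < d \<and> \<not> abel_mean (\<lambda>n. b n * \<zeta> ^ n) 0"
      using z by blast
  qed
qed

section \<open>The local factors of a number field, and their product\<close>

lemma archimedean_factor_regular: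
  assumes "number_field K" "v \<in> archimedean_places K" "x \<in> K" "\<not> root_of_unity x"
  shows "regular_factor (\<lambda>n. v (x ^ n - 1) ^ local_degree K v)"
proof -
  obtain bs where bs: "set bs \<subseteq> K" "K = rat_span bs" using number_field_rat_span[OF assms(1)] .
  interpret archimedean_place K v
    using assms(1,2)
    by (intro archimedean_place.intro valued_subfield.intro archimedean_place_axioms.intro)
       (auto simp: number_field_def archimedean_places_def)
  obtain z where z: "\<And>p. v (poly (map_poly of_rat p) x) = cmod (poly (map_poly of_rat p) z)"
    "Im z \<noteq> 0 \<Longrightarrow> even (local_degree K v)"
    by (rule archimedean_embedding[OF bs assms(3)]) blast
  have val: "v (x ^ n - 1) = cmod (z ^ n - 1)" for n
  proof -
    show ?thesis using z(1)[of "Polynomial.monom 1 n - 1"] by (simp add: poly_monom map_poly_of_rat_diff map_poly_monom)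
  qed
  \<comment> \<open>z inherits from x that it is no root of unity, because v vanishes only at
    0.\<close>
  have "z ^ n \<noteq> 1" if "n \<ge> 1" for n
  proof
    assume "z ^ n = 1"
    hence "v (x ^ n - 1) = 0" by (simp add: val)
    hence "x ^ n = 1" using assms(3) by (simp add: diff_mem power_mem)
    thus False using assms(4) that by (auto simp: root_of_unity_def)
  qed
  thus ?thesis unfolding val using z(2) by (rule regular_factor_root)
qed

text \<open>If |x| differs from 1, the larger of 1 and |x|^n is the absolute value of x^n - 1 by the
  ultrametric inequality; units are covered by \<open>unit_power_minus_one\<close>. Positivity of
  the local degree keeps the power of a singular factor singular.\<close>

lemma finite_place_factor:
  assumes "number_field K" "v \<in> finite_places K" "x \<in> K" "\<not> root_of_unity x"
  shows "v x = 1 \<Longrightarrow> singular_factor (\<lambda>n. v (x ^ n - 1) ^ local_degree K v)"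
    and "v x \<noteq> 1 \<Longrightarrow> regular_factor (\<lambda>n. v (x ^ n - 1) ^ local_degree K v)"
proof -
  obtain bs where bs: "set bs \<subseteq> K" "K = rat_span bs" using number_field_rat_span[OF assms(1)] .
  obtain p where p: "Factorial_Ring.prime p" "v \<in> places_over K p"
    using assms(2) by (auto simp: finite_places_def)
  interpret padic_place K v p
    using assms(1) p
    by (intro padic_place.intro valued_subfield.intro padic_place_axioms.intro)
       (auto simp: number_field_def places_over_def)
  show "singular_factor (\<lambda>n. v (x ^ n - 1) ^ local_degree K v)" if vx: "v x = 1"
  proof (rule singular_factor_pow)
    obtain m \<phi> where "m \<ge> 1" "\<And>a. 0 < \<phi> a" "\<And>a. \<phi> a < 1" "\<And>a. \<phi> (Suc a) < \<phi> a" "\<phi> \<longlonglongrightarrow> 0"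
      "\<And>n. n \<ge> 1 \<Longrightarrow> v (x ^ n - 1) = (if m dvd n then \<phi> (multiplicity p n) else 1)"
      by (rule unit_power_minus_one[OF bs(2) assms(3) vx assms(4)]) blast
    thus "singular_factor (\<lambda>n. v (x ^ n - 1))"
      unfolding singular_factor_def val_factor_def using p(1) by blast
    show "local_degree K v \<ge> 1" using local_degree_pos[OF bs] by simp
  qed
  show "regular_factor (\<lambda>n. v (x ^ n - 1) ^ local_degree K v)" if vx: "v x \<noteq> 1"
  proof (rule regular_factor_pow)
    consider "v x < 1" | "v x > 1" using vx by linarith
    thus "regular_factor (\<lambda>n. v (x ^ n - 1))"
    proof cases
      case 1
      show ?thesis
        by (rule regular_factor_cong[OF regular_factor_1]) (use v_power_minus_one_small[OF assms(3) 1] in simp)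
    next
      case 2
      show ?thesis
        by (rule regular_factor_cong[OF regular_factor_power_real(2)[of "v x"]])
           (use v_power_minus_one_large[OF assms(3) 2] 2 in auto)
    qed
  qed
qed

theorem theorem4p6:
  fixes k :: nat
    and K :: "nat \<Rightarrow> 'a::field_char_0 set"
    and \<xi> :: "nat \<Rightarrow> 'a"
    and S :: "nat \<Rightarrow> ('a \<Rightarrow> real) set"
    and c :: "nat \<Rightarrow> nat \<Rightarrow> real"
    and Z :: "complex fps"
  assumes "\<And>j. j \<in> {1..k} \<Longrightarrow> number_field (K j)"
    and "\<And>j. j \<in> {1..k} \<Longrightarrow> \<xi> j \<in> K j"
    and "\<And>j. j \<in> {1..k} \<Longrightarrow> \<not> root_of_unity (\<xi> j)"
    and "\<And>j. j \<in> {1..k} \<Longrightarrow> finite (S j)"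
    and "\<And>j. j \<in> {1..k} \<Longrightarrow> S j \<subseteq> finite_places (K j)"
  defines "c \<equiv> \<lambda>j n. place_product (K j) (S j) (\<xi> j) n"
    and "Z \<equiv> zeta_series (\<lambda>n. \<Prod>j=1..k. c j n)"
  shows "(rational_series Z \<or> has_natural_boundary Z) \<and>
         \<not> (rational_series Z \<and> has_natural_boundary Z) \<and>
         (has_natural_boundary Z \<longleftrightarrow> (\<exists>j\<in>{1..k}. \<exists>v\<in>S j. v (\<xi> j) = 1))"
proof -
  \<comment> \<open>Pairs flatten the double product and keep apart factors at the same place that
    belong to different j.\<close>
  define I where "I = (SIGMA j:{1..k}. archimedean_places (K j) \<union> S j)"
  define f where "f = (\<lambda>(j, v) n. v (\<xi> j ^ n - 1) ^ local_degree (K j) v)"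
  have fin: "finite (archimedean_places (K j) \<union> S j)" if "j \<in> {1..k}" for j
    using finite_archimedean_places[OF assms(1)[OF that]] assms(4)[OF that] by simp
  have finI: "finite I" unfolding I_def using fin by (intro finite_SigmaI) auto
  have "(\<Prod>j=1..k. c j n) = (\<Prod>i\<in>I. f i n)" for n
    unfolding c_def place_product_def I_def f_def
    by (subst prod.Sigma) (use fin in \<open>auto simp: case_prod_unfold\<close>)
  hence Z: "Z = zeta_fps (\<lambda>n. of_real (\<Prod>i\<in>I. f i n))" by (simp add: Z_def zeta_series_eq)
  have arch: "regular_factor (f (j, v))" if "j \<in> {1..k}" "v \<in> archimedean_places (K j)" for j v
    using archimedean_factor_regular[OF assms(1)[OF that(1)] that(2) assms(2,3)[OF that(1)]] by (simp add: f_def)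
  have unit: "singular_factor (f (j, v))" if "j \<in> {1..k}" "v \<in> S j" "v (\<xi> j) = 1" for j v
    using finite_place_factor(1)[of "K j" v "\<xi> j"] assms(1-3,5)[OF that(1)] that(2,3)
    by (auto simp: f_def)
  have nonunit: "regular_factor (f (j, v))" if "j \<in> {1..k}" "v \<in> S j" "v (\<xi> j) \<noteq> 1" for j v
    using finite_place_factor(2)[of "K j" v "\<xi> j"] assms(1-3,5)[OF that(1)] that(2,3)
    by (auto simp: f_def)
  have "has_natural_boundary Z" if "\<exists>j\<in>{1..k}. \<exists>v\<in>S j. v (\<xi> j) = 1"
  proof -
    from that obtain j v where jv: "j \<in> {1..k}" "v \<in> S j" "v (\<xi> j) = 1" by blast
    show ?thesis unfolding Z
    proof (rule natural_boundary_of_singular_factor[of I "(j, v)" f])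
      show "finite I" by (rule finI)
      show "singular_factor (f (j, v))" by (rule unit[OF jv])
      show "(j, v) \<in> I" using jv by (simp add: I_def)
      show "regular_factor (f i) \<or> singular_factor (f i)" if iI: "i \<in> I" for i
      proof -
        obtain j v where i: "i = (j, v)" "j \<in> {1..k}" "v \<in> archimedean_places (K j) \<or> v \<in> S j"
          using iI unfolding I_def by blast
        show ?thesis unfolding i(1) using i(2,3) arch unit nonunit by blast
      qed
    qed
  qed
  moreover have "rational_series Z" if "\<not> (\<exists>j\<in>{1..k}. \<exists>v\<in>S j. v (\<xi> j) = 1)"
  proof -
    have "regular_factor (f i)" if iI: "i \<in> I" for i
    proof -
      obtain j v where i: "i = (j, v)" "j \<in> {1..k}" "v \<in> archimedean_places (K j) \<or> v \<in> S j"
        using iI unfolding I_def by blast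
      show ?thesis unfolding i(1)
        using i(2,3) arch nonunit \<open>\<not> (\<exists>j\<in>{1..k}. \<exists>v\<in>S j. v (\<xi> j) = 1)\<close> by blast
    qed
    hence "regular_factor (\<lambda>n. \<Prod>i\<in>I. f i n)" by (rule regular_factor_prod)
    thus ?thesis unfolding Z regular_factor_def by (blast intro: rational_zeta_exp_sum)
  qed
  \<comment> \<open>A rational series has no natural boundary, so the two implications settle the
    dichotomy and the equivalence at once.\<close>
  ultimately show ?thesis using rational_not_natural_boundary[of Z] by blast
qed

end
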